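(* Let $n,d$ be positive integers and let $L_1,\dots,L_n$ be linear subspaces of $\mathbb{R}^d$ of positive dimension, with $l_i=\dim L_i$. Let $k_1,\dots,k_n$ be positive integers, put $m_i=l_i+k_i-1$ and $M=\sum_{i=1}^n m_i$. Let $G$ be the group of permutations $g$ of $[n]=\{1,\dots,n\}$ such that $L_{g(i)}=L_i$ and $k_{g(i)}=k_i$ for all $i$. Suppose that $$N:=\frac{1}{|G|}\binom{M}{m_1,\dots,m_n}\prod_{i=1}^n S(m_i,k_i)\equiv 1 \pmod 2 .$$ Then for any $M$ finite Borel measures $\mu_1,\dots,\mu_M$ on $\mathbb{R}^d$ there exist unit vectors $v_1\in L_1,\dots,v_n\in L_n$ and families $\mathcal F_1,\dots,\mathcal F_n$ of (generalized) oriented hyperplanes such that for each $i$, $|\mathcal F_i|=k_i$ (counted with multiplicity) and every member of $\mathcal F_i$ is orthogonal to $v_i$, and the chessboard coloring induced by $\bigcup_{i=1}^n\mathcal F_i$ bisects each of $\mu_1,\dots,\mu_M$.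
   Context: $S(m,k)$ is the Stirling number of the second kind (number of partitions of an $m$-element set into $k$ nonempty blocks), and $\binom{M}{m_1,\dots,m_n}$ is the multinomial coefficient. A (generalized) oriented hyperplane is given by an affine function $a(x)=\langle x,w\rangle+c$ with $(w,c)\neq 0$, up to multiplication by a positive scalar; if $w\ne 0$ it is a genuine hyperplane $\{a=0\}$, and if $w=0$ it is degenerate ("at infinity", $a$ a nonzero constant). Such a hyperplane is orthogonal to a vector $v$ if $w\in\operatorname{span}(v)$ (degenerate ones are orthogonal to every vector). For a finite family with affine functions $a_1,\dots,a_r$, let $p=\prod_j a_j$; its chessboard coloring is the pair $A=\{x:p(x)\ge 0\}$, $B=\{x:p(x)\le 0\}$. The coloring bisects a finite Borel measure $\mu$ if $\min(\mu(A),\mu(B))\ge \mu(\mathbb{R}^d)/2$ (for measures vanishing on hyperplanes this means $\mu(A)=\mu(B)$). *)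

theory Defs
  imports "HOL-Analysis.Analysis" "HOL-Probability.Probability" "HOL-Combinatorics.Combinatorics"
begin

definition multinom :: "nat \<Rightarrow> (nat \<Rightarrow> nat) \<Rightarrow> nat" where
  "multinom n m = fact (\<Sum>i=1..n. m i) div (\<Prod>i=1..n. fact (m i))"

text \<open>An oriented (generalized) hyperplane is represented by a pair (w, c) with (w,c) \<noteq> 0,
  standing for the affine function x \<mapsto> \<langle>x,w\<rangle> + c.\<close>
definition aff_fun :: "'a::euclidean_space \<times> real \<Rightarrow> 'a \<Rightarrow> real" where
  "aff_fun h x = inner x (fst h) + snd h"

definition orth_to :: "'a::euclidean_space \<times> real \<Rightarrow> 'a \<Rightarrow> bool" where
  "orth_to h v \<longleftrightarrow> fst h \<in> span {v}"

definition bisects :: "('a::euclidean_space \<Rightarrow> real) \<Rightarrow> 'a measure \<Rightarrow> bool" where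
  "bisects p mu \<longleftrightarrow>
     min (measure mu {x. p x \<ge> 0}) (measure mu {x. p x \<le> 0}) \<ge> measure mu (space mu) / 2"

end

theory Submission
  imports Defs
begin

text \<open>A group of \<open>k\<close> parallel hyperplanes orthogonal to \<open>v\<close> colours space by the sign of \<open>p(\<langle>x, v\<rangle>)\<close> for a
  polynomial \<open>p \<noteq> 0\<close> of degree at most \<open>k\<close>, and conversely every such \<open>p\<close> has the signs of a product of
  \<open>k\<close> generalized affine functions. So \<open>\<F>\<^sub>i\<close> ranges over pairs \<open>(v, p)\<close> in \<open>S\<^bsup>l-1\<^esup> \<times> S\<^bsup>k\<^esup>\<close> modulo
  \<open>p \<mapsto> -p\<close>, which reverses the colouring, and \<open>(v, p) \<mapsto> (-v, p(-t))\<close>, which preserves it. A fundamental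
  domain for all indices together is a box of dimension \<open>M\<close> with identifications on its boundary.

  If no configuration bisected all measures, labelling each configuration by a measure it does not
  bisect (with the sign of the imbalance) would give, on fine triangulations, an equivariant labelling by
  \<open>\<plusminus>1, \<dots>, \<plusminus>M\<close> without complementary edges. A counting argument in the spirit of Ky Fan shows that then any
  equivariant sign function on the vertices has an even number of orbits of simplices on which it
  alternates. For a suitable sign function the alternating simplices correspond to the linear extensions
  of a poset, whose number modulo the symmetry group has the parity of \<open>N\<close>, because
  \<open>S(l+k-1, k)\<close> and the number of interleavings of \<open>l-1\<close> and \<open>\<lceil>k/2\<rceil>-1\<close> steps agree modulo 2.\<close>

text \<open>Three difficulties shape the proof. The hypothesis concerns a count divided by |G|, so
  the parity argument must run on orbits: G has to act freely on flags, and no flag may be adjacent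
  to one of its own images. The second condition fails for interchangeable indices that carry a
  single coordinate, which is why such indices are merged. Next, the identification (v, p) -> (-v,
  p(-t)) acts on both blocks of coordinates, so the two block signs cannot simply be multiplied. The
  coordinates of p are ordered with the odd powers first: as long as a boundary p is an odd
  polynomial, p(-t) = -p(t) and the sign of the v block compensates; once an even power decides the
  sign, that sign is unchanged and the v block must be left out. This switch at k/2 produces the
  poset and its binomial coefficients. Finally, measures may charge the zero set of the colouring,
  so the true imbalance is discontinuous. It is replaced by the integral of the clamped multiple of
  the product by n; this is made small for each n, and only then does n tend to infinity.\<close>

section \<open>Alternating sign patterns and a Tucker-type lemma\<close>

text \<open>The exponent counts the entries of larger absolute value, so \<open>s\<close> is the
  sign of the largest entry and signs alternate downwards from there.\<close>

definition alt_family :: "'j set \<Rightarrow> ('j \<Rightarrow> int) \<Rightarrow> int \<Rightarrow> bool" where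
  "alt_family J f s \<longleftrightarrow> inj_on (\<lambda>j. \<bar>f j\<bar>) J \<and>
     (\<forall>j\<in>J. sgn (f j) = s * (-1) ^ card {i\<in>J. \<bar>f j\<bar> < \<bar>f i\<bar>})"

lemma even_card_fixpoint_free_involution:
  assumes "finite A" "\<And>x. x \<in> A \<Longrightarrow> h x \<in> A" "\<And>x. x \<in> A \<Longrightarrow> h (h x) = x" "\<And>x. x \<in> A \<Longrightarrow> h x \<noteq> x"
  shows "even (card A)"
  using assms
proof (induction "card A" arbitrary: A rule: less_induct)
  case less
  show ?case
  proof (cases "A = {}")
    case False
    then obtain a where a: "a \<in> A" by auto
    let ?B = "A - {a, h a}"
    have ha: "h a \<in> A" "h a \<noteq> a" using less.prems a by auto
    have c: "card A = card ?B + 2"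
    proof -
      have "card {a, h a} = 2" using ha by auto
      moreover have "card ?B = card A - card {a, h a}" using a ha less.prems(1) by (intro card_Diff_subset) auto
      moreover have "card {a, h a} \<le> card A" using a ha less.prems(1) by (intro card_mono) auto
      ultimately show ?thesis by simp
    qed
    have "even (card ?B)"
    proof (rule less.hyps)
      show "card ?B < card A" using c by simp
      show "finite ?B" using less.prems(1) by simp
      fix x assume x: "x \<in> ?B"
      show "h x \<in> ?B" using x less.prems(2,3) a by (metis Diff_iff insert_iff empty_iff)
      show "h (h x) = x" "h x \<noteq> x" using x less.prems by auto
    qed
    then show ?thesis using c by simp
  qed simp
qed

lemma alt_family_remove_top:
  assumes "finite J" "t \<in> J" "\<And>i. i \<in> J \<Longrightarrow> i \<noteq> t \<Longrightarrow> \<bar>f i\<bar> < \<bar>f t\<bar>"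
  shows "alt_family J f s \<longleftrightarrow> sgn (f t) = s \<and> alt_family (J - {t}) f (-s)"
proof -
  have inj: "inj_on (\<lambda>j. \<bar>f j\<bar>) J \<longleftrightarrow> inj_on (\<lambda>j. \<bar>f j\<bar>) (J - {t})"
  proof
    assume i: "inj_on (\<lambda>j. \<bar>f j\<bar>) (J - {t})"
    have "inj_on (\<lambda>j. \<bar>f j\<bar>) (insert t (J - {t}))"
      unfolding inj_on_insert using i assms(3) by fastforce
    then show "inj_on (\<lambda>j. \<bar>f j\<bar>) J" using assms(2) by (simp add: insert_absorb)
  qed (auto intro: inj_on_subset)
  have top: "{i\<in>J. \<bar>f t\<bar> < \<bar>f i\<bar>} = {}" using assms(3) by fastforce
  have oth: "card {i\<in>J. \<bar>f j\<bar> < \<bar>f i\<bar>} = Suc (card {i\<in>J - {t}. \<bar>f j\<bar> < \<bar>f i\<bar>})"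
    if "j \<in> J" "j \<noteq> t" for j
  proof -
    have "{i\<in>J. \<bar>f j\<bar> < \<bar>f i\<bar>} = insert t {i\<in>J - {t}. \<bar>f j\<bar> < \<bar>f i\<bar>}"
      using assms(2,3) that by auto
    then show ?thesis using assms(1) by simp
  qed
  have "(\<forall>j\<in>J. sgn (f j) = s * (-1) ^ card {i\<in>J. \<bar>f j\<bar> < \<bar>f i\<bar>}) \<longleftrightarrow>
     sgn (f t) = s \<and> (\<forall>j\<in>J-{t}. sgn (f j) = s * (-1) ^ card {i\<in>J. \<bar>f j\<bar> < \<bar>f i\<bar>})"
    using assms(2) top by (auto simp: top)
  also have "\<dots> \<longleftrightarrow> sgn (f t) = s \<and> (\<forall>j\<in>J-{t}. sgn (f j) = - s * (-1) ^ card {i\<in>J-{t}. \<bar>f j\<bar> < \<bar>f i\<bar>})"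
    using oth by auto
  finally show ?thesis unfolding alt_family_def inj by auto
qed

lemma alt_family_reindex:
  assumes "bij_betw \<phi> K J"
  shows "alt_family K (\<lambda>k. f (\<phi> k)) s \<longleftrightarrow> alt_family J f s"
proof -
  have im: "J = \<phi> ` K" and inj: "inj_on \<phi> K" using assms by (auto simp: bij_betw_def)
  have "card {i\<in>\<phi> ` K. x < \<bar>f i\<bar>} = card {i\<in>K. x < \<bar>f (\<phi> i)\<bar>}" for x
  proof -
    have "{i\<in>\<phi> ` K. x < \<bar>f i\<bar>} = \<phi> ` {i\<in>K. x < \<bar>f (\<phi> i)\<bar>}" by auto
    then show ?thesis using inj by (metis (no_types, lifting) card_image inj_on_subset mem_Collect_eq subsetI)
  qed
  moreover have "inj_on (\<lambda>j. \<bar>f j\<bar>) (\<phi> ` K) \<longleftrightarrow> inj_on (\<lambda>k. \<bar>f (\<phi> k)\<bar>) K"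
    using inj by (auto simp: inj_on_def)
  ultimately show ?thesis unfolding alt_family_def im by simp
qed

lemma alt_family_cong:
  assumes "\<And>j. j \<in> J \<Longrightarrow> f j = g j"
  shows "alt_family J f s \<longleftrightarrow> alt_family J g s"
proof -
  have "{i\<in>J. x < \<bar>f i\<bar>} = {i\<in>J. x < \<bar>g i\<bar>}" for x using assms by auto
  moreover have "inj_on (\<lambda>j. \<bar>f j\<bar>) J \<longleftrightarrow> inj_on (\<lambda>j. \<bar>g j\<bar>) J"
    using assms by (auto simp: inj_on_def)
  ultimately show ?thesis unfolding alt_family_def using assms by simp
qed

lemma alt_family_uminus: "alt_family J (\<lambda>j. - f j) s \<longleftrightarrow> alt_family J f (-s)"
proof -
  have "- sgn x = s * y \<longleftrightarrow> sgn x = - (s * y)" for x y :: int by linarith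
  then show ?thesis by (auto simp: alt_family_def sgn_minus)
qed

lemma alt_family_empty [simp]: "alt_family {} f s"
  by (simp add: alt_family_def)

lemma alt_family_unique_sign:
  assumes "finite J" "J \<noteq> {}" "alt_family J f s" "alt_family J f t"
  shows "s = t"
proof -
  obtain j where "j \<in> J" using assms by auto
  then have "s * (-1) ^ card {i\<in>J. \<bar>f j\<bar> < \<bar>f i\<bar>} = t * (-1) ^ card {i\<in>J. \<bar>f j\<bar> < \<bar>f i\<bar>}"
    using assms(3,4) unfolding alt_family_def by metis
  then show ?thesis by simp
qed

text \<open>Induction strips the entry \<open>t\<close> of largest absolute value: a facet keeping
  \<open>t\<close> alternates iff \<open>t\<close> has sign \<open>s\<close> and the rest alternates
  with sign \<open>-s\<close>. If two entries share an absolute value they are equal, complementary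
  pairs being excluded; then only the two facets omitting one of them can alternate, and they do so
  together.\<close>

lemma alternating_facets_parity:
  assumes "finite J" "\<And>i j. i \<in> J \<Longrightarrow> j \<in> J \<Longrightarrow> f i \<noteq> - f j" "s \<in> {1,-1}"
  shows "even (card {j\<in>J. alt_family (J - {j}) f s} + of_bool (alt_family J f s) + of_bool (alt_family J f (-s)))"
  using assms
proof (induction "card J" arbitrary: J s rule: less_induct)
  case less
  show ?case
  proof (cases "J = {}")
    case False
    show ?thesis
    proof (cases "inj_on (\<lambda>j. \<bar>f j\<bar>) J")
      case inj: True
      obtain t where t: "t \<in> J" "\<And>i. i \<in> J \<Longrightarrow> \<bar>f i\<bar> \<le> \<bar>f t\<bar>"
      proof -
        let ?A = "(\<lambda>j. \<bar>f j\<bar>) ` J"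
        have "Max ?A \<in> ?A" using less.prems(1) False by (intro Max_in) auto
        then obtain t where "t \<in> J" "\<bar>f t\<bar> = Max ?A" by auto
        moreover have "\<bar>f i\<bar> \<le> Max ?A" if "i \<in> J" for i using less.prems(1) that by (intro Max_ge) auto
        ultimately show ?thesis using that by metis
      qed
      have t': "\<bar>f i\<bar> < \<bar>f t\<bar>" if "i \<in> J" "i \<noteq> t" for i
        using t(2)[OF that(1)] inj that t(1) by (metis inj_onD order_le_less)
      let ?K = "J - {t}"
      \<comment> \<open>The case \<open>i = j\<close> of the hypothesis excludes the label
        0.\<close>
      have t0: "f t \<noteq> 0" using less.prems(2)[OF t(1) t(1)] by auto
      then have st: "sgn (f t) = s \<or> sgn (f t) = - s" using less.prems(3) by (auto simp: sgn_if)
      have s0: "s \<noteq> 0" "s \<noteq> - s" using less.prems(3) by auto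
      have IH: "even (card {j\<in>?K. alt_family (?K - {j}) f (-s)} + of_bool (alt_family ?K f (-s)) + of_bool (alt_family ?K f s))"
        using less.hyps[of ?K "-s"] less.prems t(1)
        by (metis (no_types, lifting) Diff_iff card_Diff1_less finite_Diff insert_iff minus_minus singletonD)
      have fac: "alt_family (J - {j}) f s \<longleftrightarrow> sgn (f t) = s \<and> alt_family (?K - {j}) f (-s)"
        if "j \<in> ?K" for j
      proof -
        have "J - {j} - {t} = ?K - {j}" by auto
        then show ?thesis using alt_family_remove_top[of "J - {j}" t f s] that t t' less.prems(1) by auto
      qed
      have "{j\<in>J. alt_family (J - {j}) f s} =
         (if alt_family ?K f s then {t} else {}) \<union> {j\<in>?K. sgn (f t) = s \<and> alt_family (?K - {j}) f (-s)}"
        using fac t(1) by auto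
      then have "card {j\<in>J. alt_family (J - {j}) f s} =
         of_bool (alt_family ?K f s) + card {j\<in>?K. sgn (f t) = s \<and> alt_family (?K - {j}) f (-s)}"
        using less.prems(1) by auto
      moreover have "alt_family J f s \<longleftrightarrow> sgn (f t) = s \<and> alt_family ?K f (-s)"
        "alt_family J f (-s) \<longleftrightarrow> sgn (f t) = -s \<and> alt_family ?K f s"
        using alt_family_remove_top[of J t f, OF less.prems(1) t(1)] t' by auto
      ultimately show ?thesis using IH st s0 by auto
    next
      case ninj: False
      then obtain a b where ab: "a \<in> J" "b \<in> J" "a \<noteq> b" "\<bar>f a\<bar> = \<bar>f b\<bar>" by (auto simp: inj_on_def)
      then have fab: "f a = f b" using less.prems(2) by (metis abs_eq_iff)
      have "alt_family (J - {a}) f s \<longleftrightarrow> alt_family (J - {b}) f s"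
      proof -
        let ?\<phi> = "id(b := a)"
        have "bij_betw ?\<phi> (J - {a}) (J - {b})"
          using ab by (intro bij_betw_byWitness[where f' = "id(a := b)"]) auto
        from alt_family_reindex[OF this, of f s]
        have "alt_family (J - {b}) f s \<longleftrightarrow> alt_family (J - {a}) (\<lambda>k. f (?\<phi> k)) s" by simp
        also have "\<dots> \<longleftrightarrow> alt_family (J - {a}) f s" by (rule alt_family_cong) (use fab in auto)
        finally show ?thesis by simp
      qed
      moreover have "j = a \<or> j = b" if "alt_family (J - {j}) f s" for j
        using that unfolding alt_family_def inj_on_def using ab by blast
      ultimately have "{j\<in>J. alt_family (J - {j}) f s} = (if alt_family (J - {a}) f s then {a,b} else {})"
        using ab by (auto split: if_splits)
      moreover have "\<not> alt_family J f s" "\<not> alt_family J f (-s)" using ninj by (auto simp: alt_family_def)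
      ultimately show ?thesis using ab(3) by auto
    qed
  qed simp
qed

definition alternating :: "'j set \<Rightarrow> ('j \<Rightarrow> int) \<Rightarrow> bool" where
  "alternating J f \<longleftrightarrow> alt_family J f 1 \<or> alt_family J f (-1)"

text \<open>Adding the previous parity for both signs counts \<open>J\<close> itself twice. Two
  elements are required so that facets are nonempty: the empty family alternates with both
  signs.\<close>

lemma even_card_alternating_facets:
  assumes "finite J" "card J \<ge> 2" "\<And>i j. i \<in> J \<Longrightarrow> j \<in> J \<Longrightarrow> f i \<noteq> - f j"
  shows "even (card {j\<in>J. alternating (J - {j}) f})"
proof -
  have ne: "J - {j} \<noteq> {}" for j
  proof
    assume "J - {j} = {}"
    then have "card J \<le> card {j}" by (intro card_mono) auto
    then show False using assms(2) by simp
  qed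
  have "{j\<in>J. alternating (J - {j}) f} = {j\<in>J. alt_family (J - {j}) f 1} \<union> {j\<in>J. alt_family (J - {j}) f (-1)}"
    by (auto simp: alternating_def)
  moreover have "{j\<in>J. alt_family (J - {j}) f 1} \<inter> {j\<in>J. alt_family (J - {j}) f (-1)} = {}"
    using alt_family_unique_sign[where s = 1 and t = "-1" and f = f] ne assms(1) by fastforce
  ultimately have "card {j\<in>J. alternating (J - {j}) f} =
     card {j\<in>J. alt_family (J - {j}) f 1} + card {j\<in>J. alt_family (J - {j}) f (-1)}"
    using assms(1) by (simp add: card_Un_disjoint)
  moreover have "even (card {j\<in>J. alt_family (J - {j}) f 1} + of_bool (alt_family J f 1) + of_bool (alt_family J f (-1)))"
    using alternating_facets_parity[of J f 1] assms(1,3) by simp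
  moreover have "even (card {j\<in>J. alt_family (J - {j}) f (-1)} + of_bool (alt_family J f (-1)) + of_bool (alt_family J f 1))"
    using alternating_facets_parity[of J f "-1"] assms(1,3) by simp
  ultimately show ?thesis by presburger
qed

lemma alternating_reindex:
  assumes "bij_betw \<phi> K J"
  shows "alternating K (\<lambda>k. f (\<phi> k)) \<longleftrightarrow> alternating J f"
  using alt_family_reindex[OF assms] by (simp add: alternating_def)

lemma alternating_cong:
  assumes "\<And>j. j \<in> J \<Longrightarrow> f j = g j"
  shows "alternating J f \<longleftrightarrow> alternating J g"
  unfolding alternating_def using alt_family_cong[of J f g] assms by blast

lemma alternating_scale:
  assumes "s \<in> {1, -1}"
  shows "alternating J (\<lambda>j. s * f j) \<longleftrightarrow> alternating J f"
  using assms alt_family_uminus[of J f] by (auto simp: alternating_def)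

text \<open>Absolute values that grow with the position turn alternation into a condition on
  consecutive signs; such labels start the switching argument below.\<close>

lemma alternating_by_position:
  fixes e :: "nat \<Rightarrow> int"
  assumes "\<And>l. l \<le> M \<Longrightarrow> e l \<in> {1,-1}"
  shows "alternating {..M} (\<lambda>l. e l * int (Suc l)) \<longleftrightarrow> (\<forall>l<M. e (Suc l) = - e l)"
proof -
  have ab: "\<bar>e l * int (Suc l)\<bar> = int (Suc l)" if "l \<le> M" for l using assms[OF that] by (auto simp: abs_mult)
  have sg: "sgn (e l * int (Suc l)) = e l" if "l \<le> M" for l using assms[OF that] by (auto simp: sgn_mult)
  have inj: "inj_on (\<lambda>l. \<bar>e l * int (Suc l)\<bar>) {..M}" using ab by (auto simp: inj_on_def)
  have cd: "card {i\<in>{..M}. \<bar>e l * int (Suc l)\<bar> < \<bar>e i * int (Suc i)\<bar>} = M - l" if "l \<le> M" for l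
  proof -
    have "{i\<in>{..M}. \<bar>e l * int (Suc l)\<bar> < \<bar>e i * int (Suc i)\<bar>} = {l<..M}" using ab that by auto
    then show ?thesis by simp
  qed
  have eq: "alt_family {..M} (\<lambda>l. e l * int (Suc l)) s \<longleftrightarrow> (\<forall>l\<le>M. e l = s * (-1) ^ (M - l))" for s
    unfolding alt_family_def using inj sg cd by auto
  show ?thesis
  proof
    assume "alternating {..M} (\<lambda>l. e l * int (Suc l))"
    then obtain s where s: "\<And>l. l \<le> M \<Longrightarrow> e l = s * (-1) ^ (M - l)" unfolding alternating_def eq by metis
    show "\<forall>l<M. e (Suc l) = - e l"
    proof (intro allI impI)
      fix l assume "l < M"
      then have "M - l = Suc (M - Suc l)" by simp
      then show "e (Suc l) = - e l" using s[of l] s[of "Suc l"] \<open>l < M\<close> by simp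
    qed
  next
    assume a: "\<forall>l<M. e (Suc l) = - e l"
    have "e l = e M * (-1) ^ (M - l)" if "l \<le> M" for l
      using that
    proof (induction "M - l" arbitrary: l)
      case (Suc d)
      then have "l < M" "d = M - Suc l" "Suc l \<le> M" by auto
      then have "e (Suc l) = e M * (-1) ^ d" "e (Suc l) = - e l" using Suc.hyps(1)[of "Suc l"] a by auto
      then show ?case using Suc.hyps(2) by (metis minus_minus mult_minus_left mult_minus_right power_Suc mult_1)
    qed simp
    then show "alternating {..M} (\<lambda>l. e l * int (Suc l))"
      unfolding alternating_def eq using assms[of M] by (metis insertE order_refl singletonD)
  qed
qed


text \<open>Think of \<open>T\<close> as simplices with vertices 0, ..., \<open>M\<close> and of
  \<open>\<nu> j q\<close> as the simplex across the facet opposite vertex \<open>j\<close>. With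
  the new label of vertex \<open>i\<close> added there are \<open>M + 2\<close> labels and an even
  number of alternating facets. Omitting the new or the old label of \<open>i\<close> gives the two
  counts; omitting any other \<open>j\<close> leaves labels that \<open>q\<close> and
  \<open>\<nu> j q\<close> share up to a common sign, so these facets cancel in pairs.\<close>

lemma card_parity_switch:
  fixes lab lab' :: "'q \<Rightarrow> nat \<Rightarrow> int"
  assumes "finite T" and i: "i \<le> M"
    and inv: "\<And>q j. q \<in> T \<Longrightarrow> j \<le> M \<Longrightarrow> \<nu> j q \<in> T \<and> \<nu> j (\<nu> j q) = q \<and> \<nu> j q \<noteq> q"
    and sign: "\<And>q j. q \<in> T \<Longrightarrow> j \<le> M \<Longrightarrow>
       \<exists>s\<in>{1,-1}. \<forall>l\<le>M. l \<noteq> j \<longrightarrow> lab (\<nu> j q) l = s * lab q l \<and> lab' (\<nu> j q) l = s * lab' q l"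
    and same: "\<And>q l. q \<in> T \<Longrightarrow> l \<le> M \<Longrightarrow> l \<noteq> i \<Longrightarrow> lab' q l = lab q l"
    and compl: "\<And>q l l'. q \<in> T \<Longrightarrow> l \<le> M \<Longrightarrow> l' \<le> M \<Longrightarrow>
       lab q l \<noteq> - lab q l' \<and> lab q l \<noteq> - lab' q l' \<and> lab' q l \<noteq> - lab' q l'"
  shows "even (card {q\<in>T. alternating {..M} (lab q)} + card {q\<in>T. alternating {..M} (lab' q)})"
proof -
  \<comment> \<open>Position \<open>Suc M\<close> carries the new label of vertex \<open>i\<close>.\<close>
  define h where "h q l = (if l \<le> M then lab q l else lab' q i)" for q l
  define J where "J = {..Suc M}"
  have finJ: "finite J" by (simp add: J_def)
  define A where "A j = {q\<in>T. alternating (J - {j}) (h q)}" for j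
  have "even (card {j\<in>J. alternating (J - {j}) (h q)})" if q: "q \<in> T" for q
  proof (rule even_card_alternating_facets)
    show "h q a \<noteq> - h q b" if "a \<in> J" "b \<in> J" for a b
      using compl[OF q, of a b] compl[OF q, of a i] compl[OF q, of b i] compl[OF q i i] i
      unfolding h_def by auto
  qed (auto simp: J_def)
  then have "even (\<Sum>q\<in>T. card {j\<in>J. alternating (J - {j}) (h q)})" by (intro dvd_sum) auto
  also have "(\<Sum>q\<in>T. card {j\<in>J. alternating (J - {j}) (h q)}) = (\<Sum>q\<in>T. \<Sum>j\<in>J. of_bool (alternating (J - {j}) (h q)))"
    by (intro sum.cong refl) (simp add: finJ Int_def)
  also have "\<dots> = (\<Sum>j\<in>J. \<Sum>q\<in>T. of_bool (alternating (J - {j}) (h q)))" by (rule sum.swap)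
  also have "\<dots> = (\<Sum>j\<in>J. card (A j))"
    using assms(1) by (intro sum.cong refl) (simp add: A_def Int_def)
  also have "\<dots> = card (A (Suc M)) + (card (A i) + (\<Sum>j\<in>{..M}-{i}. card (A j)))"
  proof -
    have "J = insert (Suc M) (insert i ({..M} - {i}))" using i by (auto simp: J_def)
    then show ?thesis using i by (simp add: sum.insert_remove)
  qed
  finally have ev: "even (card (A (Suc M)) + (card (A i) + (\<Sum>j\<in>{..M}-{i}. card (A j))))" .
  have "even (card (A j))" if j: "j \<in> {..M}-{i}" for j
  proof (rule even_card_fixpoint_free_involution[where h = "\<nu> j"])
    show "finite (A j)" using assms(1) by (simp add: A_def)
    fix q assume "q \<in> A j"
    then have q: "q \<in> T" "alternating (J - {j}) (h q)" by (auto simp: A_def)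
    obtain s where s: "s \<in> {1,-1}" "\<And>l. l \<le> M \<Longrightarrow> l \<noteq> j \<Longrightarrow> lab (\<nu> j q) l = s * lab q l \<and> lab' (\<nu> j q) l = s * lab' q l"
    proof -
      have "j \<le> M" using j by simp
      from sign[OF q(1) this] show ?thesis using that by blast
    qed
    have "alternating (J - {j}) (h (\<nu> j q)) \<longleftrightarrow> alternating (J - {j}) (\<lambda>l. s * h q l)"
      by (rule alternating_cong) (use s(2) i j in \<open>auto simp: h_def J_def\<close>)
    then show "\<nu> j q \<in> A j" using alternating_scale[OF s(1)] q inv[OF q(1)] j by (auto simp: A_def)
    show "\<nu> j (\<nu> j q) = q" "\<nu> j q \<noteq> q" using inv[OF q(1)] j by auto
  qed
  then have "even (\<Sum>j\<in>{..M}-{i}. card (A j))" by (intro dvd_sum) auto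
  moreover have "A (Suc M) = {q\<in>T. alternating {..M} (lab q)}"
  proof -
    have "J - {Suc M} = {..M}" by (auto simp: J_def)
    moreover have "alternating {..M} (h q) \<longleftrightarrow> alternating {..M} (lab q)" for q
      by (rule alternating_cong) (simp add: h_def)
    ultimately show ?thesis by (simp add: A_def)
  qed
  moreover have "A i = {q\<in>T. alternating {..M} (lab' q)}"
  proof -
    let ?\<phi> = "\<lambda>l. if l = i then Suc M else l"
    have b: "bij_betw ?\<phi> {..M} (J - {i})"
      by (intro bij_betw_byWitness[where f' = "\<lambda>l. if l = Suc M then i else l"]) (use i in \<open>auto simp: J_def\<close>)
    have "alternating (J - {i}) (h q) \<longleftrightarrow> alternating {..M} (lab' q)" if "q \<in> T" for q
      unfolding alternating_reindex[OF b, symmetric]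
      by (rule alternating_cong) (use same[OF that] in \<open>auto simp: h_def\<close>)
    then show ?thesis by (auto simp: A_def)
  qed
  ultimately show ?thesis using ev by simp
qed

text \<open>The labels \<open>e q l * int (Suc l)\<close> are exchanged for \<open>big q l\<close>
  one position at a time, each exchange preserving the parity. At the end \<open>M + 1\<close>
  labels have at most \<open>M\<close> absolute values, so nothing alternates.\<close>

theorem tucker_alternating_parity:
  fixes e lam :: "'q \<Rightarrow> nat \<Rightarrow> int"
  assumes "finite T"
    and inv: "\<And>q j. q \<in> T \<Longrightarrow> j \<le> M \<Longrightarrow> \<nu> j q \<in> T \<and> \<nu> j (\<nu> j q) = q \<and> \<nu> j q \<noteq> q"
    and sign: "\<And>q j. q \<in> T \<Longrightarrow> j \<le> M \<Longrightarrow>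
       \<exists>s\<in>{1,-1}. \<forall>l\<le>M. l \<noteq> j \<longrightarrow> e (\<nu> j q) l = s * e q l \<and> lam (\<nu> j q) l = s * lam q l"
    and e: "\<And>q l. q \<in> T \<Longrightarrow> l \<le> M \<Longrightarrow> e q l \<in> {1,-1}"
    and lam: "\<And>q l. q \<in> T \<Longrightarrow> l \<le> M \<Longrightarrow> lam q l \<noteq> 0 \<and> \<bar>lam q l\<bar> \<le> int M"
    and compl: "\<And>q l l'. q \<in> T \<Longrightarrow> l \<le> M \<Longrightarrow> l' \<le> M \<Longrightarrow> lam q l \<noteq> - lam q l'"
  shows "even (card {q\<in>T. \<forall>l<M. e q (Suc l) = - e q l})"
proof -
  \<comment> \<open>The shift lifts the new absolute values to at least \<open>M + 2\<close>, above
    the old ones, so an old label is never complementary to a new one at an intermediate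
    stage.\<close>
  define big where "big q l = sgn (lam q l) * (\<bar>lam q l\<bar> + int M + 1)" for q l
  define g where "g i q l = (if l < i then big q l else e q l * int (Suc l))" for i q l
  define N where "N i = card {q\<in>T. alternating {..M} (g i q)}" for i
  have abig: "\<bar>big q l\<bar> = \<bar>lam q l\<bar> + int M + 1" if "q \<in> T" "l \<le> M" for q l
    using lam[OF that] by (auto simp: big_def abs_mult sgn_if)
  have aold: "\<bar>e q l * int (Suc l)\<bar> = int (Suc l)" if "q \<in> T" "l \<le> M" for q l
    using e[OF that] by (auto simp: abs_mult)
  have oldnew: "e q l * int (Suc l) \<noteq> - big q l'" "big q l' \<noteq> - (e q l * int (Suc l))"
    if "q \<in> T" "l \<le> M" "l' \<le> M" for q l l'
    using abig[OF that(1,3)] aold[OF that(1,2)] lam[OF that(1,3)] that by linarith+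
  have oldold: "e q l * int (Suc l) \<noteq> - (e q l' * int (Suc l'))" if "q \<in> T" "l \<le> M" "l' \<le> M" for q l l'
  proof
    assume a: "e q l * int (Suc l) = - (e q l' * int (Suc l'))"
    then have "l = l'" using aold[OF that(1,2)] aold[OF that(1,3)] by linarith
    then show False using a e[OF that(1,2)] by auto
  qed
  have newnew: "big q l \<noteq> - big q l'" if "q \<in> T" "l \<le> M" "l' \<le> M" for q l l'
    using lam[OF that(1,2)] lam[OF that(1,3)] compl[OF that]
    by (auto simp: big_def sgn_if split: if_splits)
  have bsc: "big q' l = s * big q l" if "lam q' l = s * lam q l" "s \<in> {1,-1}" for q q' l s
    using that by (auto simp: big_def sgn_minus)
  have step: "even (N i + N (Suc i))" if i: "i \<le> M" for i
    unfolding N_def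
  proof (rule card_parity_switch[OF assms(1) i inv])
    fix q j assume q: "q \<in> T" "j \<le> M"
    show "\<exists>s\<in>{1, - 1}. \<forall>l\<le>M. l \<noteq> j \<longrightarrow> g i (\<nu> j q) l = s * g i q l \<and> g (Suc i) (\<nu> j q) l = s * g (Suc i) q l"
    proof -
      obtain s where s: "s \<in> {1,-1}" "\<And>l. l \<le> M \<Longrightarrow> l \<noteq> j \<Longrightarrow> e (\<nu> j q) l = s * e q l \<and> lam (\<nu> j q) l = s * lam q l"
        using sign[OF q] by blast
      have "big (\<nu> j q) l = s * big q l" if "l \<le> M" "l \<noteq> j" for l using bsc s(1) s(2)[OF that] by blast
      then show ?thesis using s by (intro bexI[of _ s]) (auto simp: g_def)
    qed
  next
    fix q l assume "l \<noteq> i" then show "g (Suc i) q l = g i q l" by (auto simp: g_def)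
  next
    fix q l l' assume q: "q \<in> T" "l \<le> M" "l' \<le> M"
    show "g i q l \<noteq> - g i q l' \<and> g i q l \<noteq> - g (Suc i) q l' \<and> g (Suc i) q l \<noteq> - g (Suc i) q l'"
      using oldnew[OF q] oldnew[OF q(1,3,2)] oldold[OF q] newnew[OF q] unfolding g_def by presburger
  qed
  have "even (N 0 + N i)" if "i \<le> Suc M" for i
    using that
  proof (induction i)
    case (Suc i)
    then have "even (N 0 + N i)" "even (N i + N (Suc i))" using step[of i] by auto
    then show ?case by presburger
  qed simp
  then have ev: "even (N 0 + N (Suc M))" by simp
  have "\<not> alternating {..M} (g (Suc M) q)" if q: "q \<in> T" for q
  proof
    assume "alternating {..M} (g (Suc M) q)"
    then have "inj_on (\<lambda>l. \<bar>g (Suc M) q l\<bar>) {..M}" by (auto simp: alternating_def alt_family_def)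
    then have inj: "inj_on (\<lambda>l. \<bar>lam q l\<bar>) {..M}"
      using abig[OF q] by (auto simp: inj_on_def g_def)
    have "(\<lambda>l. \<bar>lam q l\<bar>) ` {..M} \<subseteq> {1..int M}" using lam[OF q] by fastforce
    then have "card ((\<lambda>l. \<bar>lam q l\<bar>) ` {..M}) \<le> card {1..int M}" by (intro card_mono) auto
    then show False using card_image[OF inj] by simp
  qed
  then have "{q\<in>T. alternating {..M} (g (Suc M) q)} = {}" by blast
  then have "N (Suc M) = 0" unfolding N_def by (metis card.empty)
  moreover have "N 0 = card {q\<in>T. \<forall>l<M. e q (Suc l) = - e q l}"
  proof -
    have "alternating {..M} (g 0 q) \<longleftrightarrow> (\<forall>l<M. e q (Suc l) = - e q l)" if "q \<in> T" for q
    proof -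
      have "g 0 q = (\<lambda>l. e q l * int (Suc l))" by (rule ext) (simp add: g_def)
      then show ?thesis using alternating_by_position[of M "e q"] e[OF that] by simp
    qed
    then show ?thesis unfolding N_def by (metis (mono_tags, lifting))
  qed
  ultimately show ?thesis using ev by simp
qed

text \<open>The free action gives every orbit \<open>card G\<close> elements, so it suffices to
  count on a set \<open>T\<close> of representatives. Condition \<open>nfix\<close> says that
  crossing a facet leaves the orbit, hence the induced involution on \<open>T\<close> has no fixed
  point.\<close>

theorem tucker_alternating_parity_quotient:
  fixes e lam :: "'q \<Rightarrow> nat \<Rightarrow> int"
  assumes "finite Q" and "finite G" and "u \<in> G"
    and comp: "\<And>a b. a \<in> G \<Longrightarrow> b \<in> G \<Longrightarrow> \<exists>c\<in>G. \<forall>q\<in>Q. act c q = act b (act a q)"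
    and inverse: "\<And>a. a \<in> G \<Longrightarrow> \<exists>b\<in>G. \<forall>q\<in>Q. act b (act a q) = q"
    and unit: "\<And>q. q \<in> Q \<Longrightarrow> act u q = q"
    and act: "\<And>a q. a \<in> G \<Longrightarrow> q \<in> Q \<Longrightarrow> act a q \<in> Q"
    and free: "\<And>a b q. a \<in> G \<Longrightarrow> b \<in> G \<Longrightarrow> q \<in> Q \<Longrightarrow> act a q = act b q \<Longrightarrow> a = b"
    and inv: "\<And>q j. q \<in> Q \<Longrightarrow> j \<le> M \<Longrightarrow> \<nu> j q \<in> Q \<and> \<nu> j (\<nu> j q) = q"
    and nfix: "\<And>q j a. q \<in> Q \<Longrightarrow> j \<le> M \<Longrightarrow> a \<in> G \<Longrightarrow> \<nu> j q \<noteq> act a q"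
    and comm: "\<And>q j a. q \<in> Q \<Longrightarrow> j \<le> M \<Longrightarrow> a \<in> G \<Longrightarrow> \<nu> j (act a q) = act a (\<nu> j q)"
    and sign: "\<And>q j. q \<in> Q \<Longrightarrow> j \<le> M \<Longrightarrow>
       \<exists>s\<in>{1,-1}. \<forall>l\<le>M. l \<noteq> j \<longrightarrow> e (\<nu> j q) l = s * e q l \<and> lam (\<nu> j q) l = s * lam q l"
    and einv: "\<And>q a l. q \<in> Q \<Longrightarrow> a \<in> G \<Longrightarrow> l \<le> M \<Longrightarrow> e (act a q) l = e q l"
    and laminv: "\<And>q a l. q \<in> Q \<Longrightarrow> a \<in> G \<Longrightarrow> l \<le> M \<Longrightarrow> lam (act a q) l = lam q l"
    and e: "\<And>q l. q \<in> Q \<Longrightarrow> l \<le> M \<Longrightarrow> e q l \<in> {1,-1}"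
    and lam: "\<And>q l. q \<in> Q \<Longrightarrow> l \<le> M \<Longrightarrow> lam q l \<noteq> 0 \<and> \<bar>lam q l\<bar> \<le> int M"
    and compl: "\<And>q l l'. q \<in> Q \<Longrightarrow> l \<le> M \<Longrightarrow> l' \<le> M \<Longrightarrow> lam q l \<noteq> - lam q l'"
  shows "\<exists>N. even N \<and> card {q\<in>Q. \<forall>l<M. e q (Suc l) = - e q l} = card G * N"
proof -
  define orb where "orb q = (\<lambda>a. act a q) ` G" for q
  \<comment> \<open>The choice depends on the orbit as a set only, so all members of an orbit get
    the same representative.\<close>
  define rep where "rep q = (SOME q'. q' \<in> orb q)" for q
  have self: "q \<in> orb q" if "q \<in> Q" for q using unit[OF that] \<open>u \<in> G\<close> unfolding orb_def by force
  have sub: "orb q \<subseteq> Q" if "q \<in> Q" for q using act that by (auto simp: orb_def)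
  have orb_sub: "orb q' \<subseteq> orb q" if q: "q \<in> Q" "q' \<in> orb q" for q q'
  proof
    fix r assume "r \<in> orb q'"
    then obtain a b where ab: "a \<in> G" "b \<in> G" "q' = act a q" "r = act b q'" using q by (auto simp: orb_def)
    then show "r \<in> orb q" using comp[OF ab(1,2)] q(1) unfolding orb_def by force
  qed
  have orb_eq: "orb q' = orb q" if q: "q \<in> Q" "q' \<in> orb q" for q q'
  proof -
    obtain a where a: "a \<in> G" "q' = act a q" using q by (auto simp: orb_def)
    obtain b where b: "b \<in> G" "act b q' = q" using inverse[OF a(1)] q(1) a(2) by auto
    have "q \<in> orb q'" using b unfolding orb_def by force
    then show ?thesis using orb_sub[OF q] orb_sub[of q' q] sub[OF q(1)] q(2) by blast
  qed
  have rep: "rep q \<in> orb q" if "q \<in> Q" for q unfolding rep_def using self[OF that] by (rule someI)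
  have repQ: "rep q \<in> Q" if "q \<in> Q" for q using rep sub that by blast
  have rep_eq: "rep q' = rep q" if "q \<in> Q" "q' \<in> orb q" for q q'
    using orb_eq[OF that] by (simp add: rep_def)
  have rep_rep: "rep (rep q) = rep q" if "q \<in> Q" for q using rep_eq[OF that rep[OF that]] .
  define T where "T = rep ` Q"
  have TQ: "T \<subseteq> Q" using repQ by (auto simp: T_def)
  have repT: "rep t = t" if "t \<in> T" for t using that rep_rep by (auto simp: T_def)
  have nuorb: "\<nu> j q' \<in> orb (\<nu> j q)" if "q \<in> Q" "q' \<in> orb q" "j \<le> M" for q q' j
    using that comm by (auto simp: orb_def)
  have "even (card {q\<in>T. \<forall>l<M. e q (Suc l) = - e q l})"
  proof (rule tucker_alternating_parity[where \<nu> = "\<lambda>j q. rep (\<nu> j q)" and lam = lam])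
    show "finite T" using assms(1) by (simp add: T_def)
    fix q assume qT: "q \<in> T"
    then have q: "q \<in> Q" using TQ by auto
    fix j assume j: "j \<le> M"
    have nq: "\<nu> j q \<in> Q" using inv[OF q j] by simp
    have "rep (\<nu> j (rep (\<nu> j q))) = q"
    proof -
      have "\<nu> j (rep (\<nu> j q)) \<in> orb (\<nu> j (\<nu> j q))" by (rule nuorb[OF nq rep[OF nq] j])
      then have "\<nu> j (rep (\<nu> j q)) \<in> orb q" using inv[OF q j] by simp
      then have "rep (\<nu> j (rep (\<nu> j q))) = rep q" by (rule rep_eq[OF q])
      then show ?thesis using repT[OF qT] by simp
    qed
    moreover have "rep (\<nu> j q) \<noteq> q"
    proof
      assume "rep (\<nu> j q) = q"
      then have "q \<in> orb (\<nu> j q)" using rep[OF nq] by simp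
      then have "orb q = orb (\<nu> j q)" by (rule orb_eq[OF nq])
      then have "\<nu> j q \<in> orb q" using self[OF nq] by simp
      then show False using nfix[OF q j] by (auto simp: orb_def)
    qed
    ultimately show "rep (\<nu> j q) \<in> T \<and> rep (\<nu> j (rep (\<nu> j q))) = q \<and> rep (\<nu> j q) \<noteq> q"
      using nq by (auto simp: T_def)
    obtain a where a: "a \<in> G" "rep (\<nu> j q) = act a (\<nu> j q)" using rep[OF nq] by (auto simp: orb_def)
    show "\<exists>s\<in>{1, - 1}. \<forall>l\<le>M. l \<noteq> j \<longrightarrow> e (rep (\<nu> j q)) l = s * e q l \<and> lam (rep (\<nu> j q)) l = s * lam q l"
      unfolding a(2) using sign[OF q j] einv[OF nq a(1)] laminv[OF nq a(1)] by simp
    fix l assume l: "l \<le> M"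
    show "e q l \<in> {1, - 1}" by (rule e[OF q l])
    show "lam q l \<noteq> 0 \<and> \<bar>lam q l\<bar> \<le> int M" by (rule lam[OF q l])
    fix l' assume "l' \<le> M" then show "lam q l \<noteq> - lam q l'" by (rule compl[OF q l])
  qed
  moreover have "card {q\<in>Q. \<forall>l<M. e q (Suc l) = - e q l} = card G * card {q\<in>T. \<forall>l<M. e q (Suc l) = - e q l}"
    (is "card ?A = card G * card ?B")
  proof -
    have "bij_betw (\<lambda>(a, q). act a q) (G \<times> ?B) ?A"
    proof (rule bij_betw_imageI)
      show "inj_on (\<lambda>(a, q). act a q) (G \<times> ?B)"
      proof (rule inj_onI, clarify)
        fix a b q r assume a: "a \<in> G" "b \<in> G" "q \<in> T" "r \<in> T" "act a q = act b r"
        have "act a q \<in> orb q" unfolding orb_def using a(1) by (rule imageI)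
        moreover have "act b r \<in> orb r" unfolding orb_def using a(2) by (rule imageI)
        moreover have "q \<in> Q" "r \<in> Q" using a TQ by auto
        ultimately have "rep q = rep r" using rep_eq[of q "act a q"] rep_eq[of r "act b r"] a(5) by metis
        then have "q = r" using repT a(3,4) by simp
        then show "a = b \<and> q = r" using free[OF a(1,2), of q] a TQ by auto
      qed
      show "(\<lambda>(a, q). act a q) ` (G \<times> ?B) = ?A"
      proof (intro equalityI subsetI)
        fix q assume "q \<in> (\<lambda>(a, q). act a q) ` (G \<times> ?B)"
        then show "q \<in> ?A" using TQ act einv by (auto simp: subset_iff)
      next
        fix q assume qA: "q \<in> ?A"
        then have q: "q \<in> Q" by auto
        obtain a where a: "a \<in> G" "rep q = act a q" using rep[OF q] by (auto simp: orb_def)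
        obtain b where b: "b \<in> G" "act b (rep q) = q" using inverse[OF a(1)] q a(2) by auto
        have "rep q \<in> T" using q by (simp add: T_def)
        then have "rep q \<in> ?B" using qA einv[OF q a(1)] unfolding a(2) by simp
        then show "q \<in> (\<lambda>(a, q). act a q) ` (G \<times> ?B)" using b by force
      qed
    qed
    then have "card (G \<times> ?B) = card ?A" by (rule bij_betw_same_card)
    then show ?thesis by (simp add: card_cartesian_product)
  qed
  ultimately show ?thesis by blast
qed

section \<open>Signs of polynomials, symmetries and linear extensions\<close>

text \<open>Both sides obey the same recursion modulo 2. For even \<open>k\<close> the term
  \<open>k * Stirling (d' + k) k\<close> drops out and \<open>(k + 1) div 2\<close> is the same for
  \<open>k\<close> and \<open>k - 1\<close>; for odd \<open>k\<close> the recursion becomes Pascal's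
  rule.\<close>

lemma even_Stirling_iff_even_binomial:
  assumes "k \<ge> 1"
  shows "even (Stirling (d + k) k) \<longleftrightarrow> even ((d + ((k + 1) div 2 - 1)) choose d)"
  using assms
proof (induction "d + k" arbitrary: d k rule: less_induct)
  case less
  show ?case
  proof (cases "d = 0 \<or> k = 1")
    case True
    moreover have "Stirling (d + 1) 1 = 1" using Stirling_1[of d] by simp
    ultimately show ?thesis by (auto simp del: Stirling.simps)
  next
    case False
    then obtain d' k' where dk: "d = Suc d'" "k = Suc k'" "k' \<ge> 1"
      using less.prems by (metis One_nat_def Suc_le_D gr0_conv_Suc neq0_conv not_less_eq_eq le_SucE le_zero_eq)
    have S: "Stirling (d + k) k = k * Stirling (d' + k) k + Stirling (d + k') k'"
      by (simp add: dk)
    have IH1: "even (Stirling (d' + k) k) \<longleftrightarrow> even ((d' + ((k + 1) div 2 - 1)) choose d')"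
      by (rule less.hyps) (use less.prems dk in auto)
    have IH2: "even (Stirling (d + k') k') \<longleftrightarrow> even ((d + ((k' + 1) div 2 - 1)) choose d)"
      by (rule less.hyps) (use dk in auto)
    show ?thesis
    proof (cases "even k")
      case True
      then have "(k + 1) div 2 = (k' + 1) div 2" using dk by auto
      then show ?thesis using S IH2 True by simp
    next
      case False
      then obtain h where h: "k' = 2 * h" "h \<ge> 1" using dk by (auto elim!: evenE)
      then have "(k + 1) div 2 - 1 = h" "(k' + 1) div 2 - 1 = h - 1" using dk by auto
      moreover have "(d + h) choose d = ((d' + h) choose d') + ((d + (h - 1)) choose d)"
        using h dk(1) by (cases h) auto
      ultimately show ?thesis using S IH1 IH2 False by simp
    qed
  qed
qed

section \<open>Signs of real polynomials as signs of products of affine functions\<close>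

lemma sgn_poly_constant_if_no_root:
  fixes p :: "real poly"
  assumes "\<And>t. poly p t \<noteq> 0"
  shows "sgn (poly p t) = sgn (poly p 0)"
proof (rule ccontr)
  assume "sgn (poly p t) \<noteq> sgn (poly p 0)"
  then have "poly p t * poly p 0 < 0" "t \<noteq> 0" using assms[of t] assms[of 0]
    by (auto simp: sgn_if mult_less_0_iff split: if_splits)
  then have "\<exists>x. poly p x = 0"
    using poly_IVT[of t 0 p] poly_IVT[of 0 t p] by (cases "t < 0") (auto simp: mult.commute)
  then show False using assms by auto
qed

text \<open>Real roots are split off one at a time. When none is left the sign is constant, and the
  remaining indices receive the constants \<open>poly p 0\<close> (once) and 1. These are the
  hyperplanes at infinity of the theorem.\<close>

lemma sgn_poly_eq_sgn_prod_linear: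
  fixes p :: "real poly"
  assumes "finite A" "A \<noteq> {}" "p \<noteq> 0" "degree p \<le> card A"
  shows "\<exists>s c. (\<forall>a\<in>A. (s a, c a) \<noteq> (0,0)) \<and> (\<forall>t. sgn (poly p t) = sgn (\<Prod>a\<in>A. s a * t + c a))"
  using assms
proof (induction A arbitrary: p rule: finite_ne_induct)
  case (singleton a)
  then have d: "degree p \<le> 1" by simp
  have p: "p = [:coeff p 0, coeff p 1:]"
    using d by (intro poly_eqI) (auto simp: coeff_pCons coeff_eq_0 split: nat.splits)
  have "(coeff p 1, coeff p 0) \<noteq> (0,0)" using singleton(1) p by auto
  moreover have "poly p t = coeff p 1 * t + coeff p 0" for t
    by (subst p) (simp add: mult.commute)
  ultimately show ?case by (intro exI[of _ "\<lambda>_. coeff p 1"] exI[of _ "\<lambda>_. coeff p 0"]) auto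
next
  case (insert a A)
  show ?case
  proof (cases "\<exists>r. poly p r = 0")
    case True
    then obtain r q where pq: "p = [:-r, 1:] * q" by (auto simp: poly_eq_0_iff_dvd elim!: dvdE)
    have q: "q \<noteq> 0" using pq insert.prems by auto
    have "degree p = Suc (degree q)" unfolding pq using q by (subst degree_mult_eq) auto
    then have "degree q \<le> card A" using insert by simp
    from insert.IH[OF q this] obtain s c where sc: "\<And>a. a \<in> A \<Longrightarrow> (s a, c a) \<noteq> (0,0)"
      "\<And>t. sgn (poly q t) = sgn (\<Prod>a\<in>A. s a * t + c a)" by auto
    have "sgn (poly p t) = sgn (\<Prod>b\<in>insert a A. (s(a:=1)) b * t + (c(a:=-r)) b)" for t
    proof -
      have "(\<Prod>b\<in>A. (s(a:=1)) b * t + (c(a:=-r)) b) = (\<Prod>b\<in>A. s b * t + c b)"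
        using insert.hyps by (intro prod.cong) auto
      then have "sgn (\<Prod>b\<in>insert a A. (s(a:=1)) b * t + (c(a:=-r)) b) = sgn (t - r) * sgn (poly q t)"
        using insert.hyps sc(2)[of t] by (simp add: sgn_mult)
      moreover have "poly p t = (t - r) * poly q t" unfolding pq by (simp add: algebra_simps)
      ultimately show ?thesis by (simp add: sgn_mult)
    qed
    then show ?thesis using sc(1)
      by (intro exI[of _ "s(a:=1)"] exI[of _ "c(a:=-r)"]) auto
  next
    case False
    define c where "c b = (if b = a then poly p 0 else 1)" for b
    have "(\<Prod>b\<in>insert a A. 0 * t + c b) = poly p 0" for t
    proof -
      have "(\<Prod>b\<in>A. 0 * t + c b) = 1" using insert.hyps by (intro prod.neutral) (auto simp: c_def)
      then show ?thesis using insert.hyps by (simp add: c_def)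
    qed
    moreover have "sgn (poly p t) = sgn (poly p 0)" for t
      using sgn_poly_constant_if_no_root[of p t] False by auto
    moreover have "poly p 0 \<noteq> 0" using False by auto
    ultimately show ?thesis by (intro exI[of _ "\<lambda>_. 0"] exI[of _ c]) (auto simp: c_def)
  qed
qed

section \<open>Permutations respecting a fibration; \<open>f i = (L i, k i)\<close> gives the group
  of the theorem\<close>

definition fibre_perms :: "'a set \<Rightarrow> ('a \<Rightarrow> 'b) \<Rightarrow> ('a \<Rightarrow> 'a) set" where
  "fibre_perms A f = {g. g permutes A \<and> (\<forall>i\<in>A. f (g i) = f i)}"

lemma card_fibre_perms_disjoint_Un:
  assumes "finite A" "finite B" "f ` A \<inter> f ` B = {}"
  shows "card (fibre_perms (A \<union> B) f) = card (fibre_perms A f) * card (fibre_perms B f)"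
proof -
  have disj: "A \<inter> B = {}" using assms(3) by auto
  have "bij_betw (\<lambda>(g, h). g \<circ> h) (fibre_perms A f \<times> fibre_perms B f) (fibre_perms (A \<union> B) f)"
  proof (rule bij_betw_imageI)
    show "inj_on (\<lambda>(g, h). g \<circ> h) (fibre_perms A f \<times> fibre_perms B f)"
    proof (rule inj_onI, clarify)
      fix g h g' h'
      assume a: "g \<in> fibre_perms A f" "h \<in> fibre_perms B f" "g' \<in> fibre_perms A f" "h' \<in> fibre_perms B f"
        "g \<circ> h = g' \<circ> h'"
      then have p: "g permutes A" "h permutes B" "g' permutes A" "h' permutes B" by (auto simp: fibre_perms_def)
      have "h x = h' x \<and> g x = g' x" for x
      proof (cases "x \<in> B")
        case True
        then have "h x \<in> B" "h' x \<in> B" "x \<notin> A" using p disj by (auto simp: permutes_in_image)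
        then have "h x \<notin> A" "h' x \<notin> A" using disj by auto
        then show ?thesis using fun_cong[OF a(5), of x] p \<open>x \<notin> A\<close> by (simp add: permutes_not_in)
      next
        case False
        then show ?thesis using fun_cong[OF a(5), of x] p by (simp add: permutes_not_in)
      qed
      then show "g = g' \<and> h = h'" by auto
    qed
    show "(\<lambda>(g, h). g \<circ> h) ` (fibre_perms A f \<times> fibre_perms B f) = fibre_perms (A \<union> B) f"
    proof (intro equalityI subsetI)
      fix k assume "k \<in> (\<lambda>(g, h). g \<circ> h) ` (fibre_perms A f \<times> fibre_perms B f)"
      then obtain g h where k: "k = g \<circ> h" "g permutes A" "h permutes B"
        "\<And>i. i \<in> A \<Longrightarrow> f (g i) = f i" "\<And>i. i \<in> B \<Longrightarrow> f (h i) = f i" by (auto simp: fibre_perms_def)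
      have "k permutes A \<union> B" unfolding k(1)
        by (rule permutes_compose[OF permutes_subset[OF k(3)] permutes_subset[OF k(2)]]) auto
      moreover have "f (k i) = f i" if "i \<in> A \<union> B" for i
      proof (cases "i \<in> B")
        case True
        then have "h i \<in> B" using k by (simp add: permutes_in_image)
        then have "h i \<notin> A" using disj by auto
        then show ?thesis using k True by (simp add: permutes_not_in)
      next
        case False then show ?thesis using k that by (simp add: permutes_not_in)
      qed
      ultimately show "k \<in> fibre_perms (A \<union> B) f" by (auto simp: fibre_perms_def)
    next
      fix k assume "k \<in> fibre_perms (A \<union> B) f"
      then have k: "k permutes A \<union> B" "\<And>i. i \<in> A \<union> B \<Longrightarrow> f (k i) = f i" by (auto simp: fibre_perms_def)
      have kin: "k i \<in> A \<union> B" if "i \<in> A \<union> B" for i using k(1) that by (simp only: permutes_in_image)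
      have kA: "k i \<in> A" if i: "i \<in> A" for i
      proof (rule ccontr)
        assume "k i \<notin> A"
        then have "k i \<in> B" using kin[of i] i by auto
        then have "f (k i) \<in> f ` B" "f (k i) \<in> f ` A" using imageI[of "k i" B f] k(2)[of i] i by auto
        then show False using assms(3) by auto
      qed
      have kB: "k i \<in> B" if i: "i \<in> B" for i
      proof (rule ccontr)
        assume "k i \<notin> B"
        then have "k i \<in> A" using kin[of i] i by auto
        then have "f (k i) \<in> f ` A" "f (k i) \<in> f ` B" using imageI[of "k i" A f] k(2)[of i] i by auto
        then show False using assms(3) by auto
      qed
      have inj: "inj k" using k(1) by (rule permutes_inj)
      define g where "g x = (if x \<in> A then k x else x)" for x
      define h where "h x = (if x \<in> B then k x else x)" for x
      have "inj_on k A" using inj by (rule inj_on_subset) simp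
      moreover from this have "k ` A = A" using kA assms(1) by (intro endo_inj_surj) auto
      ultimately have "bij_betw k A A" by (rule bij_betw_imageI)
      then have "bij_betw g A A" by (subst bij_betw_cong[of A g k]) (auto simp: g_def)
      then have g: "g permutes A" by (rule bij_imp_permutes) (simp add: g_def)
      have "inj_on k B" using inj by (rule inj_on_subset) simp
      moreover from this have "k ` B = B" using kB assms(2) by (intro endo_inj_surj) auto
      ultimately have "bij_betw k B B" by (rule bij_betw_imageI)
      then have "bij_betw h B B" by (subst bij_betw_cong[of B h k]) (auto simp: h_def)
      then have h: "h permutes B" by (rule bij_imp_permutes) (simp add: h_def)
      have "k = g \<circ> h"
      proof
        fix x show "k x = (g \<circ> h) x"
          using kB[of x] disj permutes_not_in[OF k(1), of x] by (auto simp: g_def h_def)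
      qed
      moreover have "g \<in> fibre_perms A f" "h \<in> fibre_perms B f"
        using g h k(2) by (auto simp: fibre_perms_def g_def h_def)
      ultimately show "k \<in> (\<lambda>(g, h). g \<circ> h) ` (fibre_perms A f \<times> fibre_perms B f)" by force
    qed
  qed
  then show ?thesis using bij_betw_same_card by (metis card_cartesian_product)
qed

text \<open>A Young subgroup: one full symmetric group per fibre, split off by induction on the
  number of fibres.\<close>

lemma card_fibre_perms:
  assumes "finite A"
  shows "card (fibre_perms A f) = (\<Prod>y\<in>f ` A. fact (card {i\<in>A. f i = y}))"
  using assms
proof (induction "card (f ` A)" arbitrary: A)
  case 0
  then have "A = {}" by simp
  moreover have "fibre_perms {} f = {id}" by (auto simp: fibre_perms_def)
  ultimately show ?case by simp
next
  case (Suc n)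
  then obtain y where y: "y \<in> f ` A" by fastforce
  define B where "B = {i\<in>A. f i = y}"
  define C where "C = {i\<in>A. f i \<noteq> y}"
  have A: "A = B \<union> C" and fin: "finite B" "finite C" using Suc.prems by (auto simp: B_def C_def)
  have fA: "f ` A = insert y (f ` C)" and yC: "y \<notin> f ` C" using y by (auto simp: C_def)
  have "card (f ` C) = n" using Suc.hyps(2) fA yC fin by simp
  then have IH: "card (fibre_perms C f) = (\<Prod>z\<in>f ` C. fact (card {i\<in>C. f i = z}))"
    using Suc.hyps(1)[of C] fin by simp
  have "fibre_perms B f = {g. g permutes B}"
  proof -
    have "f (g i) = f i" if "g permutes B" "i \<in> B" for g i
      using permutes_in_image[OF that(1), of i] that(2) by (simp add: B_def)
    then show ?thesis by (auto simp: fibre_perms_def)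
  qed
  then have cB: "card (fibre_perms B f) = fact (card B)" using card_permutations[OF refl fin(1)] by simp
  have "card (fibre_perms A f) = card (fibre_perms B f) * card (fibre_perms C f)"
    unfolding A by (rule card_fibre_perms_disjoint_Un[OF fin]) (auto simp: B_def C_def)
  also have "\<dots> = fact (card B) * (\<Prod>z\<in>f ` C. fact (card {i\<in>A. f i = z}))"
  proof -
    have "{i\<in>C. f i = z} = {i\<in>A. f i = z}" if "z \<in> f ` C" for z using that by (auto simp: C_def)
    then show ?thesis unfolding cB IH by simp
  qed
  also have "\<dots> = (\<Prod>z\<in>f ` A. fact (card {i\<in>A. f i = z}))"
    unfolding fA using yC fin by (simp add: B_def)
  finally show ?case .
qed

text \<open>An extension is stored as the position of each element. The value 0 off \<open>D\<close>
  makes the function unique and the set finite.\<close>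

definition linear_extensions :: "'c set \<Rightarrow> ('c \<Rightarrow> 'c \<Rightarrow> bool) \<Rightarrow> ('c \<Rightarrow> nat) set" where
  "linear_extensions D r = {p. bij_betw p D {..<card D} \<and> (\<forall>c. c \<notin> D \<longrightarrow> p c = 0) \<and>
     (\<forall>a\<in>D. \<forall>b\<in>D. r a b \<longrightarrow> p a < p b)}"

lemma finite_linear_extensions [simp]:
  assumes "finite D"
  shows "finite (linear_extensions D r)"
proof -
  have "linear_extensions D r \<subseteq> {p. (\<forall>c\<in>D. p c \<in> {..<card D}) \<and> (\<forall>c. c \<notin> D \<longrightarrow> p c = 0)}"
    by (auto simp: linear_extensions_def bij_betw_def)
  moreover have "finite {p. (\<forall>c\<in>D. p c \<in> {..<card D}) \<and> (\<forall>c. c \<notin> D \<longrightarrow> p c = (0::nat))}"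
    using finite_set_of_finite_funs[OF assms, of "{..<card D}" 0] by (simp add: Ball_def conj_commute all_conj_distrib)
  ultimately show ?thesis by (rule finite_subset)
qed

lemma linear_extensions_empty: "linear_extensions {} r = {\<lambda>_. 0}"
  by (auto simp: linear_extensions_def bij_betw_def)

text \<open>Extensions are sorted by the element in last position, which must be maximal; the counts
  below all come from this recursion.\<close>

lemma card_linear_extensions_rec:
  assumes "finite D" "D \<noteq> {}"
  shows "card (linear_extensions D r) = (\<Sum>c\<in>{c\<in>D. \<forall>b\<in>D. \<not> r c b}. card (linear_extensions (D - {c}) r))"
proof -
  define n where "n = card D - 1"
  have cD: "card D = Suc n" using assms by (simp add: n_def card_gt_0_iff)
  define ext where "ext c p = p(c := n)" for c and p :: "'a \<Rightarrow> nat"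
  let ?X = "{c\<in>D. \<forall>b\<in>D. \<not> r c b}"
  have last: "p c = n" if "p \<in> ext c ` linear_extensions (D - {c}) r" for p c using that by (auto simp: ext_def)
  have sub: "ext c ` linear_extensions (D - {c}) r \<subseteq> linear_extensions D r" if c: "c \<in> ?X" for c
  proof
    fix p assume "p \<in> ext c ` linear_extensions (D - {c}) r"
    then obtain q where q: "q \<in> linear_extensions (D - {c}) r" "p = q(c := n)" by (auto simp: ext_def)
    have cc: "card (D - {c}) = n" using c cD assms by simp
    have b: "bij_betw q (D - {c}) {..<n}" using q cc by (auto simp: linear_extensions_def)
    have "bij_betw p (D - {c}) {..<n}" using b q(2) by (subst bij_betw_cong[of _ p q]) auto
    then have "bij_betw p (insert c (D - {c})) (insert n {..<n})"
      using notIn_Un_bij_betw3[of c "D - {c}" p "{..<n}"] q(2) by simp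
    moreover have "insert c (D - {c}) = D" "insert n {..<n} = {..<card D}" using c cD by auto
    ultimately have "bij_betw p D {..<card D}" by simp
    moreover have "p a < p b" if "a \<in> D" "b \<in> D" "r a b" for a b
    proof -
      have ac: "a \<noteq> c" using c that by auto
      show ?thesis
      proof (cases "b = c")
        case True
        have "q a < n" using b ac that(1) by (auto simp: bij_betw_def)
        then show ?thesis using q True ac by simp
      next
        case False then show ?thesis using q ac that by (auto simp: linear_extensions_def)
      qed
    qed
    moreover have "p a = 0" if "a \<notin> D" for a using that q c by (auto simp: linear_extensions_def)
    ultimately show "p \<in> linear_extensions D r" by (auto simp: linear_extensions_def)
  qed
  have "linear_extensions D r = (\<Union>c\<in>?X. ext c ` linear_extensions (D - {c}) r)"
  proof (intro equalityI subsetI)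
    fix p assume p: "p \<in> linear_extensions D r"
    then have b: "bij_betw p D {..<Suc n}" and m: "\<And>a b. a \<in> D \<Longrightarrow> b \<in> D \<Longrightarrow> r a b \<Longrightarrow> p a < p b"
      by (auto simp: linear_extensions_def cD)
    then have "n \<in> p ` D" by (auto simp: bij_betw_def)
    then obtain c where c: "c \<in> D" "p c = n" by auto
    have lt: "p a < n" if "a \<in> D - {c}" for a
    proof -
      have "p a \<in> {..<Suc n}" "p a \<noteq> p c" using b that c by (auto simp: bij_betw_def inj_on_def)
      then show ?thesis using c by simp
    qed
    have cX: "c \<in> ?X"
    proof -
      have "\<not> r c b" if "b \<in> D" for b
      proof
        assume "r c b" then have "n < p b" using m[of c b] c that by simp
        moreover have "p b < Suc n" using b that by (auto simp: bij_betw_def)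
        ultimately show False by simp
      qed
      then show ?thesis using c by simp
    qed
    have "bij_betw p (D - {c}) ({..<Suc n} - {p c})"
      using b c(1) by (meson bij_betw_DiffI bij_betw_singletonI bij_betwE singletonD empty_subsetI insert_subset lessThan_iff) 
    moreover have "{..<Suc n} - {p c} = {..<card (D - {c})}" using c cD assms by auto
    ultimately have "bij_betw p (D - {c}) {..<card (D - {c})}" by simp
    then have "bij_betw (p(c := 0)) (D - {c}) {..<card (D - {c})}"
      by (subst bij_betw_cong[of _ _ p]) auto
    then have "p(c := 0) \<in> linear_extensions (D - {c}) r"
      using p by (auto simp: linear_extensions_def)
    moreover have "p = ext c (p(c := 0))" using c by (auto simp: ext_def)
    ultimately show "p \<in> (\<Union>c\<in>?X. ext c ` linear_extensions (D - {c}) r)" using cX by blast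
  qed (use sub in blast)
  moreover have "card (\<Union>c\<in>?X. ext c ` linear_extensions (D - {c}) r) =
     (\<Sum>c\<in>?X. card (ext c ` linear_extensions (D - {c}) r))"
  proof (rule card_UN_disjoint)
    show "\<forall>c\<in>?X. \<forall>d\<in>?X. c \<noteq> d \<longrightarrow> ext c ` linear_extensions (D - {c}) r \<inter> ext d ` linear_extensions (D - {d}) r = {}"
    proof (intro ballI impI, rule ccontr)
      fix c d assume cd: "c \<in> ?X" "d \<in> ?X" "c \<noteq> d"
        "ext c ` linear_extensions (D - {c}) r \<inter> ext d ` linear_extensions (D - {d}) r \<noteq> {}"
      then obtain p where p: "p \<in> ext c ` linear_extensions (D - {c}) r" "p \<in> ext d ` linear_extensions (D - {d}) r" by auto
      then have "p c = p d" using last by metis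
      moreover have "inj_on p D" using p(1) sub[OF cd(1)] by (auto simp: linear_extensions_def bij_betw_def)
      ultimately show False using cd by (auto simp: inj_on_def)
    qed
  qed (use assms in auto)
  moreover have "card (ext c ` linear_extensions (D - {c}) r) = card (linear_extensions (D - {c}) r)" for c
  proof (rule card_image, rule inj_onI)
    fix p q assume "p \<in> linear_extensions (D - {c}) r" "q \<in> linear_extensions (D - {c}) r" "ext c p = ext c q"
    then show "p = q" unfolding ext_def linear_extensions_def
      by (metis (mono_tags, lifting) Diff_iff fun_upd_triv fun_upd_upd insertCI mem_Collect_eq)
  qed
  ultimately show ?thesis by simp
qed

text \<open>The binomial coefficient counts interleavings. The last element lies in \<open>A\<close>
  or in \<open>B\<close>, and the two resulting coefficients add up by Pascal's rule.\<close>

lemma card_linear_extensions_disjoint_Un: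
  assumes "finite A" "finite B" "A \<inter> B = {}" "\<And>a b. a \<in> A \<Longrightarrow> b \<in> B \<Longrightarrow> \<not> r a b \<and> \<not> r b a"
  shows "card (linear_extensions (A \<union> B) r) =
     ((card A + card B) choose card A) * (card (linear_extensions A r) * card (linear_extensions B r))"
  using assms
proof (induction "card A + card B" arbitrary: A B rule: less_induct)
  case less
  show ?case
  proof (cases "A = {} \<or> B = {}")
    case True
    then show ?thesis by (auto simp: linear_extensions_empty)
  next
    case False
    let ?mx = "\<lambda>D. {c\<in>D. \<forall>b\<in>D. \<not> r c b}"
    let ?E = "\<lambda>D. card (linear_extensions D r)"
    let ?a = "card A - 1" and ?b = "card B - 1"
    have cA: "card A = Suc ?a" and cB: "card B = Suc ?b" using False less.prems by (simp_all add: card_gt_0_iff)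
    have A: "?E ((A \<union> B) - {c}) = ((?a + card B) choose ?a) * (?E (A - {c}) * ?E B)" if "c \<in> A" for c
    proof -
      have "(A \<union> B) - {c} = (A - {c}) \<union> B" using that less.prems(3) by auto
      moreover have "?E ((A - {c}) \<union> B) = ((card (A - {c}) + card B) choose card (A - {c})) * (?E (A - {c}) * ?E B)"
        by (rule less.hyps) (use less.prems that cA in auto)
      ultimately show ?thesis using that less.prems by simp
    qed
    have B: "?E ((A \<union> B) - {c}) = ((card A + ?b) choose card A) * (?E A * ?E (B - {c}))" if "c \<in> B" for c
    proof -
      have "(A \<union> B) - {c} = A \<union> (B - {c})" using that less.prems(3) by auto
      moreover have "?E (A \<union> (B - {c})) = ((card A + card (B - {c})) choose card A) * (?E A * ?E (B - {c}))"
        by (rule less.hyps) (use less.prems that cB in auto)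
      ultimately show ?thesis using that less.prems by simp
    qed
    have mx: "?mx (A \<union> B) = ?mx A \<union> ?mx B" using less.prems(4) by blast
    have "?E (A \<union> B) = (\<Sum>c\<in>?mx (A \<union> B). ?E ((A \<union> B) - {c}))"
      by (rule card_linear_extensions_rec) (use less.prems False in auto)
    also have "\<dots> = (\<Sum>c\<in>?mx A. ?E ((A \<union> B) - {c})) + (\<Sum>c\<in>?mx B. ?E ((A \<union> B) - {c}))"
      unfolding mx by (rule sum.union_disjoint) (use less.prems in auto)
    also have "(\<Sum>c\<in>?mx A. ?E ((A \<union> B) - {c})) = (\<Sum>c\<in>?mx A. ((?a + card B) choose ?a) * (?E (A - {c}) * ?E B))"
      by (rule sum.cong) (use A in auto)
    also have "\<dots> = ((?a + card B) choose ?a) * (?E A * ?E B)"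
      using card_linear_extensions_rec[of A r] less.prems False by (simp add: sum_distrib_left sum_distrib_right)
    also have "(\<Sum>c\<in>?mx B. ?E ((A \<union> B) - {c})) = (\<Sum>c\<in>?mx B. ((card A + ?b) choose card A) * (?E A * ?E (B - {c})))"
      by (rule sum.cong) (use B in auto)
    also have "\<dots> = ((card A + ?b) choose card A) * (?E A * ?E B)"
      using card_linear_extensions_rec[of B r] less.prems False by (simp add: sum_distrib_left sum_distrib_right)
    also have "((?a + card B) choose ?a) * (?E A * ?E B) + ((card A + ?b) choose card A) * (?E A * ?E B) =
       (((?a + card B) choose ?a) + ((card A + ?b) choose card A)) * (?E A * ?E B)"
      by (simp add: add_mult_distrib)
    also have "((?a + card B) choose ?a) + ((card A + ?b) choose card A) = (card A + card B) choose card A"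
    proof -
      obtain x y where "card A = Suc x" "card B = Suc y" using cA cB by metis
      then show ?thesis by simp
    qed
    finally show ?thesis .
  qed
qed

lemma card_linear_extensions_series_Un:
  assumes "finite A" "finite B" "A \<inter> B = {}" "\<And>a b. a \<in> A \<Longrightarrow> b \<in> B \<Longrightarrow> r a b \<and> \<not> r b a"
  shows "card (linear_extensions (A \<union> B) r) = card (linear_extensions A r) * card (linear_extensions B r)"
  using assms(2,3,4)
proof (induction "card B" arbitrary: B)
  case 0
  then show ?case by (simp add: linear_extensions_empty)
next
  case (Suc n)
  then have ne: "B \<noteq> {}" by auto
  let ?mx = "\<lambda>D. {c\<in>D. \<forall>b\<in>D. \<not> r c b}"
  have "?mx (A \<union> B) = ?mx B" using Suc.prems(3) ne by blast
  then have "card (linear_extensions (A \<union> B) r) = (\<Sum>c\<in>?mx B. card (linear_extensions ((A \<union> B) - {c}) r))"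
    using card_linear_extensions_rec[of "A \<union> B" r] assms(1) Suc.prems ne by simp
  also have "\<dots> = (\<Sum>c\<in>?mx B. card (linear_extensions A r) * card (linear_extensions (B - {c}) r))"
  proof (rule sum.cong)
    fix c assume c: "c \<in> ?mx B"
    have "(A \<union> B) - {c} = A \<union> (B - {c})" using c Suc.prems by auto
    moreover have "card (linear_extensions (A \<union> (B - {c})) r) = card (linear_extensions A r) * card (linear_extensions (B - {c}) r)"
      by (rule Suc.hyps(1)) (use Suc.prems Suc.hyps(2) c in auto)
    ultimately show "card (linear_extensions ((A \<union> B) - {c}) r) = card (linear_extensions A r) * card (linear_extensions (B - {c}) r)" by simp
  qed simp
  also have "\<dots> = card (linear_extensions A r) * card (linear_extensions B r)"
    using card_linear_extensions_rec[of B r] Suc.prems ne by (simp add: sum_distrib_left)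
  finally show ?case .
qed

lemma card_linear_extensions_chain:
  fixes key :: "'c \<Rightarrow> nat"
  assumes "finite A" "inj_on key A" "\<And>a b. a \<in> A \<Longrightarrow> b \<in> A \<Longrightarrow> r a b \<longleftrightarrow> key a < key b"
  shows "card (linear_extensions A r) = 1"
  using assms
proof (induction "card A" arbitrary: A)
  case 0
  then show ?case by (simp add: linear_extensions_empty)
next
  case (Suc n)
  then have ne: "A \<noteq> {}" by auto
  have "Max (key ` A) \<in> key ` A" using Suc.prems ne by (intro Max_in) auto
  then obtain m where m: "m \<in> A" "key m = Max (key ` A)" by auto
  have le: "key a \<le> key m" if "a \<in> A" for a using m Suc.prems(1) that by auto
  have "{c\<in>A. \<forall>b\<in>A. \<not> r c b} = {m}"
  proof (intro equalityI subsetI)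
    fix c assume "c \<in> {c\<in>A. \<forall>b\<in>A. \<not> r c b}"
    then have "c \<in> A" "\<not> key c < key m" using Suc.prems(3) m by auto
    then have "key c = key m" using le by (simp add: order_antisym)
    then show "c \<in> {m}" using Suc.prems(2) \<open>c \<in> A\<close> m by (auto simp: inj_on_def)
  next
    fix c assume "c \<in> {m}"
    then show "c \<in> {c\<in>A. \<forall>b\<in>A. \<not> r c b}" using m le Suc.prems(3) by (auto simp: not_less)
  qed
  then have "card (linear_extensions A r) = card (linear_extensions (A - {m}) r)"
    using card_linear_extensions_rec[of A r] Suc.prems ne by simp
  also have "\<dots> = 1"
    by (rule Suc.hyps(1)) (use Suc.prems Suc.hyps(2) m in \<open>auto intro: inj_on_subset\<close>)
  finally show ?case .
qed

section \<open>A barycentric grid and its alternating flags\<close>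

text \<open>The cube \<open>[-R, R]\<^sup>d\<close> with antipodal boundary points identified is a projective space. Its flag of
  projective subspaces, taken in the order \<open>d, 1, 2, \<dots>, d - 1\<close> of boundary coordinates and followed by the
  interior, has \<open>d + 1\<close> strata: \<open>rk\<close> is the number of the stratum of \<open>u\<close>, and \<open>sg\<close> the sign
  of \<open>u\<close> relative to a representative of its antipodal pair.\<close>

definition inner_block :: "int \<Rightarrow> nat \<Rightarrow> (nat \<Rightarrow> int) \<Rightarrow> bool" where
  "inner_block R d u \<longleftrightarrow> (\<forall>\<kappa>\<in>{1..d}. \<bar>u \<kappa>\<bar> < R)"

definition rk :: "int \<Rightarrow> nat \<Rightarrow> (nat \<Rightarrow> int) \<Rightarrow> nat" where
  "rk R d u = (if inner_block R d u then d else Max (insert 0 {\<kappa>\<in>{1..<d}. u \<kappa> \<noteq> 0}))"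

definition sg :: "int \<Rightarrow> nat \<Rightarrow> (nat \<Rightarrow> int) \<Rightarrow> int" where
  "sg R d u = (if inner_block R d u then 1 else if rk R d u = 0 then sgn (u d) else sgn (u (rk R d u)))"

lemma rk_le: "rk R d u \<le> d"
  by (auto simp: rk_def)

lemma rk_eq_iff: "rk R d u = d \<longleftrightarrow> inner_block R d u"
proof (cases "inner_block R d u")
  case False
  then have "d \<ge> 1" by (auto simp: inner_block_def)
  then have "Max (insert 0 {\<kappa>\<in>{1..<d}. u \<kappa> \<noteq> 0}) < d" by (subst Max_less_iff) auto
  then have "rk R d u < d" using False unfolding rk_def by (simp only: if_False)
  then show ?thesis using False by simp
qed (auto simp: rk_def)

lemma rk_cong:
  assumes "\<And>\<kappa>. \<kappa> \<in> {1..d} \<Longrightarrow> u \<kappa> = v \<kappa>"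
  shows "rk R d u = rk R d v"
proof -
  have "{\<kappa>\<in>{1..<d}. u \<kappa> \<noteq> 0} = {\<kappa>\<in>{1..<d}. v \<kappa> \<noteq> 0}" using assms by auto
  then show ?thesis using assms by (simp add: rk_def inner_block_def)
qed

lemma sg_cong:
  assumes "\<And>\<kappa>. \<kappa> \<in> {1..d} \<Longrightarrow> u \<kappa> = v \<kappa>"
  shows "sg R d u = sg R d v"
proof (cases "d = 0")
  case False
  have "rk R d v \<in> {1..d}" if "rk R d v \<noteq> 0" using rk_le[of R d v] that by auto
  moreover have "inner_block R d u = inner_block R d v" using assms by (simp add: inner_block_def)
  ultimately show ?thesis using assms False rk_cong[OF assms, where R = R] by (simp add: sg_def)
qed (simp add: sg_def inner_block_def)

lemma rk_nonzero:
  assumes "rk R d u \<noteq> 0" "rk R d u \<noteq> d"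
  shows "u (rk R d u) \<noteq> 0" "rk R d u \<in> {1..<d}"
proof -
  let ?S = "insert 0 {\<kappa>\<in>{1..<d}. u \<kappa> \<noteq> 0}"
  have "rk R d u = Max ?S" using assms rk_eq_iff by (simp add: rk_def)
  moreover have "Max ?S \<in> ?S" by (rule Max_in) auto
  ultimately show "u (rk R d u) \<noteq> 0" "rk R d u \<in> {1..<d}" using assms by auto
qed

text \<open>In stratum 0 all coordinates other than \<open>d\<close> vanish, so \<open>d\<close>
  must be the one that puts the point on the boundary.\<close>

lemma rk_zero_starter:
  assumes "rk R d u = 0" "d \<noteq> 0" "\<And>\<kappa>. \<kappa> \<in> {1..d} \<Longrightarrow> \<bar>u \<kappa>\<bar> \<le> R" "R > 0"
  shows "\<bar>u d\<bar> = R"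
proof -
  have ni: "\<not> inner_block R d u" using assms(1,2) rk_eq_iff[of R d u] by auto
  then have "Max (insert 0 {\<kappa>\<in>{1..<d}. u \<kappa> \<noteq> 0}) = 0" using assms(1) by (simp add: rk_def)
  then have z: "u \<kappa> = 0" if "\<kappa> \<in> {1..<d}" for \<kappa>
    using that Max_ge[of "insert 0 {\<kappa>\<in>{1..<d}. u \<kappa> \<noteq> 0}" \<kappa>] by fastforce
  obtain \<kappa> where \<kappa>: "\<kappa> \<in> {1..d}" "\<not> \<bar>u \<kappa>\<bar> < R" using ni by (auto simp: inner_block_def)
  then have "\<kappa> = d" using z[of \<kappa>] assms(4) by (cases "\<kappa> = d") auto
  then show ?thesis using \<kappa> assms(3)[of \<kappa>] by simp
qed

lemma sg_unit:
  assumes "\<And>\<kappa>. \<kappa> \<in> {1..d} \<Longrightarrow> \<bar>u \<kappa>\<bar> \<le> R" "R > 0"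
  shows "sg R d u \<in> {1,-1}"
proof (cases "rk R d u = d")
  case False
  then have d: "d \<noteq> 0" using rk_le[of R d u] by auto
  have "sg R d u = (if rk R d u = 0 then sgn (u d) else sgn (u (rk R d u)))"
    using False rk_eq_iff[of R d u] by (simp add: sg_def)
  moreover have "u d \<noteq> 0" if "rk R d u = 0" using rk_zero_starter[OF that d assms] assms(2) by auto
  moreover have "u (rk R d u) \<noteq> 0" if "rk R d u \<noteq> 0" using rk_nonzero[OF that False] by simp
  ultimately show ?thesis by (auto simp: sgn_if)
qed (simp add: sg_def rk_eq_iff)

section \<open>One coordinate of one block moving from an even value to an adjacent odd one\<close>

locale block_move =
  fixes R :: int and d :: nat and u u' :: "nat \<Rightarrow> int" and \<kappa> :: nat and \<eta> :: int
  assumes R: "even R" "R > 0"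
    and \<kappa>: "\<kappa> \<in> {1..d}" and \<eta>: "\<eta> \<in> {1,-1}"
    and u': "u' = u(\<kappa> := u \<kappa> + \<eta>)"
    and even: "even (u \<kappa>)"
    and bound: "\<And>c. c \<in> {1..d} \<Longrightarrow> \<bar>u c\<bar> \<le> R \<and> \<bar>u' c\<bar> \<le> R"
begin

text \<open>A nonzero even entry has absolute value at least 2, so a unit step can neither kill it
  nor change its sign.\<close>

lemma persist:
  assumes "u c \<noteq> 0"
  shows "u' c \<noteq> 0" "sgn (u' c) = sgn (u c)"
proof -
  have "\<bar>u c\<bar> \<ge> 2" if "c = \<kappa>" using assms even that by (auto elim!: evenE simp: abs_mult)
  then show "u' c \<noteq> 0" "sgn (u' c) = sgn (u c)" using assms \<eta> u' by (auto simp: sgn_if)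
qed

text \<open>The moved entry becomes odd and \<open>R\<close> is even, so a step never enters the
  boundary.\<close>

lemma interior:
  assumes "inner_block R d u"
  shows "inner_block R d u'"
  unfolding inner_block_def
proof
  fix c assume c: "c \<in> {1..d}"
  show "\<bar>u' c\<bar> < R"
  proof (cases "c = \<kappa>")
    case True
    have "odd (u' \<kappa>)" using even \<eta> u' by auto
    then have "\<bar>u' \<kappa>\<bar> \<noteq> R" using R(1) by auto
    then show ?thesis using bound[OF c] True by auto
  next
    case False then show ?thesis using assms c u' by (simp add: inner_block_def)
  qed
qed

text \<open>By \<open>persist\<close> the set of nonzero entries can only grow. Hence the rank rises
  in two ways: the step leaves the last wall and reaches the interior, or it creates a nonzero entry
  at \<open>\<kappa>\<close> above the old rank.\<close>

lemma rk_increase_cases: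
  shows "rk R d u \<le> rk R d u'"
    and "rk R d u = rk R d u' \<Longrightarrow> sg R d u = sg R d u'"
    and "rk R d u < rk R d u' \<Longrightarrow> rk R d u' = d \<and> \<bar>u \<kappa>\<bar> = R \<or>
           rk R d u' = \<kappa> \<and> \<kappa> < d \<and> u \<kappa> = 0 \<and> sg R d u' = \<eta>"
proof -
  let ?N = "\<lambda>u. {c\<in>{1..<d}. u c \<noteq> (0::int)}"
  have Nsub: "?N u \<subseteq> ?N u'" using persist(1) by auto
  have all: "rk R d u \<le> rk R d u' \<and> (rk R d u = rk R d u' \<longrightarrow> sg R d u = sg R d u') \<and>
    (rk R d u < rk R d u' \<longrightarrow> rk R d u' = d \<and> \<bar>u \<kappa>\<bar> = R \<or>
           rk R d u' = \<kappa> \<and> \<kappa> < d \<and> u \<kappa> = 0 \<and> sg R d u' = \<eta>)"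
  proof (cases "inner_block R d u")
    case True
    then show ?thesis using interior[OF True] by (simp add: rk_def sg_def)
  next
    case ni: False
    then have rku: "rk R d u = Max (insert 0 (?N u))" "rk R d u < d"
    proof -
      show "rk R d u = Max (insert 0 (?N u))" using ni by (simp add: rk_def)
      show "rk R d u < d" using ni rk_eq_iff[of R d u] rk_le[of R d u] by linarith
    qed
    show ?thesis
    proof (cases "inner_block R d u'")
      case True
      then have "rk R d u' = d" by (simp add: rk_def)
      moreover have "\<bar>u \<kappa>\<bar> = R"
      proof -
        obtain c where c: "c \<in> {1..d}" "\<not> \<bar>u c\<bar> < R" using ni by (auto simp: inner_block_def)
        moreover have "\<bar>u' c\<bar> < R" using True c(1) by (simp add: inner_block_def)
        ultimately have "c = \<kappa>" using u' by (metis fun_upd_other)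
        then show ?thesis using c bound[OF c(1)] by simp
      qed
      ultimately show ?thesis using rku(2) by simp
    next
      case ni': False
      then have rku': "rk R d u' = Max (insert 0 (?N u'))" "rk R d u' \<noteq> d"
        using rk_eq_iff[of R d u'] by (simp add: rk_def, simp)
      have le: "rk R d u \<le> rk R d u'" unfolding rku(1) rku'(1)
        by (rule Max_mono) (use Nsub in auto)
      have eq: "sg R d u = sg R d u'" if e: "rk R d u = rk R d u'"
      proof (cases "rk R d u = 0")
        case True
        have "u d \<noteq> 0" using rk_zero_starter[of R d u] True rku(2) bound R by force
        then show ?thesis using ni ni' True e persist(2) by (simp add: sg_def)
      next
        case False
        then have "u (rk R d u) \<noteq> 0" using rk_nonzero(1)[of R d u] rku(2) by simp
        then show ?thesis using ni ni' False e persist(2)[of "rk R d u"] by (simp add: sg_def)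
      qed
      have lt: "rk R d u' = \<kappa> \<and> \<kappa> < d \<and> u \<kappa> = 0 \<and> sg R d u' = \<eta>" if l: "rk R d u < rk R d u'"
      proof -
        have n: "u' (rk R d u') \<noteq> 0" "rk R d u' \<in> {1..<d}" using rk_nonzero[of R d u'] rku'(2) l by auto
        have "rk R d u' \<notin> ?N u"
        proof
          assume "rk R d u' \<in> ?N u"
          then have "rk R d u' \<le> Max (insert 0 (?N u))" by (intro Max_ge) auto
          then show False using l unfolding rku(1) by linarith
        qed
        then have z: "u (rk R d u') = 0" using n by auto
        then have k: "rk R d u' = \<kappa>" using n u' by (metis fun_upd_other)
        then have "sg R d u' = sgn (u' \<kappa>)" using ni' n by (simp add: sg_def)
        then show ?thesis using k n z u' \<eta> by (auto simp: sgn_if)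
      qed
      show ?thesis using le eq lt by blast
    qed
  qed
  then show "rk R d u \<le> rk R d u'"
    "rk R d u = rk R d u' \<Longrightarrow> sg R d u = sg R d u'"
    "rk R d u < rk R d u' \<Longrightarrow> rk R d u' = d \<and> \<bar>u \<kappa>\<bar> = R \<or>
           rk R d u' = \<kappa> \<and> \<kappa> < d \<and> u \<kappa> = 0 \<and> sg R d u' = \<eta>" by auto
qed

end

text \<open>Coordinate \<open>(i, b, \<kappa>)\<close> belongs to the direction \<open>v\<^sub>i\<close> if \<open>b\<close> is false and to the polynomial
  \<open>p\<^sub>i\<close> otherwise. The cells are those of the grid with even vertices; the barycentre of a cell has odd
  entries where the cell is an open interval. In \<open>(y, \<eta>, p)\<close>, \<open>y\<close> is the barycentre of the top cell of a
  maximal flag of cells, and coordinate \<open>c\<close> moves from the even value \<open>y c - \<eta> c\<close> to \<open>y c\<close> at step \<open>p c\<close>.\<close>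

type_synonym coord = "nat \<times> bool \<times> nat"
type_synonym grid_flag = "(coord \<Rightarrow> int) \<times> (coord \<Rightarrow> int) \<times> (coord \<Rightarrow> nat)"

definition vertex :: "grid_flag \<Rightarrow> nat \<Rightarrow> coord \<Rightarrow> int" where
  "vertex q l c = (case q of (y, \<eta>, p) \<Rightarrow> if p c < l then y c else y c - \<eta> c)"

lemma vertex_simp: "vertex (y, \<eta>, p) l c = (if p c < l then y c else y c - \<eta> c)"
  by (simp add: vertex_def)

locale block_grid =
  fixes I :: "nat set" and d :: "nat \<Rightarrow> bool \<Rightarrow> nat" and R :: int
  assumes finite_I: "finite I" and d_pos: "\<And>i. i \<in> I \<Longrightarrow> d i True \<ge> 1"
    and even_R: "even R" and R_pos: "R > 0"
begin

definition D :: "coord set" where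
  "D = {(i, b, \<kappa>). i \<in> I \<and> 1 \<le> \<kappa> \<and> \<kappa> \<le> d i b}"

abbreviation M :: nat where "M \<equiv> card D"

text \<open>The number of odd exponents in \<open>{1..d i True}\<close>. Polynomial strata of rank
  below \<open>half i\<close> will contain odd powers only.\<close>

definition half :: "nat \<Rightarrow> nat" where "half i = (d i True + 1) div 2"

definition brk :: "nat \<Rightarrow> bool \<Rightarrow> (coord \<Rightarrow> int) \<Rightarrow> nat" where
  "brk i b x = rk R (d i b) (\<lambda>\<kappa>. x (i, b, \<kappa>))"

definition bsg :: "nat \<Rightarrow> bool \<Rightarrow> (coord \<Rightarrow> int) \<Rightarrow> int" where
  "bsg i b x = sg R (d i b) (\<lambda>\<kappa>. x (i, b, \<kappa>))"

text \<open>A combined rank of the two blocks: the direction enters with its own rank while only odd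
  powers occur in the polynomial, and with full rank afterwards. Its maximum is the number of
  coordinates of index \<open>i\<close>.\<close>

definition rho :: "nat \<Rightarrow> (coord \<Rightarrow> int) \<Rightarrow> nat" where
  "rho i x = brk i True x + (if brk i True x < half i then brk i False x else d i False)"

text \<open>Built to be reversed by p -> -p and preserved by (v, p) -> (-v, p(-t)) on the
  corresponding walls. Under the latter, below \<open>half i\<close> both block signs change and
  cancel; from \<open>half i\<close> on the polynomial sign is unchanged, so the direction sign has
  to be dropped.\<close>

definition beps :: "nat \<Rightarrow> (coord \<Rightarrow> int) \<Rightarrow> int" where
  "beps i x = bsg i True x * (if brk i True x < half i then bsg i False x else 1)"

definition eps :: "(coord \<Rightarrow> int) \<Rightarrow> int" where
  "eps x = (\<Prod>i\<in>I. beps i x)"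

definition flags :: "grid_flag set" where
  "flags = {(y, \<eta>, p). (\<forall>c\<in>D. odd (y c) \<and> \<bar>y c\<bar> < R \<and> \<eta> c \<in> {1,-1}) \<and> (\<forall>c. c \<notin> D \<longrightarrow> y c = 0 \<and> \<eta> c = 0) \<and>
     bij_betw p D {..<M} \<and> (\<forall>c. c \<notin> D \<longrightarrow> p c = 0)}"

lemma D_alt: "D = (SIGMA i:I. SIGMA b:UNIV. {1..d i b})"
  by (auto simp: D_def)

lemma finite_D: "finite D"
  unfolding D_alt using finite_I by (intro finite_SigmaI) auto

lemma card_D: "M = (\<Sum>i\<in>I. d i False + d i True)"
  unfolding D_alt using finite_I by (simp add: card_SigmaI UNIV_bool)

lemma rho_le: "rho i x \<le> d i False + d i True"
  using rk_le[of R "d i True"] rk_le[of R "d i False"] by (auto simp: rho_def brk_def add.commute intro: add_mono)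

lemma vertex_bound:
  assumes "q \<in> flags" "c \<in> D"
  shows "\<bar>vertex q l c\<bar> \<le> R"
  using assms by (cases q) (auto simp: flags_def vertex_simp)

lemma beps_unit:
  assumes "i \<in> I" "\<And>c. c \<in> D \<Longrightarrow> \<bar>x c\<bar> \<le> R"
  shows "beps i x \<in> {1,-1}"
proof -
  have "bsg i b x \<in> {1,-1}" for b
    unfolding bsg_def by (rule sg_unit[OF _ R_pos]) (use assms in \<open>auto simp: D_def\<close>)
  from this[of True] this[of False] show ?thesis by (auto simp: beps_def)
qed

lemma eps_unit:
  assumes "\<And>c. c \<in> D \<Longrightarrow> \<bar>x c\<bar> \<le> R"
  shows "eps x \<in> {1,-1}"
proof -
  have "\<forall>i\<in>J. beps i x \<in> {1,-1} \<Longrightarrow> (\<Prod>i\<in>J. beps i x) \<in> {1,-1}" if "finite J" for J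
    using that by (induction J rule: finite_induct) auto
  then show ?thesis unfolding eps_def using finite_I beps_unit assms by blast
qed

end

section \<open>Ranks and signs along a single flag\<close>

locale flag_step = block_grid +
  fixes q :: grid_flag and y \<eta> :: "coord \<Rightarrow> int" and p :: "coord \<Rightarrow> nat"
  assumes q: "q = (y, \<eta>, p)" "q \<in> flags"
begin

lemma p_bij: "bij_betw p D {..<M}" using q by (auto simp: flags_def)

lemma p_less: "c \<in> D \<Longrightarrow> p c < M" using p_bij by (auto simp: bij_betw_def)

lemma p_inj: "c \<in> D \<Longrightarrow> c' \<in> D \<Longrightarrow> p c = p c' \<Longrightarrow> c = c'" using p_bij by (auto simp: bij_betw_def inj_on_def)

lemma vertex_other: "c' \<in> D \<Longrightarrow> c \<in> D \<Longrightarrow> c' \<noteq> c \<Longrightarrow> vertex q (Suc (p c)) c' = vertex q (p c) c'"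
  using p_inj[of c c'] by (auto simp: q(1) vertex_simp less_Suc_eq)

lemma vertex_before: "vertex q (p c) c = y c - \<eta> c" and vertex_after: "vertex q (Suc (p c)) c = y c"
  by (auto simp: q(1) vertex_simp)

lemma block_unchanged:
  assumes "(i, b, \<kappa>) \<in> D" "j \<in> I" "(j, b') \<noteq> (i, b)"
  shows "brk j b' (vertex q (Suc (p (i, b, \<kappa>)))) = brk j b' (vertex q (p (i, b, \<kappa>)))"
    "bsg j b' (vertex q (Suc (p (i, b, \<kappa>)))) = bsg j b' (vertex q (p (i, b, \<kappa>)))"
proof -
  have "vertex q (Suc (p (i, b, \<kappa>))) (j, b', \<kappa>') = vertex q (p (i, b, \<kappa>)) (j, b', \<kappa>')"
    if "\<kappa>' \<in> {1..d j b'}" for \<kappa>'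
    by (rule vertex_other) (use assms that in \<open>auto simp: D_def\<close>)
  then show "brk j b' (vertex q (Suc (p (i, b, \<kappa>)))) = brk j b' (vertex q (p (i, b, \<kappa>)))"
    "bsg j b' (vertex q (Suc (p (i, b, \<kappa>)))) = bsg j b' (vertex q (p (i, b, \<kappa>)))"
    unfolding brk_def bsg_def by (auto intro!: rk_cong sg_cong)
qed

lemma block_moved:
  assumes c: "(i, b, \<kappa>) \<in> D"
  defines "x \<equiv> vertex q (p (i, b, \<kappa>))" and "x' \<equiv> vertex q (Suc (p (i, b, \<kappa>)))"
  shows "brk i b x \<le> brk i b x'"
    and "brk i b x = brk i b x' \<Longrightarrow> bsg i b x = bsg i b x'"
    and "brk i b x < brk i b x' \<Longrightarrow> brk i b x' = d i b \<and> \<bar>y (i,b,\<kappa>) - \<eta> (i,b,\<kappa>)\<bar> = R \<or>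
       brk i b x' = \<kappa> \<and> \<kappa> < d i b \<and> y (i,b,\<kappa>) = \<eta> (i,b,\<kappa>) \<and> bsg i b x' = \<eta> (i,b,\<kappa>)"
proof -
  let ?u = "\<lambda>\<kappa>'. x (i, b, \<kappa>')"
  let ?u' = "?u(\<kappa> := ?u \<kappa> + \<eta> (i,b,\<kappa>))"
  have eq: "x' (i, b, c) = ?u' c" if "c \<in> {1..d i b}" for c
  proof (cases "c = \<kappa>")
    case False then show ?thesis using vertex_other[of "(i, b, c)" "(i,b,\<kappa>)"] that assms by (auto simp: D_def)
  qed (simp add: x'_def x_def vertex_before vertex_after)
  interpret bm: block_move R "d i b" ?u ?u' \<kappa> "\<eta> (i,b,\<kappa>)"
  proof
    show "even R" "0 < R" by (rule even_R, rule R_pos)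
    show "\<kappa> \<in> {1..d i b}" using c by (auto simp: D_def)
    show "\<eta> (i, b, \<kappa>) \<in> {1, - 1}" using c q by (auto simp: flags_def)
    show "even (x (i, b, \<kappa>))" unfolding x_def vertex_before using c q by (auto simp: flags_def)
    fix c' assume c': "c' \<in> {1..d i b}"
    then have "(i, b, c') \<in> D" using c by (auto simp: D_def)
    then show "\<bar>x (i, b, c')\<bar> \<le> R \<and> \<bar>?u' c'\<bar> \<le> R"
      using vertex_bound[OF q(2), of "(i, b, c')"] eq[OF c'] unfolding x_def x'_def by metis
  qed simp
  have e: "rk R (d i b) (\<lambda>\<kappa>. x' (i, b, \<kappa>)) = rk R (d i b) ?u'" "sg R (d i b) (\<lambda>\<kappa>. x' (i, b, \<kappa>)) = sg R (d i b) ?u'"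
    using eq by (auto intro!: rk_cong sg_cong)
  have z: "x (i,b,\<kappa>) = y (i,b,\<kappa>) - \<eta> (i,b,\<kappa>)" by (simp add: x_def vertex_before)
  show "brk i b x \<le> brk i b x'"
    "brk i b x = brk i b x' \<Longrightarrow> bsg i b x = bsg i b x'"
    "brk i b x < brk i b x' \<Longrightarrow> brk i b x' = d i b \<and> \<bar>y (i,b,\<kappa>) - \<eta> (i,b,\<kappa>)\<bar> = R \<or>
       brk i b x' = \<kappa> \<and> \<kappa> < d i b \<and> y (i,b,\<kappa>) = \<eta> (i,b,\<kappa>) \<and> bsg i b x' = \<eta> (i,b,\<kappa>)"
    using bm.rk_increase_cases unfolding brk_def bsg_def e z by auto
qed

lemma coord_at: "l < M \<Longrightarrow> \<exists>c\<in>D. p c = l"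
  using p_bij unfolding bij_betw_def by (metis (no_types, lifting) imageE lessThan_iff)

lemma brk_mono_step: "j \<in> I \<Longrightarrow> l < M \<Longrightarrow> brk j b (vertex q l) \<le> brk j b (vertex q (Suc l))"
proof -
  assume j: "j \<in> I" and "l < M"
  then obtain i b' \<kappa> where c: "(i, b', \<kappa>) \<in> D" "p (i, b', \<kappa>) = l" using coord_at by fastforce
  then show ?thesis using block_moved(1)[OF c(1)] block_unchanged(1)[OF c(1) j, of b]
    by (cases "(j, b) = (i, b')") auto
qed

lemma brk_mono:
  assumes "j \<in> I" "l \<le> l'" "l' \<le> M"
  shows "brk j b (vertex q l) \<le> brk j b (vertex q l')"
  using assms(2,3)
proof (induction l' rule: dec_induct)
  case (step n) then show ?case using brk_mono_step[OF assms(1), of n b] by simp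
qed simp

lemma bsg_eq_step:
  assumes "j \<in> I" "l < M" "brk j b (vertex q l) = brk j b (vertex q (Suc l))"
  shows "bsg j b (vertex q l) = bsg j b (vertex q (Suc l))"
proof -
  obtain i b' \<kappa> where c: "(i, b', \<kappa>) \<in> D" "p (i, b', \<kappa>) = l" using coord_at[OF assms(2)] by auto
  then show ?thesis using block_moved(2)[OF c(1)] block_unchanged(2)[OF c(1) assms(1), of b] assms(3)
    by (cases "(j, b) = (i, b')") auto
qed

lemma bsg_eq:
  assumes "j \<in> I" "l \<le> l'" "l' \<le> M" "brk j b (vertex q l) = brk j b (vertex q l')"
  shows "bsg j b (vertex q l) = bsg j b (vertex q l')"
  using assms(2,3,4)
proof (induction l' rule: dec_induct)
  case (step n)
  have "brk j b (vertex q l) \<le> brk j b (vertex q n)" "brk j b (vertex q n) \<le> brk j b (vertex q (Suc n))"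
    using brk_mono[OF assms(1), of l n b] brk_mono_step[OF assms(1), of n b] step by auto
  then show ?case using step bsg_eq_step[OF assms(1), of n b] by simp
qed simp

lemma rho_beps_unchanged:
  assumes "(i, b, \<kappa>) \<in> D" "j \<in> I" "j \<noteq> i"
  shows "rho j (vertex q (Suc (p (i, b, \<kappa>)))) = rho j (vertex q (p (i, b, \<kappa>)))"
    "beps j (vertex q (Suc (p (i, b, \<kappa>)))) = beps j (vertex q (p (i, b, \<kappa>)))"
  using block_unchanged[OF assms(1,2)] assms(3) by (auto simp: rho_def beps_def)

lemma rho_mono_step:
  assumes "j \<in> I" "l < M"
  shows "rho j (vertex q l) \<le> rho j (vertex q (Suc l))"
  using brk_mono_step[OF assms, of True] brk_mono_step[OF assms, of False] rk_le
  unfolding rho_def by (auto simp: brk_def intro: add_mono)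

lemma eps_step:
  assumes "(i, b, \<kappa>) \<in> D"
  defines "l \<equiv> p (i, b, \<kappa>)"
  shows "eps (vertex q (Suc l)) = - eps (vertex q l) \<longleftrightarrow> beps i (vertex q (Suc l)) = - beps i (vertex q l)"
proof -
  have i: "i \<in> I" using assms by (auto simp: D_def)
  have s: "eps x = beps i x * (\<Prod>j\<in>I-{i}. beps j x)" for x
    unfolding eps_def using finite_I i by (rule prod.remove)
  have "(\<Prod>j\<in>I-{i}. beps j (vertex q (Suc l))) = (\<Prod>j\<in>I-{i}. beps j (vertex q l))"
    unfolding l_def by (rule prod.cong) (use rho_beps_unchanged[OF assms(1)] in auto)
  moreover have "(\<Prod>j\<in>I-{i}. beps j (vertex q l)) \<noteq> 0"
    using finite_I beps_unit[of _ "vertex q l"] vertex_bound[OF q(2)] by force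
  ultimately show ?thesis unfolding s by (metis mult_cancel_right mult_minus_left)
qed

text \<open>\<open>rho\<close> is monotone along a flag, and a step that leaves it constant also
  leaves constant the block ranks that enter \<open>beps\<close>, hence the block signs.\<close>

lemma beps_flip_rho_increase:
  assumes "(i, b, \<kappa>) \<in> D"
  defines "l \<equiv> p (i, b, \<kappa>)"
  assumes flip: "beps i (vertex q (Suc l)) = - beps i (vertex q l)"
  shows "rho i (vertex q l) < rho i (vertex q (Suc l))"
proof (rule ccontr)
  assume n: "\<not> ?thesis"
  have i: "i \<in> I" and l: "l < M" using assms p_less by (auto simp: D_def)
  let ?x = "vertex q l" and ?x' = "vertex q (Suc l)"
  have eq: "rho i ?x = rho i ?x'" using rho_mono_step[OF i l] n by simp
  have m: "brk i b ?x \<le> brk i b ?x'" for b by (rule brk_mono_step[OF i l])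
  have le: "brk i False ?x' \<le> d i False" "brk i False ?x \<le> d i False" unfolding brk_def by (rule rk_le)+
  have T: "brk i True ?x = brk i True ?x'" using eq m[of True] m[of False] le unfolding rho_def
    by (auto split: if_splits)
  have sT: "bsg i True ?x = bsg i True ?x'" by (rule bsg_eq_step[OF i l T])
  have "beps i ?x = beps i ?x'"
  proof (cases "brk i True ?x < half i")
    case True
    then have "brk i False ?x = brk i False ?x'" using eq T by (simp add: rho_def)
    then have "bsg i False ?x = bsg i False ?x'" by (rule bsg_eq_step[OF i l])
    then show ?thesis using T sT by (simp add: beps_def)
  next
    case False then show ?thesis using T sT by (simp add: beps_def)
  qed
  moreover have "beps i ?x \<in> {1,-1}" by (rule beps_unit[OF i vertex_bound[OF q(2)]])
  ultimately show False using flip by auto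
qed


text \<open>Each of the \<open>M\<close> sign changes raises the total rank \<open>r\<close> by at
  least one, but \<open>r\<close> is bounded by \<open>M\<close>, the sum of all dimensions. So
  \<open>r l = l\<close> throughout and every increase is exactly one.\<close>

lemma rho_step_if_alternating:
  assumes "\<And>l. l < M \<Longrightarrow> eps (vertex q (Suc l)) = - eps (vertex q l)" and c: "(i, b, \<kappa>) \<in> D"
  shows "rho i (vertex q (Suc (p (i, b, \<kappa>)))) = Suc (rho i (vertex q (p (i, b, \<kappa>))))"
proof -
  define r where "r l = (\<Sum>i\<in>I. rho i (vertex q l))" for l
  have step: "r l + (rho i (vertex q (Suc l)) - rho i (vertex q l)) = r (Suc l)"
    "rho i (vertex q l) < rho i (vertex q (Suc l))" if "(i, b, \<kappa>) \<in> D" "l = p (i, b, \<kappa>)" for i b \<kappa> l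
  proof -
    have i: "i \<in> I" and l: "l < M" using that p_less by (auto simp: D_def)
    show lt: "rho i (vertex q l) < rho i (vertex q (Suc l))"
      using beps_flip_rho_increase[OF that(1)] eps_step[OF that(1)] assms(1)[OF l] that(2) by simp
    have "(\<Sum>j\<in>I-{i}. rho j (vertex q (Suc l))) = (\<Sum>j\<in>I-{i}. rho j (vertex q l))"
      by (rule sum.cong) (use rho_beps_unchanged[OF that(1)] that(2) in auto)
    then show "r l + (rho i (vertex q (Suc l)) - rho i (vertex q l)) = r (Suc l)"
      using sum.remove[OF finite_I i, of "\<lambda>i. rho i (vertex q l)"] sum.remove[OF finite_I i, of "\<lambda>i. rho i (vertex q (Suc l))"] lt
      unfolding r_def by simp
  qed
  have r_less: "r l < r (Suc l)" if l: "l < M" for l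
  proof -
    obtain i b \<kappa> where "(i, b, \<kappa>) \<in> D" "p (i, b, \<kappa>) = l" using coord_at[OF l] by auto
    then show ?thesis using step[of i b \<kappa> l] by simp
  qed
  have low: "l \<le> M \<Longrightarrow> l \<le> r l" for l
  proof (induction l)
    case (Suc l) then show ?case using r_less[of l] by simp
  qed simp
  have rM: "r M \<le> M" unfolding r_def card_D by (rule sum_mono) (rule rho_le)
  have up: "k \<le> M \<Longrightarrow> r (M - k) \<le> M - k" for k
  proof (induction k)
    case (Suc k)
    then have "r (M - Suc k) < r (M - k)" using r_less[of "M - Suc k"] by (simp add: Suc_diff_Suc)
    then show ?case using Suc by simp
  qed (use rM in simp)
  have r: "r l = l" if "l \<le> M" for l using up[of "M - l"] low[OF that] that by simp
  have "p (i, b, \<kappa>) < M" using p_less[OF c] .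
  then show ?thesis using step[OF c refl] r[of "p (i, b, \<kappa>)"] r[of "Suc (p (i, b, \<kappa>))"] by simp
qed

end

context block_grid
begin

text \<open>The order forced on the steps of an alternating flag: increasing within a block, and the
  whole direction before any polynomial coordinate that lifts the rank to \<open>half i\<close> or
  more.\<close>

definition prec :: "coord \<Rightarrow> coord \<Rightarrow> bool" where
  "prec = (\<lambda>(i, b, \<kappa>) (i', b', \<kappa>'). i = i' \<and> (b = b' \<and> \<kappa> < \<kappa>' \<or> \<not> b \<and> b' \<and> half i \<le> \<kappa>'))"

text \<open>The forced shape of an alternating flag: coordinates below \<open>d i b\<close> leave 0
  with alternating signs, and coordinate \<open>d i b\<close> leaves the wall at
  \<open>(-1) ^ d i b * R\<close> inwards. The exponent counts the sign changes still to come before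
  the interior, whose sign is 1.\<close>

definition y_alt :: "coord \<Rightarrow> int" where
  "y_alt = (\<lambda>(i, b, \<kappa>). if (i, b, \<kappa>) \<in> D then (if \<kappa> < d i b then (-1) ^ (d i b - \<kappa>) else (-1) ^ d i b * (R - 1)) else 0)"

definition \<eta>_alt :: "coord \<Rightarrow> int" where
  "\<eta>_alt = (\<lambda>(i, b, \<kappa>). if (i, b, \<kappa>) \<in> D then (if \<kappa> < d i b then (-1) ^ (d i b - \<kappa>) else - ((-1) ^ d i b)) else 0)"

end

section \<open>Alternating flags are determined by a linear extension\<close>

locale alternating_flag = flag_step +
  assumes alt: "\<And>l. l < M \<Longrightarrow> eps (vertex q (Suc l)) = - eps (vertex q l)"
begin

text \<open>\<open>rho\<close> grows by exactly one. If a polynomial step crosses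
  \<open>half i\<close>, then \<open>rho\<close> also gains \<open>d i False - brk i False\<close>;
  this must be 0, so the direction is already interior and its dropped sign is 1. From
  \<open>half i\<close> on, \<open>rho\<close> ignores direction steps, so none can occur
  there.\<close>

lemma block_facts:
  assumes c: "(i, b, \<kappa>) \<in> D"
  defines "l \<equiv> p (i, b, \<kappa>)"
  shows "brk i b (vertex q l) < brk i b (vertex q (Suc l))"
    and "bsg i b (vertex q (Suc l)) = - bsg i b (vertex q l)"
    and "\<not> b \<Longrightarrow> brk i True (vertex q l) < half i"
proof -
  let ?x = "vertex q l" and ?x' = "vertex q (Suc l)"
  have i: "i \<in> I" and l: "l < M" using assms p_less by (auto simp: D_def)
  have rho: "rho i ?x' = Suc (rho i ?x)" unfolding l_def by (rule rho_step_if_alternating[OF alt c])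
  have flip: "beps i ?x' = - beps i ?x" using eps_step[OF c] alt[OF l] by (simp add: l_def)
  have m: "brk i b ?x \<le> brk i b ?x'" for b by (rule brk_mono_step[OF i l])
  have le: "brk i False ?x \<le> d i False" unfolding brk_def by (rule rk_le)
  have inner: "bsg i False ?x = 1" if "brk i False ?x = d i False"
    using that unfolding bsg_def brk_def by (simp add: sg_def rk_eq_iff)
  have un: "brk i (\<not> b) ?x' = brk i (\<not> b) ?x" "bsg i (\<not> b) ?x' = bsg i (\<not> b) ?x"
    unfolding l_def using block_unchanged[OF c i, of "\<not> b"] by auto
  have unit: "bsg i b x \<in> {1,-1}" if "x = ?x \<or> x = ?x'" for b x
    unfolding bsg_def by (rule sg_unit[OF _ R_pos]) (use that vertex_bound[OF q(2)] i in \<open>auto simp: D_def\<close>)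
  have "brk i b ?x < brk i b ?x' \<and> bsg i b ?x' = - bsg i b ?x \<and> (\<not> b \<longrightarrow> brk i True ?x < half i)"
  proof (cases b)
    case True
    then have lt: "brk i True ?x < brk i True ?x'"
      using rho un(1) m[of True] unfolding rho_def by (cases "brk i True ?x = brk i True ?x'") (auto split: if_splits)
    have "bsg i True ?x' = - bsg i True ?x"
    proof (cases "brk i True ?x < half i")
      case low: True
      show ?thesis
      proof (cases "brk i True ?x' < half i")
        case True
        then show ?thesis using flip low un \<open>b\<close> unit[of "?x" False] by (auto simp: beps_def)
      next
        case False
        then have "brk i False ?x = d i False" using rho lt le low by (simp add: rho_def)
        then show ?thesis using flip low False inner by (simp add: beps_def)
      qed
    next
      case False
      then show ?thesis using flip lt by (simp add: beps_def)
    qed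
    then show ?thesis using lt True by simp
  next
    case False
    have low: "brk i True ?x < half i" using rho un(1) False by (auto simp: rho_def split: if_splits)
    then have "brk i False ?x < brk i False ?x'" using rho un(1) False by (simp add: rho_def)
    moreover have "bsg i False ?x' = - bsg i False ?x"
      using flip low un False unit[of "?x" True] by (auto simp: beps_def)
    ultimately show ?thesis using low False by simp
  qed
  then show "brk i b ?x < brk i b ?x'" "bsg i b ?x' = - bsg i b ?x" "\<not> b \<Longrightarrow> brk i True ?x < half i" by auto
qed

text \<open>Otherwise the step reaches full rank. So does the step of coordinate
  \<open>d i b\<close>, by \<open>block_moved\<close>, and a monotone rank cannot strictly increase
  to its maximum twice.\<close>

lemma brk_after:
  assumes c: "(i, b, \<kappa>) \<in> D"
  shows "brk i b (vertex q (Suc (p (i, b, \<kappa>)))) = \<kappa>"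
proof (rule ccontr)
  assume n: "\<not> ?thesis"
  then have full: "brk i b (vertex q (Suc (p (i, b, \<kappa>)))) = d i b" using block_moved(3)[OF c block_facts(1)[OF c]] by auto
  have i: "i \<in> I" using c by (auto simp: D_def)
  define c' where "c' = (i, b, d i b)"
  have c': "(i, b, d i b) \<in> D" and ne: "(i, b, \<kappa>) \<noteq> c'" using c n full by (auto simp: D_def c'_def)
  have full': "brk i b (vertex q (Suc (p c'))) = d i b"
    unfolding c'_def using block_moved(3)[OF c' block_facts(1)[OF c']] by auto
  have M: "p (i, b, \<kappa>) < M" "p c' < M" using c c' p_less by (auto simp: c'_def)
  have "p (i, b, \<kappa>) \<noteq> p c'" using p_inj[OF c, of c'] c' ne by (auto simp: c'_def)
  then consider "p (i, b, \<kappa>) < p c'" | "p c' < p (i, b, \<kappa>)" by linarith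
  then show False
  proof cases
    case 1
    then have "d i b \<le> brk i b (vertex q (p c'))" using brk_mono[OF i, of "Suc (p (i, b, \<kappa>))" "p c'" b] M full by simp
    then show False using block_facts(1)[OF c'] full' by (simp add: c'_def)
  next
    case 2
    then have "d i b \<le> brk i b (vertex q (p (i, b, \<kappa>)))" using brk_mono[OF i, of "Suc (p c')" "p (i, b, \<kappa>)" b] M full' by simp
    then show False using block_facts(1)[OF c] full by simp
  qed
qed

lemma p_mono:
  assumes "(i, b, \<kappa>) \<in> D" "(i, b, \<kappa>') \<in> D" "\<kappa> < \<kappa>'"
  shows "p (i, b, \<kappa>) < p (i, b, \<kappa>')"
proof (rule ccontr)
  assume "\<not> ?thesis"
  moreover have "p (i, b, \<kappa>) \<noteq> p (i, b, \<kappa>')" using p_inj[OF assms(1,2)] assms(3) by auto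
  ultimately have lt: "Suc (p (i, b, \<kappa>')) \<le> p (i, b, \<kappa>)" by linarith
  have "i \<in> I" using assms by (auto simp: D_def)
  then have "\<kappa>' \<le> brk i b (vertex q (p (i, b, \<kappa>)))"
    using brk_mono[OF _ lt, of i b] p_less[OF assms(1)] brk_after[OF assms(2)] by simp
  then show False using block_facts(1)[OF assms(1)] brk_after[OF assms(1)] assms(3) by simp
qed

text \<open>Once coordinate \<open>\<kappa>'\<close> has moved, the polynomial rank is at least
  \<open>half i\<close>, where \<open>block_facts\<close> forbids direction steps.\<close>

lemma p_cross:
  assumes "(i, False, \<kappa>) \<in> D" "(i, True, \<kappa>') \<in> D" "half i \<le> \<kappa>'"
  shows "p (i, False, \<kappa>) < p (i, True, \<kappa>')"
proof (rule ccontr)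
  assume "\<not> ?thesis"
  moreover have "p (i, False, \<kappa>) \<noteq> p (i, True, \<kappa>')" using p_inj[OF assms(1,2)] by auto
  ultimately have lt: "Suc (p (i, True, \<kappa>')) \<le> p (i, False, \<kappa>)" by linarith
  have "i \<in> I" using assms by (auto simp: D_def)
  then have "\<kappa>' \<le> brk i True (vertex q (p (i, False, \<kappa>)))"
    using brk_mono[OF _ lt, of i True] p_less[OF assms(1)] brk_after[OF assms(2)] by simp
  then show False using block_facts(3)[OF assms(1)] assms(3) by simp
qed

lemma p_linear_extension: "p \<in> linear_extensions D prec"
proof -
  have "p (i, b, \<kappa>) < p (i', b', \<kappa>')" if "(i, b, \<kappa>) \<in> D" "(i', b', \<kappa>') \<in> D" "prec (i, b, \<kappa>) (i', b', \<kappa>')" for i b \<kappa> i' b' \<kappa>'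
    using that p_mono[of i b \<kappa> \<kappa>'] p_cross[of i \<kappa> \<kappa>'] by (auto simp: prec_def)
  moreover have "\<forall>c. c \<notin> D \<longrightarrow> p c = 0" using q by (simp add: flags_def)
  ultimately show ?thesis using p_bij by (auto simp: linear_extensions_def)
qed

lemma brk_before:
  assumes c: "(i, b, \<kappa>) \<in> D" "(i, b, Suc \<kappa>) \<in> D"
  shows "brk i b (vertex q (p (i, b, Suc \<kappa>))) = \<kappa>"
    "bsg i b (vertex q (p (i, b, Suc \<kappa>))) = bsg i b (vertex q (Suc (p (i, b, \<kappa>))))"
proof -
  have i: "i \<in> I" using c by (auto simp: D_def)
  have le: "Suc (p (i, b, \<kappa>)) \<le> p (i, b, Suc \<kappa>)" "p (i, b, Suc \<kappa>) \<le> M" using p_mono[OF c] p_less[OF c(2)] by auto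
  have "\<kappa> \<le> brk i b (vertex q (p (i, b, Suc \<kappa>)))" using brk_mono[OF i le, of b] brk_after[OF c(1)] by simp
  moreover have "brk i b (vertex q (p (i, b, Suc \<kappa>))) < Suc \<kappa>" using block_facts(1)[OF c(2)] brk_after[OF c(2)] by simp
  ultimately show e: "brk i b (vertex q (p (i, b, Suc \<kappa>))) = \<kappa>" by simp
  show "bsg i b (vertex q (p (i, b, Suc \<kappa>))) = bsg i b (vertex q (Suc (p (i, b, \<kappa>))))"
    using bsg_eq[OF i le, of b] e brk_after[OF c(1)] by simp
qed

text \<open>Read backwards from the interior, which has sign 1; each step of the block reverses the
  sign.\<close>

lemma bsg_after:
  assumes c: "(i, b, \<kappa>) \<in> D"
  shows "bsg i b (vertex q (Suc (p (i, b, \<kappa>)))) = (-1) ^ (d i b - \<kappa>)"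
  using assms
proof (induction "d i b - \<kappa>" arbitrary: \<kappa>)
  case 0
  then have "\<kappa> = d i b" by (auto simp: D_def)
  then have "brk i b (vertex q (Suc (p (i, b, \<kappa>)))) = d i b" using brk_after[OF 0(2)] by simp
  then show ?case using 0 unfolding brk_def bsg_def by (simp add: sg_def rk_eq_iff)
next
  case (Suc n)
  then have c': "(i, b, Suc \<kappa>) \<in> D" by (auto simp: D_def)
  have n: "n = d i b - Suc \<kappa>" using Suc.hyps(2) by simp
  have "bsg i b (vertex q (Suc (p (i, b, \<kappa>)))) = - bsg i b (vertex q (Suc (p (i, b, Suc \<kappa>))))"
    using block_facts(2)[OF c'] brk_before(2)[OF Suc.prems c'] by simp
  also have "\<dots> = - ((-1) ^ n)" using Suc.hyps(1)[OF n c'] n by simp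
  finally show ?case using Suc.hyps(2) by (metis mult_minus1 power_Suc)
qed

lemma y_\<eta>_determined: "y = y_alt" "\<eta> = \<eta>_alt"
proof -
  have "y c = y_alt c \<and> \<eta> c = \<eta>_alt c" for c
  proof (cases "c \<in> D")
    case False
    then show ?thesis using q by (cases c) (auto simp: flags_def y_alt_def \<eta>_alt_def)
  next
    case True
    obtain i b \<kappa> where c: "c = (i, b, \<kappa>)" by (cases c)
    have cD: "(i, b, \<kappa>) \<in> D" using True c by simp
    have i: "i \<in> I" using cD by (auto simp: D_def)
    note mv = block_moved(3)[OF cD block_facts(1)[OF cD]] brk_after[OF cD] bsg_after[OF cD]
    have f: "odd (y c)" "\<bar>y c\<bar> < R" "\<eta> c \<in> {1,-1}" using q True by (auto simp: flags_def)
    show ?thesis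
    proof (cases "\<kappa> < d i b")
      case lt: True
      then show ?thesis using mv cD c by (auto simp: y_alt_def \<eta>_alt_def)
    next
      case False
      then have k: "\<kappa> = d i b" using cD by (auto simp: D_def)
      \<comment> \<open>Before the first step of the block its rank is 0, which puts coordinate
        \<open>d i b\<close> on the wall; its side is opposite to the sign after that step.\<close>
      let ?x = "vertex q (p (i, b, 1))"
      have c1: "(i, b, 1) \<in> D" using cD by (auto simp: D_def)
      have start: "?x c = y c - \<eta> c"
      proof -
        have "p (i, b, 1) \<le> p c" using p_mono[OF c1 cD] c k cD by (cases "\<kappa> = 1") (auto simp: D_def)
        then show ?thesis by (simp add: q(1) vertex_simp)
      qed
      have "brk i b ?x < 1" using block_facts(1)[OF c1] brk_after[OF c1] by simp
      then have r0: "brk i b ?x = 0" by simp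
      have d0: "d i b \<noteq> 0" using cD by (auto simp: D_def)
      have "bsg i b ?x = sgn (?x c)"
        using r0 d0 rk_eq_iff[of R "d i b" "\<lambda>\<kappa>. ?x (i, b, \<kappa>)"] c k unfolding bsg_def brk_def by (auto simp: sg_def)
      moreover have "bsg i b ?x = (-1) ^ d i b"
      proof -
        have "- bsg i b ?x = (-1) ^ (d i b - 1)" using block_facts(2)[OF c1] bsg_after[OF c1] by simp
        then show ?thesis using d0 by (cases "d i b") auto
      qed
      moreover have "\<bar>?x c\<bar> = R"
        unfolding c k
        by (rule rk_zero_starter[where u = "\<lambda>\<kappa>. ?x (i, b, \<kappa>)"])
          (use r0 d0 R_pos i vertex_bound[OF q(2)] in \<open>auto simp: brk_def D_def\<close>)
      ultimately have "y c - \<eta> c = (-1) ^ d i b * R" using start by (metis mult_sgn_abs)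
      moreover have "(-1::int) ^ d i b \<in> {1,-1}" by (metis insertCI neg_one_even_power neg_one_odd_power)
      ultimately have "\<eta> c = - ((-1) ^ d i b) \<and> y c = (-1) ^ d i b * (R - 1)"
        using f by (auto simp: abs_if split: if_splits)
      then show ?thesis using c k cD by (simp add: y_alt_def \<eta>_alt_def)
    qed
  qed
  then show "y = y_alt" "\<eta> = \<eta>_alt" by auto
qed

end

text \<open>Describes the point of the forced flag at which exactly the coordinates 1, ...,
  \<open>t\<close> of a block have moved.\<close>

lemma rk_sg_canonical:
  assumes "R > 1" "t \<le> d"
    and low: "\<And>\<kappa>. \<kappa> \<in> {1..d} \<Longrightarrow> \<kappa> \<le> t \<Longrightarrow> u \<kappa> = (if \<kappa> < d then (-1) ^ (d - \<kappa>) else (-1) ^ d * (R - 1))"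
    and high: "\<And>\<kappa>. \<kappa> \<in> {1..d} \<Longrightarrow> t < \<kappa> \<Longrightarrow> u \<kappa> = (if \<kappa> < d then 0 else (-1) ^ d * R)"
  shows "rk R d u = t" "sg R d u = (-1) ^ (d - t)"
proof -
  have pm: "\<bar>(-1::int) ^ k\<bar> = 1" for k by (simp add: power_abs)
  have sp: "sgn ((-1::int) ^ k) = (-1) ^ k" for k by (cases "even k") auto
  have "rk R d u = t \<and> sg R d u = (-1) ^ (d - t)"
  proof (cases "t = d")
    case True
    have "\<bar>u \<kappa>\<bar> < R" if "\<kappa> \<in> {1..d}" for \<kappa> using low[OF that] that True assms(1) pm by (auto simp: abs_mult)
    then have "inner_block R d u" by (auto simp: inner_block_def)
    then show ?thesis using True by (simp add: rk_def sg_def)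
  next
    case False
    then have d: "d \<in> {1..d}" "t < d" using assms(2) by auto
    then have ud: "u d = (-1) ^ d * R" using high[of d] by simp
    then have "\<not> \<bar>u d\<bar> < R" using pm assms(1) by (simp add: abs_mult)
    then have ni: "\<not> inner_block R d u" using d(1) unfolding inner_block_def by blast
    have "{\<kappa>\<in>{1..<d}. u \<kappa> \<noteq> 0} = {1..t}"
    proof (intro equalityI subsetI)
      fix \<kappa> assume "\<kappa> \<in> {\<kappa>\<in>{1..<d}. u \<kappa> \<noteq> 0}"
      then show "\<kappa> \<in> {1..t}" using high[of \<kappa>] by (cases "\<kappa> \<le> t") auto
    next
      fix \<kappa> assume "\<kappa> \<in> {1..t}"
      then show "\<kappa> \<in> {\<kappa>\<in>{1..<d}. u \<kappa> \<noteq> 0}" using low[of \<kappa>] d by auto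
    qed
    moreover have "Max (insert 0 {1..t}) = t" by (rule Max_eqI) auto
    ultimately have rk: "rk R d u = t" using ni by (simp add: rk_def)
    have "sg R d u = (-1) ^ (d - t)"
    proof (cases "t = 0")
      case True
      then show ?thesis using ni rk ud assms(1) pm[of d] by (simp add: sg_def sgn_mult sp)
    next
      case False
      then show ?thesis using ni rk low[of t] d by (simp add: sg_def sp)
    qed
    then show ?thesis using rk by simp
  qed
  then show "rk R d u = t" "sg R d u = (-1) ^ (d - t)" by auto
qed

context block_grid
begin

lemma y_\<eta>_alt_flag:
  assumes "p \<in> linear_extensions D prec"
  shows "(y_alt, \<eta>_alt, p) \<in> flags"
proof -
  have R2: "R \<ge> 2" using even_R R_pos by (auto elim!: evenE)
  have pm: "\<bar>(-1::int) ^ k\<bar> = 1" for k by (simp add: power_abs)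
  have pm': "(-1::int) ^ k = 1 \<or> (-1::int) ^ k = -1" for k by (metis neg_one_even_power neg_one_odd_power)
  have "odd (y_alt c) \<and> \<bar>y_alt c\<bar> < R \<and> \<eta>_alt c \<in> {1,-1}" if "c \<in> D" for c
    using that R2 even_R pm pm' by (cases c) (auto simp: y_alt_def \<eta>_alt_def abs_mult)
  moreover have "y_alt c = 0 \<and> \<eta>_alt c = 0" if "c \<notin> D" for c
    using that by (cases c) (auto simp: y_alt_def \<eta>_alt_def)
  ultimately show ?thesis using assms by (auto simp: flags_def linear_extensions_def)
qed

text \<open>Each step reverses the sign of its own block, and \<open>prec\<close> makes this visible
  in \<open>beps\<close>: a direction step occurs while the polynomial rank is below
  \<open>half i\<close>, and a polynomial step reaching \<open>half i\<close> finds the direction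
  complete, with sign 1.\<close>

lemma alternating_if_linear_extension:
  assumes p: "p \<in> linear_extensions D prec" and l: "l < M"
  defines "q \<equiv> (y_alt, \<eta>_alt, p)"
  shows "eps (vertex q (Suc l)) = - eps (vertex q l)"
proof -
  have q: "q \<in> flags" unfolding q_def by (rule y_\<eta>_alt_flag[OF p])
  interpret flag_step I d R q y_alt \<eta>_alt p
    by unfold_locales (use q in \<open>auto simp: q_def\<close>)
  have R1: "R > 1" using even_R R_pos by (auto elim!: evenE)
  have mono: "p a < p b" if "a \<in> D" "b \<in> D" "prec a b" for a b using p that by (auto simp: linear_extensions_def)
  have canon: "brk i b (vertex q l) = t" "bsg i b (vertex q l) = (-1) ^ (d i b - t)"
    if "i \<in> I" "t \<le> d i b" "\<And>\<kappa>. \<kappa> \<in> {1..d i b} \<Longrightarrow> p (i, b, \<kappa>) < l \<longleftrightarrow> \<kappa> \<le> t" for i b t l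
    unfolding brk_def bsg_def
    by (rule rk_sg_canonical[OF R1 that(2)];
        use that in \<open>auto simp: q_def vertex_simp y_alt_def \<eta>_alt_def D_def algebra_simps\<close>)+
  have ex: "\<exists>t\<le>d i b. \<forall>\<kappa>\<in>{1..d i b}. p (i, b, \<kappa>) < l \<longleftrightarrow> \<kappa> \<le> t" if iI: "i \<in> I" for i b l
  proof -
    let ?S = "insert 0 {\<kappa>\<in>{1..d i b}. p (i, b, \<kappa>) < l}"
    have mx: "Max ?S \<in> ?S" by (rule Max_in) auto
    have "p (i, b, \<kappa>) < l \<longleftrightarrow> \<kappa> \<le> Max ?S" if k: "\<kappa> \<in> {1..d i b}" for \<kappa>
    proof
      assume "p (i, b, \<kappa>) < l" then show "\<kappa> \<le> Max ?S" using k by (intro Max_ge) auto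
    next
      assume le: "\<kappa> \<le> Max ?S"
      then have m: "Max ?S \<in> {1..d i b}" "p (i, b, Max ?S) < l" using mx k by auto
      show "p (i, b, \<kappa>) < l"
      proof (cases "\<kappa> = Max ?S")
        case False
        then have "p (i, b, \<kappa>) < p (i, b, Max ?S)"
          using le k m iI by (intro mono) (auto simp: D_def prec_def)
        then show ?thesis using m by simp
      qed (use m in simp)
    qed
    moreover have "Max ?S \<le> d i b" using mx by auto
    ultimately show ?thesis by blast
  qed
  obtain i b \<kappa> where c: "(i, b, \<kappa>) \<in> D" "p (i, b, \<kappa>) = l" using coord_at[OF l] by auto
  have i: "i \<in> I" and k: "\<kappa> \<in> {1..d i b}" using c by (auto simp: D_def)
  have other: "p (i, b, \<kappa>') < l \<longleftrightarrow> \<kappa>' < \<kappa>" if "\<kappa>' \<in> {1..d i b}" for \<kappa>'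
  proof (cases "\<kappa>' = \<kappa>")
    case False
    have "(i, b, \<kappa>') \<in> D" using that i by (auto simp: D_def)
    then show ?thesis using False mono[of "(i, b, \<kappa>')" "(i, b, \<kappa>)"] mono[of "(i, b, \<kappa>)" "(i, b, \<kappa>')"] c
      by (cases "\<kappa>' < \<kappa>") (auto simp: prec_def)
  qed (use c in simp)
  have other': "p (i, b, \<kappa>') < Suc l \<longleftrightarrow> \<kappa>' \<le> \<kappa>" if k': "\<kappa>' \<in> {1..d i b}" for \<kappa>'
  proof -
    have "(i, b, \<kappa>') \<in> D" using that i by (auto simp: D_def)
    then have "p (i, b, \<kappa>') = l \<longleftrightarrow> \<kappa>' = \<kappa>" using p_inj[of "(i, b, \<kappa>')" "(i, b, \<kappa>)"] c by auto
    then show ?thesis using other[OF k'] by (auto simp: less_Suc_eq)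
  qed
  have bef: "brk i b (vertex q l) = \<kappa> - 1" "bsg i b (vertex q l) = (-1) ^ (d i b - (\<kappa> - 1))"
    by (rule canon[OF i]; use k other in auto)+
  have aft: "brk i b (vertex q (Suc l)) = \<kappa>" "bsg i b (vertex q (Suc l)) = (-1) ^ (d i b - \<kappa>)"
    by (rule canon[OF i]; use k other' in auto)+
  have flip: "bsg i b (vertex q (Suc l)) = - bsg i b (vertex q l)"
  proof -
    have "d i b - (\<kappa> - 1) = Suc (d i b - \<kappa>)" using k by auto
    then show ?thesis unfolding bef aft by simp
  qed
  have un: "brk i (\<not> b) (vertex q (Suc l)) = brk i (\<not> b) (vertex q l)" "bsg i (\<not> b) (vertex q (Suc l)) = bsg i (\<not> b) (vertex q l)"
    using block_unchanged[OF c(1) i, of "\<not> b"] c(2) by auto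
  have "beps i (vertex q (Suc l)) = - beps i (vertex q l)"
  proof (cases b)
    case True
    show ?thesis
    proof (cases "\<kappa> < half i")
      case low: True
      then show ?thesis using bef(1) aft(1) flip un True by (simp add: beps_def)
    next
      case False
      have "bsg i False (vertex q l) = (-1) ^ (d i False - d i False)"
      proof (rule canon(2)[OF i])
        fix \<kappa>' assume "\<kappa>' \<in> {1..d i False}"
        then show "p (i, False, \<kappa>') < l \<longleftrightarrow> \<kappa>' \<le> d i False"
          using mono[of "(i, False, \<kappa>')" "(i, b, \<kappa>)"] c False True i by (auto simp: D_def prec_def)
      qed simp
      then show ?thesis using aft(1) flip un True False by (simp add: beps_def)
    qed
  next
    case False
    obtain t where t: "t \<le> d i True" "\<And>\<kappa>'. \<kappa>' \<in> {1..d i True} \<Longrightarrow> p (i, True, \<kappa>') < l \<longleftrightarrow> \<kappa>' \<le> t"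
      using ex[OF i, of True l] by blast
    have "brk i True (vertex q l) = t" by (rule canon[OF i t])
    moreover have "t < half i"
    proof (rule ccontr)
      assume n: "\<not> t < half i"
      have "half i \<ge> 1" using d_pos[OF i] by (simp add: half_def)
      then have h: "t \<in> {1..d i True}" using n t(1) by auto
      then have "p (i, True, t) < l" using t(2) by simp
      moreover have "l < p (i, True, t)"
        using mono[of "(i, b, \<kappa>)" "(i, True, t)"] c n False h i by (auto simp: D_def prec_def)
      ultimately show False by simp
    qed
    ultimately show ?thesis using flip un False by (simp add: beps_def)
  qed
  then show ?thesis using eps_step[OF c(1)] c(2) by simp
qed

theorem alternating_flags_eq:
  "{q\<in>flags. \<forall>l<M. eps (vertex q (Suc l)) = - eps (vertex q l)} = (\<lambda>p. (y_alt, \<eta>_alt, p)) ` linear_extensions D prec"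
proof (intro equalityI subsetI)
  fix q assume "q \<in> {q\<in>flags. \<forall>l<M. eps (vertex q (Suc l)) = - eps (vertex q l)}"
  moreover obtain y \<eta> p where "q = (y, \<eta>, p)" by (cases q)
  ultimately interpret alternating_flag I d R q y \<eta> p by unfold_locales auto
  show "q \<in> (\<lambda>p. (y_alt, \<eta>_alt, p)) ` linear_extensions D prec"
    using q(1) y_\<eta>_determined p_linear_extension by auto
qed (use alternating_if_linear_extension y_\<eta>_alt_flag in auto)

lemma card_alternating_flags:
  "card {q\<in>flags. \<forall>l<M. eps (vertex q (Suc l)) = - eps (vertex q l)} = card (linear_extensions D prec)"
  unfolding alternating_flags_eq by (rule card_image) (auto simp: inj_on_def)

end

section \<open>Gluing flags along the boundary identifications\<close>

context block_grid
begin

text \<open>Different indices are incomparable, so extensions are shuffles of the extensions for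
  single indices. The factorials stand on the left to avoid division.\<close>

lemma card_linear_extensions_blocks:
  assumes indep: "\<And>i b \<kappa> i' b' \<kappa>'. i \<noteq> i' \<Longrightarrow> \<not> r (i, b, \<kappa>) (i', b', \<kappa>')"
  shows "card (linear_extensions D r) * (\<Prod>i\<in>I. fact (d i False + d i True)) =
     fact M * (\<Prod>i\<in>I. card (linear_extensions {c\<in>D. fst c = i} r))"
proof -
  let ?m = "\<lambda>i. d i False + d i True"
  have c1: "card {c\<in>D. fst c = i} = ?m i" if "i \<in> I" for i
  proof -
    have "{c\<in>D. fst c = i} = (\<lambda>(b, \<kappa>). (i, b, \<kappa>)) ` (SIGMA b:UNIV. {1..d i b})" using that by (auto simp: D_def)
    moreover have "inj_on (\<lambda>(b, \<kappa>). (i, b, \<kappa>)) (SIGMA b:UNIV. {1..d i b})" by (auto simp: inj_on_def)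
    ultimately show ?thesis by (simp add: card_image card_SigmaI UNIV_bool)
  qed
  have "card {c\<in>D. fst c \<in> J} = (\<Sum>i\<in>J. ?m i) \<and>
    card (linear_extensions {c\<in>D. fst c \<in> J} r) * (\<Prod>i\<in>J. fact (?m i)) =
     fact (\<Sum>i\<in>J. ?m i) * (\<Prod>i\<in>J. card (linear_extensions {c\<in>D. fst c = i} r))" if "J \<subseteq> I" for J
    using finite_subset[OF that finite_I] that
  proof (induction J rule: finite_induct)
    case empty
    then show ?case by (simp add: linear_extensions_empty)
  next
    case (insert i J)
    let ?A = "{c\<in>D. fst c = i}" and ?B = "{c\<in>D. fst c \<in> J}"
    let ?E = "\<lambda>X. card (linear_extensions X r)"
    have u: "{c\<in>D. fst c \<in> insert i J} = ?A \<union> ?B" by auto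
    have dis: "?A \<inter> ?B = {}" using insert.hyps by auto
    have fin: "finite ?A" "finite ?B" using finite_D by auto
    have IH: "card ?B = (\<Sum>i\<in>J. ?m i)" "?E ?B * (\<Prod>i\<in>J. fact (?m i)) = fact (\<Sum>i\<in>J. ?m i) * (\<Prod>i\<in>J. ?E {c\<in>D. fst c = i})"
      using insert.IH insert.prems by auto
    have cA: "card ?A = ?m i" using c1 insert.prems by simp
    have "?E (?A \<union> ?B) = ((card ?A + card ?B) choose card ?A) * (?E ?A * ?E ?B)"
    proof (rule card_linear_extensions_disjoint_Un[OF fin dis])
      fix a b assume "a \<in> ?A" "b \<in> ?B"
      then have "fst a \<noteq> fst b" using insert.hyps by auto
      then show "\<not> r a b \<and> \<not> r b a" using indep by (metis prod.collapse)
    qed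
    then have "?E (?A \<union> ?B) * (fact (?m i) * (\<Prod>i\<in>J. fact (?m i))) =
      (((?m i + card ?B) choose ?m i) * fact (?m i)) * ?E ?A * (?E ?B * (\<Prod>i\<in>J. fact (?m i)))"
      unfolding cA by (simp add: algebra_simps)
    also have "\<dots> = (fact (?m i) * fact (card ?B) * ((?m i + card ?B) choose ?m i)) * (?E ?A * (\<Prod>i\<in>J. ?E {c\<in>D. fst c = i}))"
      unfolding IH by (simp add: algebra_simps)
    also have "fact (?m i) * fact (card ?B) * ((?m i + card ?B) choose ?m i) = fact (?m i + card ?B)"
      using binomial_fact_lemma[of "?m i" "?m i + card ?B"] by simp
    finally show ?case
      using insert.hyps IH(1) cA card_Un_disjoint[OF fin dis] unfolding u by simp
  qed
  from this[OF order_refl] have "card (linear_extensions {c\<in>D. fst c \<in> I} r) * (\<Prod>i\<in>I. fact (?m i)) =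
     fact (\<Sum>i\<in>I. ?m i) * (\<Prod>i\<in>I. card (linear_extensions {c\<in>D. fst c = i} r))" by blast
  moreover have "{c\<in>D. fst c \<in> I} = D" by (auto simp: D_def)
  ultimately show ?thesis unfolding card_D by simp
qed

text \<open>For one index the poset is a pair of parallel chains, the direction and the polynomial
  coordinates below \<open>half i\<close>, followed by the chain of the remaining ones. Only the
  interleaving of the pair leaves a choice.\<close>

lemma card_linear_extensions_prec_block:
  assumes i: "i \<in> I"
  shows "card (linear_extensions {c\<in>D. fst c = i} prec) = (d i False + (half i - 1)) choose d i False"
proof -
  let ?F = "(\<lambda>\<kappa>. (i, False, \<kappa>)) ` {1..d i False}"
  let ?T = "(\<lambda>\<kappa>. (i, True, \<kappa>)) ` {1..half i - 1}"
  let ?H = "(\<lambda>\<kappa>. (i, True, \<kappa>)) ` {half i..d i True}"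
  let ?E = "\<lambda>X. card (linear_extensions X prec)"
  have h: "1 \<le> half i" "half i \<le> d i True" using d_pos[OF i] by (auto simp: half_def)
  have chain: "?E ((\<lambda>\<kappa>. (i, b, \<kappa>)) ` S) = 1" if "finite S" for b and S :: "nat set"
    by (rule card_linear_extensions_chain[where key = "\<lambda>(i, b, \<kappa>). \<kappa>"]) (use that in \<open>auto simp: prec_def inj_on_def\<close>)
  have "{c\<in>D. fst c = i} = (?F \<union> ?T) \<union> ?H"
  proof (intro equalityI subsetI)
    fix c assume "c \<in> {c\<in>D. fst c = i}"
    then obtain b \<kappa> where c: "c = (i, b, \<kappa>)" "1 \<le> \<kappa>" "\<kappa> \<le> d i b" by (auto simp: D_def)
    then show "c \<in> (?F \<union> ?T) \<union> ?H" by (cases b; cases "half i \<le> \<kappa>") auto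
  next
    fix c assume "c \<in> (?F \<union> ?T) \<union> ?H"
    then show "c \<in> {c\<in>D. fst c = i}" using h i by (auto simp: D_def)
  qed
  moreover have "?E ((?F \<union> ?T) \<union> ?H) = ?E (?F \<union> ?T) * ?E ?H"
    by (rule card_linear_extensions_series_Un) (use h in \<open>auto simp: prec_def\<close>)
  moreover have "?E (?F \<union> ?T) = ((card ?F + card ?T) choose card ?F) * (?E ?F * ?E ?T)"
    by (rule card_linear_extensions_disjoint_Un) (use h in \<open>auto simp: prec_def\<close>)
  moreover have "card ?F = d i False" "card ?T = half i - 1" by (auto simp: card_image inj_on_def)
  ultimately show ?thesis using chain[of "{1..d i False}" False] chain[of "{1..half i - 1}" True] chain[of "{half i..d i True}" True]
    by simp
qed

lemma card_linear_extensions_prec: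
  "card (linear_extensions D prec) * (\<Prod>i\<in>I. fact (d i False + d i True)) =
     fact M * (\<Prod>i\<in>I. (d i False + (half i - 1)) choose d i False)"
  using card_linear_extensions_blocks[of prec] card_linear_extensions_prec_block by (simp add: prec_def)

text \<open>One chain per index: its linear extensions are counted by the multinomial coefficient
  and carry a free action of the symmetry group, so the group order divides that
  coefficient.\<close>

definition bchain :: "coord \<Rightarrow> coord \<Rightarrow> bool" where
  "bchain = (\<lambda>(i, b, \<kappa>) (i', b', \<kappa>'). i = i' \<and> (b = b' \<and> \<kappa> < \<kappa>' \<or> \<not> b \<and> b'))"

lemma card_linear_extensions_bchain:
  "card (linear_extensions D bchain) * (\<Prod>i\<in>I. fact (d i False + d i True)) = fact M"
proof -
  have "card (linear_extensions {c\<in>D. fst c = i} bchain) = 1" if i: "i \<in> I" for i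
    by (rule card_linear_extensions_chain[where key = "\<lambda>(j, b, \<kappa>). if b then d i False + \<kappa> else \<kappa>"])
      (use finite_D i in \<open>auto simp: bchain_def inj_on_def D_def split: if_splits\<close>)
  then show ?thesis using card_linear_extensions_blocks[of bchain] by (simp add: bchain_def)
qed

text \<open>The boundary identifications \<open>p \<mapsto> -p\<close> and \<open>(v, p) \<mapsto> (-v, p(-t))\<close>; the coordinates of \<open>p\<close>
  selected in the second case are the coefficients of odd powers.\<close>

definition negset :: "nat \<Rightarrow> bool \<Rightarrow> coord set" where
  "negset i b = {(i', b', \<kappa>). i' = i \<and> (b' = b \<or> b' \<and> (\<kappa> < half i \<or> \<kappa> = d i True))}"

definition negate :: "nat \<Rightarrow> bool \<Rightarrow> (coord \<Rightarrow> int) \<Rightarrow> coord \<Rightarrow> int" where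
  "negate i b x c = (if c \<in> negset i b then - x c else x c)"

end

lemma rk_abs_cong:
  assumes "\<And>\<kappa>. \<kappa> \<in> {1..d} \<Longrightarrow> \<bar>v \<kappa>\<bar> = \<bar>u \<kappa>\<bar>"
  shows "rk R d v = rk R d u"
proof -
  have "{\<kappa>\<in>{1..<d}. v \<kappa> \<noteq> 0} = {\<kappa>\<in>{1..<d}. u \<kappa> \<noteq> 0}"
    using assms by (metis (no_types, lifting) Collect_cong abs_eq_0 atLeastAtMost_iff atLeastLessThan_iff less_imp_le)
  moreover have "inner_block R d v \<longleftrightarrow> inner_block R d u" using assms by (simp add: inner_block_def)
  ultimately show ?thesis by (simp add: rk_def)
qed

lemma sg_not_inner:
  assumes "rk R d u \<noteq> d"
  shows "sg R d u = sgn (u (if rk R d u = 0 then d else rk R d u))"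
  using assms by (simp add: sg_def rk_eq_iff)

lemma sg_inner:
  assumes "rk R d u = d"
  shows "sg R d u = 1"
  using assms by (simp add: sg_def rk_eq_iff)

context block_grid
begin

lemma beps_negate:
  assumes i: "i \<in> I" and bd: "(i, b, \<kappa>) \<in> D" "\<bar>x (i, b, \<kappa>)\<bar> = R"
  shows "beps i (negate i b x) = (if b then -1 else 1) * beps i x"
proof -
  let ?x' = "negate i b x"
  have h: "1 \<le> half i" "half i \<le> d i True" using d_pos[OF i] by (auto simp: half_def)
  have rk: "brk i b' ?x' = brk i b' x" for b'
    unfolding brk_def by (rule rk_abs_cong) (simp add: negate_def)
  have ni: "brk i b x \<noteq> d i b"
    unfolding brk_def rk_eq_iff inner_block_def using bd by (auto simp: D_def intro!: bexI[of _ \<kappa>])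
  have sgb: "bsg i b ?x' = - bsg i b x"
    using ni rk[of b] unfolding bsg_def brk_def by (simp add: sg_not_inner negate_def negset_def sgn_minus)
  show ?thesis
  proof (cases b)
    case True
    have "bsg i False ?x' = bsg i False x"
      unfolding bsg_def by (rule sg_cong) (simp add: negate_def negset_def True)
    then show ?thesis using sgb rk True by (simp add: beps_def)
  next
    case False
    show ?thesis
    proof (cases "brk i True x < half i")
      case low: True
      then have "brk i True x \<noteq> d i True" using h by simp
      then have "bsg i True ?x' = - bsg i True x"
        using low rk[of True] unfolding bsg_def brk_def
        by (simp add: sg_not_inner negate_def negset_def sgn_minus False)
      then show ?thesis using sgb rk low False by (simp add: beps_def)
    next
      case high: False
      have "bsg i True ?x' = bsg i True x"
      proof (cases "brk i True x = d i True")
        case True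
        then show ?thesis using rk[of True] unfolding bsg_def brk_def by (simp add: sg_inner)
      next
        case n: False
        have "brk i True x \<noteq> 0" using high h by simp
        then show ?thesis using n high rk[of True] unfolding bsg_def brk_def
          by (simp add: sg_not_inner negate_def negset_def False)
      qed
      then show ?thesis using rk high False by (simp add: beps_def)
    qed
  qed
qed

lemma eps_negate:
  assumes "(i, b, \<kappa>) \<in> D" "\<bar>x (i, b, \<kappa>)\<bar> = R"
  shows "eps (negate i b x) = (if b then -1 else 1) * eps x"
proof -
  have i: "i \<in> I" using assms by (auto simp: D_def)
  have s: "eps x = beps i x * (\<Prod>j\<in>I-{i}. beps j x)" for x
    unfolding eps_def using finite_I i by (rule prod.remove)
  have "(\<Prod>j\<in>I-{i}. beps j (negate i b x)) = (\<Prod>j\<in>I-{i}. beps j x)"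
  proof (rule prod.cong)
    fix j assume j: "j \<in> I - {i}"
    have "brk j b' (negate i b x) = brk j b' x" "bsg j b' (negate i b x) = bsg j b' x" for b'
      unfolding brk_def bsg_def using j by (auto intro!: rk_cong sg_cong simp: negate_def negset_def)
    then show "beps j (negate i b x) = beps j x" by (simp add: beps_def)
  qed simp
  then show ?thesis using beps_negate[of i b \<kappa> x, OF i assms] s by simp
qed

section \<open>Crossing a facet of a flag\<close>

definition reflectable :: "grid_flag \<Rightarrow> bool" where
  "reflectable = (\<lambda>(y, \<eta>, p). \<forall>c\<in>D. p c = M - 1 \<longrightarrow> \<bar>y c - 2 * \<eta> c\<bar> < R)"

definition flipset :: "(coord \<Rightarrow> nat) \<Rightarrow> coord set" where
  "flipset p = {c. \<exists>i b \<kappa>. (i, b, \<kappa>) \<in> D \<and> p (i, b, \<kappa>) = M - 1 \<and> c \<in> negset i b}"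

text \<open>The flag across the facet opposite vertex \<open>j\<close>. For \<open>j = 0\<close> the
  first edge starts at its other end; for inner \<open>j\<close> two consecutive steps are
  exchanged; for \<open>j = M\<close> the top cell is reflected in the wall through
  \<open>y c - \<eta> c\<close>, or the boundary identification is applied if that wall bounds the
  box.\<close>

definition neighbour :: "nat \<Rightarrow> grid_flag \<Rightarrow> grid_flag" where
  "neighbour j = (\<lambda>(y, \<eta>, p).
     if j = 0 then (y, \<lambda>c. if c \<in> D \<and> p c = 0 then - \<eta> c else \<eta> c, p)
     else if j < M then (y, \<eta>, \<lambda>c. if c \<in> D then Transposition.transpose (j - 1) j (p c) else 0)
     else if reflectable (y, \<eta>, p) then
       (\<lambda>c. if c \<in> D \<and> p c = M - 1 then y c - 2 * \<eta> c else y c,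
        \<lambda>c. if c \<in> D \<and> p c = M - 1 then - \<eta> c else \<eta> c, p)
     else (\<lambda>c. if c \<in> flipset p then - y c else y c, \<lambda>c. if c \<in> flipset p then - \<eta> c else \<eta> c, p))"

lemma neighbour_first: "neighbour 0 (y, \<eta>, p) = (y, \<lambda>c. if c \<in> D \<and> p c = 0 then - \<eta> c else \<eta> c, p)"
  by (simp add: neighbour_def)

lemma neighbour_swap:
  "0 < j \<Longrightarrow> j < M \<Longrightarrow> neighbour j (y, \<eta>, p) = (y, \<eta>, \<lambda>c. if c \<in> D then Transposition.transpose (j - 1) j (p c) else 0)"
  by (simp add: neighbour_def)

lemma neighbour_reflect:
  "0 < M \<Longrightarrow> reflectable (y, \<eta>, p) \<Longrightarrow> neighbour M (y, \<eta>, p) =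
     (\<lambda>c. if c \<in> D \<and> p c = M - 1 then y c - 2 * \<eta> c else y c,
        \<lambda>c. if c \<in> D \<and> p c = M - 1 then - \<eta> c else \<eta> c, p)"
  by (simp add: neighbour_def)

lemma neighbour_boundary:
  "0 < M \<Longrightarrow> \<not> reflectable (y, \<eta>, p) \<Longrightarrow> neighbour M (y, \<eta>, p) =
     (\<lambda>c. if c \<in> flipset p then - y c else y c, \<lambda>c. if c \<in> flipset p then - \<eta> c else \<eta> c, p)"
  by (simp add: neighbour_def)

lemma flipset_eq:
  assumes "bij_betw p D {..<M}" "(i, b, \<kappa>) \<in> D" "p (i, b, \<kappa>) = M - 1"
  shows "flipset p = negset i b"
proof -
  have "c = (i, b, \<kappa>)" if "c \<in> D" "p c = M - 1" for c
    using assms that by (auto simp: bij_betw_def inj_on_def)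
  then show ?thesis unfolding flipset_def using assms(2,3) by blast
qed

lemma neighbour_flag:
  assumes q: "q \<in> flags" and j: "j \<le> M" and M: "0 < M"
  shows "neighbour j q \<in> flags" "neighbour j (neighbour j q) = q"
proof -
  obtain y \<eta> p where qe: "q = (y, \<eta>, p)" by (cases q)
  have f: "\<And>c. c \<in> D \<Longrightarrow> odd (y c) \<and> \<bar>y c\<bar> < R \<and> \<eta> c \<in> {1,-1}" "\<And>c. c \<notin> D \<Longrightarrow> y c = 0 \<and> \<eta> c = 0"
    "bij_betw p D {..<M}" "\<And>c. c \<notin> D \<Longrightarrow> p c = 0"
    using q unfolding qe flags_def by auto
  consider "j = 0" | "0 < j" "j < M" | "j = M" "reflectable q" | "j = M" "\<not> reflectable q" using j by linarith
  then have "neighbour j q \<in> flags \<and> neighbour j (neighbour j q) = q"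
  proof cases
    case 1
    have "(y, \<lambda>c. if c \<in> D \<and> p c = 0 then - \<eta> c else \<eta> c, p) \<in> flags"
      using f by (auto simp: flags_def)
    then show ?thesis unfolding 1 qe neighbour_first by (auto simp: fun_eq_iff)
  next
    case 2
    let ?t = "Transposition.transpose (j - 1) j"
    let ?p = "\<lambda>c. if c \<in> D then ?t (p c) else 0"
    have "bij_betw ?t {..<M} {..<M}"
      using 2 by (intro permutes_imp_bij permutes_swap_id) auto
    then have "bij_betw (?t \<circ> p) D {..<M}" using f(3) bij_betw_trans by blast
    then have "bij_betw ?p D {..<M}" by (subst bij_betw_cong[of D ?p "?t \<circ> p"]) auto
    then have "(y, \<eta>, ?p) \<in> flags" using f by (auto simp: flags_def)
    moreover have "(\<lambda>c. if c \<in> D then ?t (?p c) else 0) = p" using f(4) by (auto simp: fun_eq_iff)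
    ultimately show ?thesis unfolding qe using 2 by (simp add: neighbour_swap)
  next
    case 3
    let ?y = "\<lambda>c. if c \<in> D \<and> p c = M - 1 then y c - 2 * \<eta> c else y c"
    let ?\<eta> = "\<lambda>c. if c \<in> D \<and> p c = M - 1 then - \<eta> c else \<eta> c"
    have r: "\<bar>y c - 2 * \<eta> c\<bar> < R" if "c \<in> D" "p c = M - 1" for c using 3(2) that by (auto simp: reflectable_def qe)
    have "(?y, ?\<eta>, p) \<in> flags" using f r by (auto simp: flags_def)
    moreover have "reflectable (?y, ?\<eta>, p)" using f(1) by (auto simp: reflectable_def)
    ultimately show ?thesis using 3 M unfolding qe by (auto simp: neighbour_reflect fun_eq_iff)
  next
    case 4
    let ?y = "\<lambda>c. if c \<in> flipset p then - y c else y c"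
    let ?\<eta> = "\<lambda>c. if c \<in> flipset p then - \<eta> c else \<eta> c"
    have "(?y, ?\<eta>, p) \<in> flags" using f by (auto simp: flags_def)
    moreover have "\<not> reflectable (?y, ?\<eta>, p)"
    proof -
      obtain c where c: "c \<in> D" "p c = M - 1" "\<not> \<bar>y c - 2 * \<eta> c\<bar> < R" using 4(2) by (auto simp: reflectable_def qe)
      have "\<bar>?y c - 2 * ?\<eta> c\<bar> = \<bar>y c - 2 * \<eta> c\<bar>" by auto
      then show ?thesis using c unfolding reflectable_def by force
    qed
    ultimately show ?thesis using 4 M unfolding qe by (auto simp: neighbour_boundary fun_eq_iff)
  qed
  then show "neighbour j q \<in> flags" "neighbour j (neighbour j q) = q" by auto
qed

lemma neighbour_vertex:
  assumes q: "q \<in> flags" and j: "j \<le> M" and M: "0 < M"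
  shows "(\<forall>l\<le>M. l \<noteq> j \<longrightarrow> vertex (neighbour j q) l = vertex q l) \<or>
    (\<exists>i b \<kappa>. (i, b, \<kappa>) \<in> D \<and> (\<forall>l\<le>M. l \<noteq> j \<longrightarrow> \<bar>vertex q l (i, b, \<kappa>)\<bar> = R \<and>
       vertex (neighbour j q) l = negate i b (vertex q l)))"
proof -
  obtain y \<eta> p where qe: "q = (y, \<eta>, p)" by (cases q)
  have f: "\<And>c. c \<in> D \<Longrightarrow> odd (y c) \<and> \<bar>y c\<bar> < R \<and> \<eta> c \<in> {1,-1}" "\<And>c. c \<notin> D \<Longrightarrow> y c = 0 \<and> \<eta> c = 0"
    "bij_betw p D {..<M}" "\<And>c. c \<notin> D \<Longrightarrow> p c = 0"
    using q unfolding qe flags_def by auto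
  consider "j = 0" | "0 < j" "j < M" | "j = M" "reflectable q" | "j = M" "\<not> reflectable q" using j by linarith
  then show ?thesis
  proof cases
    case 1
    then have "\<forall>l\<le>M. l \<noteq> j \<longrightarrow> vertex (neighbour j q) l = vertex q l"
      unfolding qe 1 neighbour_first by (auto simp: vertex_simp fun_eq_iff)
    then show ?thesis by blast
  next
    case 2
    have "Transposition.transpose (j - 1) j k < l \<longleftrightarrow> k < l" if "l \<noteq> j" for k l
      using that 2 by (auto simp: Transposition.transpose_def)
    then have "\<forall>l\<le>M. l \<noteq> j \<longrightarrow> vertex (neighbour j q) l = vertex q l"
      unfolding qe neighbour_swap[OF 2] using f(2) by (auto simp: vertex_simp fun_eq_iff)
    then show ?thesis by blast
  next
    case 3
    then have "\<forall>l\<le>M. l \<noteq> j \<longrightarrow> vertex (neighbour j q) l = vertex q l"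
      unfolding qe using M by (auto simp: neighbour_reflect vertex_simp fun_eq_iff)
    then show ?thesis by blast
  next
    case 4
    then obtain c where c: "c \<in> D" "p c = M - 1" "\<not> \<bar>y c - 2 * \<eta> c\<bar> < R" by (auto simp: reflectable_def qe)
    obtain i b \<kappa> where ce: "c = (i, b, \<kappa>)" by (cases c)
    have fs: "flipset p = negset i b" using flipset_eq[OF f(3)] c ce by simp
    \<comment> \<open>Both excluded values are even while \<open>y c\<close> is odd, so reflection
      fails only if the wall lies on the boundary of the box.\<close>
    have "y c \<noteq> 2 - R" "y c \<noteq> R - 2" using f(1)[OF c(1)] even_R by auto
    then have "\<bar>y c - \<eta> c\<bar> = R" using f(1)[OF c(1)] c(3) by auto
    then have "\<forall>l\<le>M. l \<noteq> j \<longrightarrow> \<bar>vertex q l (i, b, \<kappa>)\<bar> = R \<and> vertex (neighbour j q) l = negate i b (vertex q l)"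
      using 4 M c unfolding qe ce by (auto simp: neighbour_boundary fs vertex_simp fun_eq_iff negate_def)
    then show ?thesis using c(1) unfolding ce by blast
  qed
qed

lemma neighbour_pos:
  assumes "q \<in> flags" "j \<le> M" "0 < M"
  shows "\<not> (0 < j \<and> j < M) \<Longrightarrow> snd (snd (neighbour j q)) = snd (snd q)" "neighbour j q \<noteq> q"
proof -
  obtain y \<eta> p where qe: "q = (y, \<eta>, p)" by (cases q)
  have f: "\<And>c. c \<in> D \<Longrightarrow> odd (y c) \<and> \<bar>y c\<bar> < R \<and> \<eta> c \<in> {1,-1}" "bij_betw p D {..<M}"
    using assms(1) unfolding qe flags_def by auto
  have at: "\<exists>c\<in>D. p c = l" if "l < M" for l
    using f(2) that unfolding bij_betw_def by (metis (no_types, lifting) imageE lessThan_iff)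
  show "\<not> (0 < j \<and> j < M) \<Longrightarrow> snd (snd (neighbour j q)) = snd (snd q)"
    by (auto simp: neighbour_def qe)
  consider "j = 0" | "0 < j" "j < M" | "j = M" "reflectable q" | "j = M" "\<not> reflectable q" using assms(2) by linarith
  then show "neighbour j q \<noteq> q"
  proof cases
    case 1
    obtain c where c: "c \<in> D" "p c = 0" using at[of 0] assms(3) by auto
    then have "fst (snd (neighbour j q)) c \<noteq> \<eta> c" using f(1)[of c] unfolding qe 1 neighbour_first by auto
    then show ?thesis by (auto simp: qe)
  next
    case 2
    obtain c where c: "c \<in> D" "p c = j" using at[of j] 2 by auto
    then have "snd (snd (neighbour j q)) c \<noteq> p c" unfolding qe neighbour_swap[OF 2] using 2 by simp
    then show ?thesis by (auto simp: qe)
  next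
    case 3
    obtain c where c: "c \<in> D" "p c = M - 1" using at[of "M - 1"] assms(3) by auto
    then have "fst (snd (neighbour j q)) c \<noteq> \<eta> c" using 3 assms(3) f(1)[of c] unfolding qe by (auto simp: neighbour_reflect)
    then show ?thesis by (auto simp: qe)
  next
    case 4
    obtain c where c: "c \<in> D" "p c = M - 1" using at[of "M - 1"] assms(3) by auto
    then have "c \<in> flipset p" by (cases c) (auto simp: flipset_def negset_def)
    then have "fst (neighbour j q) c \<noteq> y c" using 4 assms(3) f(1)[of c] c unfolding qe by (auto simp: neighbour_boundary)
    then show ?thesis by (auto simp: qe)
  qed
qed

end

section \<open>Symmetries permuting the indices\<close>

definition lift :: "(nat \<Rightarrow> nat) \<Rightarrow> coord \<Rightarrow> coord" where
  "lift g c = (g (fst c), snd c)"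

lemma lift_simp [simp]: "lift g (i, b, \<kappa>) = (g i, b, \<kappa>)"
  by (simp add: lift_def)

definition relabel :: "(nat \<Rightarrow> nat) \<Rightarrow> grid_flag \<Rightarrow> grid_flag" where
  "relabel g = (\<lambda>(y, \<eta>, p). (y \<circ> lift g, \<eta> \<circ> lift g, p \<circ> lift g))"

lemma vertex_relabel: "vertex (relabel g q) l = vertex q l \<circ> lift g"
  by (cases q) (auto simp: relabel_def vertex_def)

locale symmetric_block_grid = block_grid +
  fixes G :: "(nat \<Rightarrow> nat) set"
  assumes I_ne: "I \<noteq> {}"
    and G_id: "id \<in> G" and G_comp: "\<And>g h. g \<in> G \<Longrightarrow> h \<in> G \<Longrightarrow> g \<circ> h \<in> G"
    and G_inv: "\<And>g. g \<in> G \<Longrightarrow> \<exists>h\<in>G. g \<circ> h = id"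
    and G_perm: "\<And>g. g \<in> G \<Longrightarrow> g permutes I"
    and G_d: "\<And>g i b. g \<in> G \<Longrightarrow> i \<in> I \<Longrightarrow> d (g i) b = d i b"
    and G_moved: "\<And>g i. g \<in> G \<Longrightarrow> i \<in> I \<Longrightarrow> g i \<noteq> i \<Longrightarrow> 2 \<le> d i False + d i True"
begin

lemma M_pos: "0 < M"
proof -
  obtain i where "i \<in> I" using I_ne by auto
  then have "(i, True, 1) \<in> D" using d_pos[of i] by (auto simp: D_def)
  then show ?thesis using finite_D by (auto simp: card_gt_0_iff)
qed

lemma finite_G: "finite G"
  using G_perm finite_subset[OF _ finite_permutations[OF finite_I], of G] by auto

lemma lift_D: "g \<in> G \<Longrightarrow> lift g c \<in> D \<longleftrightarrow> c \<in> D"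
  using G_perm[of g] G_d[of g "fst c"] by (cases c) (auto simp: D_def permutes_in_image)

lemma lift_inj: "g \<in> G \<Longrightarrow> lift g c = lift g c' \<longleftrightarrow> c = c'"
  using permutes_inj[OF G_perm[of g]] by (cases c, cases c') (auto simp: inj_eq)

lemma lift_bij: "g \<in> G \<Longrightarrow> bij_betw (lift g) D D"
proof -
  assume g: "g \<in> G"
  have "inj_on (lift g) D" using lift_inj[OF g] by (auto simp: inj_on_def)
  moreover have "lift g ` D \<subseteq> D" using lift_D[OF g] by auto
  ultimately show ?thesis using endo_inj_surj[OF finite_D] by (auto simp: bij_betw_def)
qed

lemma linear_extensions_relabel:
  assumes "g \<in> G" "p \<in> linear_extensions D bchain"
  shows "p \<circ> lift g \<in> linear_extensions D bchain"
proof -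
  have "bij_betw (p \<circ> lift g) D {..<M}"
    using lift_bij[OF assms(1)] assms(2) bij_betw_trans by (auto simp: linear_extensions_def)
  moreover have "bchain (lift g a) (lift g b)" if "bchain a b" for a b
    using that by (cases a, cases b) (auto simp: bchain_def)
  ultimately show ?thesis using assms lift_D[OF assms(1)] by (auto simp: linear_extensions_def)
qed

lemma lift_eq_imp_eq:
  assumes "g \<in> G" "h \<in> G" "\<And>c. c \<in> D \<Longrightarrow> lift g c = lift h c"
  shows "g = h"
proof
  fix i show "g i = h i"
  proof (cases "i \<in> I")
    case True
    then have "(i, True, 1) \<in> D" using d_pos by (auto simp: D_def)
    then show ?thesis using assms(3)[of "(i, True, 1)"] by simp
  next
    case False
    then show ?thesis
      using permutes_not_in[OF G_perm[OF assms(1)]] permutes_not_in[OF G_perm[OF assms(2)]] by simp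
  qed
qed

lemma pos_lift_eq_imp_eq:
  assumes "g \<in> G" "h \<in> G" "bij_betw p D {..<M}" "p \<circ> lift g = p \<circ> lift h"
  shows "g = h"
proof (rule lift_eq_imp_eq[OF assms(1,2)])
  fix c assume "c \<in> D"
  then have "lift g c \<in> D" "lift h c \<in> D" "p (lift g c) = p (lift h c)"
    using lift_D assms(1,2) fun_cong[OF assms(4), of c] by auto
  then show "lift g c = lift h c" using assms(3) by (auto simp: bij_betw_def inj_on_def)
qed

lemma lift_comp: "lift (g \<circ> h) = lift g \<circ> lift h"
  by (auto simp: lift_def fun_eq_iff)

lemma lift_id: "lift id = id"
  by (auto simp: lift_def fun_eq_iff)

text \<open>Positions are distinct, so relabelling acts freely and the extensions split into orbits
  of size \<open>card G\<close>.\<close>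

lemma card_G_dvd: "card G dvd card (linear_extensions D bchain)"
proof -
  let ?L = "linear_extensions D bchain"
  define orb where "orb p = (\<lambda>g. p \<circ> lift g) ` G" for p :: "coord \<Rightarrow> nat"
  have sub: "orb p \<subseteq> ?L" if "p \<in> ?L" for p using linear_extensions_relabel that by (auto simp: orb_def)
  have self: "p \<in> orb p" for p unfolding orb_def using G_id by (auto simp: lift_id intro!: image_eqI[of _ _ id])
  have osub: "orb p \<subseteq> orb p'" if "p \<in> orb p'" for p p'
    using that G_comp by (auto simp: orb_def comp_assoc lift_comp[symmetric])
  have osym: "p' \<in> orb p" if pp: "p \<in> orb p'" for p p'
  proof -
    obtain g where g: "g \<in> G" "p = p' \<circ> lift g" using pp by (auto simp: orb_def)
    obtain h where h: "h \<in> G" "g \<circ> h = id" using G_inv[OF g(1)] by auto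
    have "p' = p \<circ> lift h" using g(2) h(2) by (simp add: comp_assoc lift_comp[symmetric] lift_id)
    then show ?thesis using h(1) by (auto simp: orb_def)
  qed
  have "?L = \<Union> (orb ` ?L)" using sub self by blast
  moreover have "card G dvd card (\<Union> (orb ` ?L))"
  proof (rule dvd_partition)
    show "finite (\<Union> (orb ` ?L))" using calculation finite_linear_extensions[OF finite_D] by metis
    show "\<forall>c\<in>orb ` ?L. card G dvd card c"
    proof
      fix c assume "c \<in> orb ` ?L"
      then obtain p where p: "p \<in> ?L" "c = orb p" by auto
      have "inj_on (\<lambda>g. p \<circ> lift g) G"
        using pos_lift_eq_imp_eq[of _ _ p] p(1) by (auto simp: inj_on_def linear_extensions_def)
      then show "card G dvd card c" unfolding p(2) orb_def by (simp add: card_image)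
    qed
    show "\<forall>c1\<in>orb ` ?L. \<forall>c2\<in>orb ` ?L. c1 \<noteq> c2 \<longrightarrow> c1 \<inter> c2 = {}"
    proof (intro ballI impI, rule ccontr)
      fix c1 c2 assume c: "c1 \<in> orb ` ?L" "c2 \<in> orb ` ?L" "c1 \<noteq> c2" "c1 \<inter> c2 \<noteq> {}"
      then obtain p1 p2 p where "c1 = orb p1" "c2 = orb p2" "p \<in> orb p1" "p \<in> orb p2" by auto
      then have "c1 = c2" using osub osym by blast
      then show False using c by simp
    qed
  qed
  ultimately show ?thesis by simp
qed

lemma multinomial_divided_by_symmetries:
  "\<exists>c. card G * c * (\<Prod>i\<in>I. fact (d i False + d i True)) = fact M"
  using card_G_dvd card_linear_extensions_bchain by (auto elim!: dvdE)

lemma relabel_flag: "g \<in> G \<Longrightarrow> q \<in> flags \<Longrightarrow> relabel g q \<in> flags"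
proof -
  assume g: "g \<in> G" and q: "q \<in> flags"
  obtain y \<eta> p where qe: "q = (y, \<eta>, p)" by (cases q)
  have "bij_betw (p \<circ> lift g) D {..<M}"
    using lift_bij[OF g] q bij_betw_trans by (auto simp: flags_def qe)
  then show ?thesis using q lift_D[OF g] by (auto simp: flags_def qe relabel_def)
qed

lemma eps_lift:
  assumes "g \<in> G"
  shows "eps (x \<circ> lift g) = eps x"
proof -
  have "beps i (x \<circ> lift g) = beps (g i) x" if "i \<in> I" for i
  proof -
    have "brk i b (x \<circ> lift g) = brk (g i) b x" "bsg i b (x \<circ> lift g) = bsg (g i) b x" for b
      using G_d[OF assms that] by (auto simp: brk_def bsg_def)
    then show ?thesis using G_d[OF assms that] by (simp add: beps_def half_def)
  qed
  then have "eps (x \<circ> lift g) = (\<Prod>i\<in>I. beps (g i) x)" by (simp add: eps_def)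
  also have "\<dots> = eps x" unfolding eps_def
    by (rule prod.reindex_bij_betw[OF permutes_imp_bij[OF G_perm[OF assms]]])
  finally show ?thesis .
qed

lemma flipset_lift:
  assumes g: "g \<in> G"
  shows "c \<in> flipset (p \<circ> lift g) \<longleftrightarrow> lift g c \<in> flipset p"
proof
  have neg: "c \<in> negset i b \<longleftrightarrow> lift g c \<in> negset (g i) b" if "i \<in> I" for i b
    using permutes_inj[OF G_perm[OF g]] G_d[OF g that]
    by (cases c) (auto simp: negset_def half_def inj_eq)
  show "lift g c \<in> flipset p" if "c \<in> flipset (p \<circ> lift g)"
  proof -
    obtain i b \<kappa> where c: "(i, b, \<kappa>) \<in> D" "p (g i, b, \<kappa>) = M - 1" "c \<in> negset i b"
      using \<open>c \<in> flipset (p \<circ> lift g)\<close> by (auto simp: flipset_def)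
    have "i \<in> I" using c(1) by (auto simp: D_def)
    then show ?thesis using c neg lift_D[OF g, of "(i, b, \<kappa>)"] by (auto simp: flipset_def)
  qed
  show "c \<in> flipset (p \<circ> lift g)" if "lift g c \<in> flipset p"
  proof -
    obtain i b \<kappa> where c: "(i, b, \<kappa>) \<in> D" "p (i, b, \<kappa>) = M - 1" "lift g c \<in> negset i b"
      using \<open>lift g c \<in> flipset p\<close> by (auto simp: flipset_def)
    obtain j where j: "i = g j" "j \<in> I"
      using c(1) permutes_image[OF G_perm[OF g]] by (auto simp: D_def)
    have "(j, b, \<kappa>) \<in> D" using c(1) lift_D[OF g, of "(j, b, \<kappa>)"] j by simp
    then show ?thesis using c neg[OF j(2)] j unfolding flipset_def by auto
  qed
qed

lemma neighbour_relabel: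
  assumes g: "g \<in> G" and j: "j \<le> M"
  shows "neighbour j (relabel g q) = relabel g (neighbour j q)"
proof -
  obtain y \<eta> p where qe: "q = (y, \<eta>, p)" by (cases q)
  have refl: "reflectable (relabel g q) \<longleftrightarrow> reflectable q"
  proof -
    have "(\<forall>c\<in>D. p c = M - 1 \<longrightarrow> \<bar>y c - 2 * \<eta> c\<bar> < R) \<longleftrightarrow>
      (\<forall>c\<in>lift g ` D. p c = M - 1 \<longrightarrow> \<bar>y c - 2 * \<eta> c\<bar> < R)"
      using lift_bij[OF g] by (simp add: bij_betw_def)
    then show ?thesis by (simp add: reflectable_def relabel_def qe)
  qed
  consider "j = 0" | "0 < j" "j < M" | "j = M" "reflectable q" | "j = M" "\<not> reflectable q" using j by linarith
  then show ?thesis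
  proof cases
    case 1
    then show ?thesis using lift_D[OF g] by (auto simp: qe neighbour_first relabel_def fun_eq_iff)
  next
    case 2
    then show ?thesis using lift_D[OF g] by (auto simp: qe neighbour_swap relabel_def fun_eq_iff)
  next
    case 3
    then show ?thesis using lift_D[OF g] refl M_pos
      by (auto simp: qe neighbour_reflect relabel_def fun_eq_iff)
  next
    case 4
    then show ?thesis using refl M_pos flipset_lift[OF g]
      by (auto simp: qe neighbour_boundary relabel_def fun_eq_iff)
  qed
qed

text \<open>For \<open>j = 0\<close> and \<open>j = M\<close> the positions stay the same, and only
  the identity does that. For inner \<open>j\<close> just two coordinates change position, whereas a
  \<open>g\<close> moving \<open>i\<close> displaces two coordinates \<open>c1\<close>,
  \<open>c2\<close> of index \<open>i\<close>, supplied by \<open>G_moved\<close>, and also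
  \<open>lift g c1\<close>.\<close>

lemma neighbour_not_relabel:
  assumes g: "g \<in> G" and j: "j \<le> M" and q: "q \<in> flags"
  shows "neighbour j q \<noteq> relabel g q"
proof
  assume eq: "neighbour j q = relabel g q"
  obtain y \<eta> p where qe: "q = (y, \<eta>, p)" by (cases q)
  have p: "bij_betw p D {..<M}" using q by (simp add: qe flags_def)
  have pinj: "p c = p c' \<Longrightarrow> c \<in> D \<Longrightarrow> c' \<in> D \<Longrightarrow> c = c'" for c c' using p by (auto simp: bij_betw_def inj_on_def)
  have id: "g \<noteq> id" using neighbour_pos(2)[OF q j M_pos] eq by (auto simp: relabel_def lift_id qe)
  show False
  proof (cases "0 < j \<and> j < M")
    case False
    then have "p \<circ> lift g = p \<circ> lift id" using neighbour_pos(1)[OF q j M_pos] eq by (simp add: relabel_def qe lift_id)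
    then have "g = id" by (rule pos_lift_eq_imp_eq[OF g G_id p])
    then show False using id by simp
  next
    case True
    obtain i where gi: "g i \<noteq> i" using id by (auto simp: fun_eq_iff)
    have i: "i \<in> I" using gi permutes_not_in[OF G_perm[OF g]] by auto
    have moved: "p c \<in> {j - 1, j}" if c: "c \<in> D" "lift g c \<noteq> c" for c
    proof (rule ccontr)
      assume n: "p c \<notin> {j - 1, j}"
      have "(\<lambda>c. if c \<in> D then Transposition.transpose (j - 1) j (p c) else 0) = p \<circ> lift g"
        using eq True by (simp add: qe neighbour_swap relabel_def)
      from fun_cong[OF this, of c]
      have "(if c \<in> D then Transposition.transpose (j - 1) j (p c) else 0) = p (lift g c)" by simp
      then have "p c = p (lift g c)" using c n by (simp add: Transposition.transpose_def)
      then show False using pinj[of c "lift g c"] c lift_D[OF g] by auto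
    qed
    obtain c1 c2 where c12: "c1 \<in> D" "c2 \<in> D" "c1 \<noteq> c2" "fst c1 = i" "fst c2 = i"
    proof (cases "d i True \<ge> 2")
      case True
      show ?thesis by (rule that[of "(i, True, 1)" "(i, True, 2)"]) (use True i in \<open>auto simp: D_def\<close>)
    next
      case False
      then have "d i True \<ge> 1" "d i False \<ge> 1" using G_moved[OF g i gi] d_pos[OF i] by auto
      then show ?thesis by (intro that[of "(i, True, 1)" "(i, False, 1)"]) (use i in \<open>auto simp: D_def\<close>)
    qed
    have "lift g c1 \<in> D" using lift_D[OF g] c12 by simp
    moreover have "g (g i) \<noteq> g i" using gi permutes_inj[OF G_perm[OF g]] by (auto simp: inj_eq)
    ultimately have "p (lift g c1) \<in> {j - 1, j}" using c12 by (intro moved) (auto simp: lift_def)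
    moreover have "fst (lift g c1) \<noteq> fst c1" "fst (lift g c2) \<noteq> fst c2" "fst (lift g c1) \<noteq> fst c2"
      using c12 gi by (auto simp: lift_def)
    then have ne: "lift g c1 \<noteq> c1" "lift g c2 \<noteq> c2" "lift g c1 \<noteq> c2" by metis+
    then have "p c1 \<in> {j - 1, j}" "p c2 \<in> {j - 1, j}" using moved[of c1] moved[of c2] c12 ne by blast+
    moreover have "p c1 \<noteq> p c2" "p c1 \<noteq> p (lift g c1)" "p c2 \<noteq> p (lift g c1)"
      using pinj[of c1 c2] pinj[of c1 "lift g c1"] pinj[of c2 "lift g c1"] c12 ne \<open>lift g c1 \<in> D\<close> by auto
    ultimately show False by auto
  qed
qed

text \<open>Without such a pair the number of alternating flags would be \<open>card G * N\<close>
  with \<open>N\<close> even. Counting them through \<open>prec\<close> instead gives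
  \<open>N\<close> as \<open>c\<close> times the product of the binomial coefficients, which is
  odd.\<close>

theorem complementary_labels_exist:
  fixes \<Lambda> :: "(coord \<Rightarrow> int) \<Rightarrow> int"
  defines "grid \<equiv> {x. (\<forall>c\<in>D. \<bar>x c\<bar> \<le> R) \<and> (\<forall>c. c \<notin> D \<longrightarrow> x c = 0)}"
  assumes c: "card G * c * (\<Prod>i\<in>I. fact (d i False + d i True)) = fact M" "odd c"
    and binom: "\<And>i. i \<in> I \<Longrightarrow> odd ((d i False + (half i - 1)) choose d i False)"
    and range: "\<And>x. x \<in> grid \<Longrightarrow> \<Lambda> x \<noteq> 0 \<and> \<bar>\<Lambda> x\<bar> \<le> int M"
    and sym: "\<And>g x. g \<in> G \<Longrightarrow> x \<in> grid \<Longrightarrow> \<Lambda> (x \<circ> lift g) = \<Lambda> x"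
    and neg: "\<And>i b \<kappa> x. (i, b, \<kappa>) \<in> D \<Longrightarrow> x \<in> grid \<Longrightarrow> \<bar>x (i, b, \<kappa>)\<bar> = R \<Longrightarrow>
       \<Lambda> (negate i b x) = (if b then -1 else 1) * \<Lambda> x"
  shows "\<exists>x\<in>grid. \<exists>x'\<in>grid. (\<forall>c\<in>D. \<bar>x c - x' c\<bar> \<le> 1) \<and> \<Lambda> x = - \<Lambda> x'"
proof (rule ccontr)
  assume contra: "\<not> ?thesis"
  have vgrid: "vertex q l \<in> grid" if q: "q \<in> flags" for q l
    using vertex_bound[OF q] q by (cases q) (auto simp: grid_def flags_def vertex_simp)
  have near: "\<bar>vertex q l c - vertex q l' c\<bar> \<le> 1" if "q \<in> flags" "c \<in> D" for q l l' c
    using that by (cases q) (auto simp: flags_def vertex_simp)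
  have fin: "finite flags"
  proof -
    have "flags \<subseteq> {y. (\<forall>c\<in>D. y c \<in> {-R..R}) \<and> (\<forall>c. c \<notin> D \<longrightarrow> y c = 0)} \<times> {\<eta>. (\<forall>c\<in>D. \<eta> c \<in> {1,-1}) \<and> (\<forall>c. c \<notin> D \<longrightarrow> \<eta> c = 0)}
       \<times> linear_extensions D (\<lambda>_ _. False)"
      by (auto simp: flags_def linear_extensions_def)
    moreover have "finite {y. (\<forall>c\<in>D. y c \<in> {-R..R}) \<and> (\<forall>c. c \<notin> D \<longrightarrow> y c = 0)}"
      "finite {\<eta>. (\<forall>c\<in>D. \<eta> c \<in> {1,-1::int}) \<and> (\<forall>c. c \<notin> D \<longrightarrow> \<eta> c = 0)}"
      using finite_set_of_finite_funs[OF finite_D, of "{-R..R}" 0] finite_set_of_finite_funs[OF finite_D, of "{1,-1::int}" 0]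
      by (simp_all add: Ball_def conj_commute all_conj_distrib)
    ultimately show ?thesis
      by (rule finite_subset[OF _ finite_cartesian_product[OF _ finite_cartesian_product[OF _ finite_linear_extensions[OF finite_D]]]])
  qed
  have "\<exists>N. even N \<and> card {q\<in>flags. \<forall>l<M. eps (vertex q (Suc l)) = - eps (vertex q l)} = card G * N"
  proof (rule tucker_alternating_parity_quotient[where e = "\<lambda>q l. eps (vertex q l)" and lam = "\<lambda>q l. \<Lambda> (vertex q l)"
        and act = relabel and \<nu> = neighbour and u = id, OF fin finite_G G_id])
    fix a b assume ab: "a \<in> G" "b \<in> G"
    show "\<exists>c\<in>G. \<forall>q\<in>flags. relabel c q = relabel b (relabel a q)"
      by (rule bexI[OF _ G_comp[OF ab]]) (auto simp: relabel_def lift_comp comp_assoc)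
  next
    fix a assume "a \<in> G"
    then obtain h where h: "h \<in> G" "a \<circ> h = id" using G_inv by auto
    have "relabel h (relabel a q) = q" for q
      by (cases q) (simp add: relabel_def comp_assoc lift_comp[symmetric] h(2) lift_id)
    then show "\<exists>b\<in>G. \<forall>q\<in>flags. relabel b (relabel a q) = q" using h(1) by blast
  next
    fix q show "relabel id q = q" by (cases q) (simp add: relabel_def lift_id)
  next
    fix a q assume "a \<in> G" "q \<in> flags" then show "relabel a q \<in> flags" by (rule relabel_flag)
  next
    fix a b q assume ab: "a \<in> G" "b \<in> G" "q \<in> flags" "relabel a q = relabel b q"
    then show "a = b"
      by (cases q) (auto simp: relabel_def flags_def intro: pos_lift_eq_imp_eq)
  next
    fix q j assume "q \<in> flags" "j \<le> M"
    then show "neighbour j q \<in> flags \<and> neighbour j (neighbour j q) = q" using neighbour_flag M_pos by blast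
  next
    fix q j a assume "q \<in> flags" "j \<le> M" "a \<in> G"
    then show "neighbour j q \<noteq> relabel a q" by (intro neighbour_not_relabel)
  next
    fix q j a assume "q \<in> flags" "j \<le> M" "a \<in> G"
    then show "neighbour j (relabel a q) = relabel a (neighbour j q)" by (intro neighbour_relabel)
  next
    fix q j assume q: "q \<in> flags" and j: "j \<le> M"
    show "\<exists>s\<in>{1, - 1}. \<forall>l\<le>M. l \<noteq> j \<longrightarrow> eps (vertex (neighbour j q) l) = s * eps (vertex q l) \<and>
       \<Lambda> (vertex (neighbour j q) l) = s * \<Lambda> (vertex q l)"
      using neighbour_vertex[OF q j M_pos]
    proof (elim disjE exE conjE)
      assume "\<forall>l\<le>M. l \<noteq> j \<longrightarrow> vertex (neighbour j q) l = vertex q l"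
      then show ?thesis by (intro bexI[of _ 1]) auto
    next
      fix i b \<kappa> assume a: "(i, b, \<kappa>) \<in> D" "\<forall>l\<le>M. l \<noteq> j \<longrightarrow> \<bar>vertex q l (i, b, \<kappa>)\<bar> = R \<and> vertex (neighbour j q) l = negate i b (vertex q l)"
      show ?thesis
      proof (intro bexI[of _ "if b then -1 else 1"] allI impI)
        fix l assume "l \<le> M" "l \<noteq> j"
        then have l: "\<bar>vertex q l (i, b, \<kappa>)\<bar> = R" "vertex (neighbour j q) l = negate i b (vertex q l)" using a(2) by auto
        show "eps (vertex (neighbour j q) l) = (if b then - 1 else 1) * eps (vertex q l) \<and>
            \<Lambda> (vertex (neighbour j q) l) = (if b then - 1 else 1) * \<Lambda> (vertex q l)"
          unfolding l(2) using eps_negate[of i b \<kappa> "vertex q l", OF a(1) l(1)] neg[of i b \<kappa> "vertex q l", OF a(1) vgrid[OF q] l(1)] by simp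
      qed auto
    qed
  next
    fix q a and l :: nat assume "q \<in> flags" "a \<in> G"
    then show "eps (vertex (relabel a q) l) = eps (vertex q l)" "\<Lambda> (vertex (relabel a q) l) = \<Lambda> (vertex q l)"
      using eps_lift sym vgrid by (auto simp: vertex_relabel)
  next
    fix q l assume q: "q \<in> flags"
    show "eps (vertex q l) \<in> {1, - 1}" using eps_unit vertex_bound[OF q] by blast
    show "\<Lambda> (vertex q l) \<noteq> 0 \<and> \<bar>\<Lambda> (vertex q l)\<bar> \<le> int M" using range vgrid[OF q] by blast
    fix l' show "\<Lambda> (vertex q l) \<noteq> - \<Lambda> (vertex q l')" using contra vgrid[OF q] near[OF q] by blast
  qed
  then obtain N where N: "even N" "card (linear_extensions D prec) = card G * N"
    unfolding card_alternating_flags by auto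
  let ?P = "\<Prod>i\<in>I. fact (d i False + d i True) :: nat"
  let ?B = "\<Prod>i\<in>I. (d i False + (half i - 1)) choose d i False"
  have "card G * N * ?P = card G * c * ?P * ?B" using card_linear_extensions_prec N(2) c(1) by simp
  moreover have "?P > 0" "card G > 0" using finite_G G_id by (auto simp: prod_pos card_gt_0_iff)
  moreover have "card G * N * ?P = (card G * ?P) * N" "card G * c * ?P * ?B = (card G * ?P) * (c * ?B)"
    by (simp_all only: mult.assoc mult.commute mult.left_commute)
  ultimately have "(card G * ?P) * N = (card G * ?P) * (c * ?B)" "card G * ?P \<noteq> 0" by simp_all
  then have "N = c * ?B" by (simp only: mult_cancel1) blast
  moreover have "odd ?B" using binom finite_I by (simp add: even_prod_iff)
  ultimately show False using N(1) c(2) by simp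
qed

end

section \<open>From the grid to bisecting configurations\<close>

lemma bounded_coordinates_subsequence:
  fixes z :: "nat \<Rightarrow> 'c \<Rightarrow> real"
  assumes "finite D" "\<And>m c. c \<in> D \<Longrightarrow> \<bar>z m c\<bar> \<le> B"
  shows "\<exists>w r. strict_mono (r :: nat \<Rightarrow> nat) \<and> (\<forall>c\<in>D. (\<lambda>m. z (r m) c) \<longlonglongrightarrow> w c)"
  using assms
proof (induction D rule: finite_induct)
  case empty
  show ?case by (intro exI[of _ "\<lambda>_. 0"] exI[of _ id]) (auto simp: strict_mono_def)
next
  case (insert c D)
  then obtain w r where r: "strict_mono (r :: nat \<Rightarrow> nat)" "\<And>c. c \<in> D \<Longrightarrow> (\<lambda>m. z (r m) c) \<longlonglongrightarrow> w c" by blast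
  have "\<forall>m. z (r m) c \<in> {-B..B}" using insert.prems[of c] by (auto simp: abs_le_iff minus_le_iff)
  then obtain l s where s: "strict_mono (s :: nat \<Rightarrow> nat)" "((\<lambda>m. z (r m) c) \<circ> s) \<longlonglongrightarrow> l"
    using compact_Icc[of "-B" B] unfolding compact_def by meson
  have "(\<lambda>m. z ((r \<circ> s) m) b) \<longlonglongrightarrow> (w(c := l)) b" if "b \<in> insert c D" for b
  proof (cases "b = c")
    case True then show ?thesis using s(2) by (simp add: comp_def)
  next
    case False
    then have "((\<lambda>m. z (r m) b) \<circ> s) \<longlonglongrightarrow> w b" using r(2) s(1) that by (intro LIMSEQ_subseq_LIMSEQ) auto
    then show ?thesis using False by (simp add: comp_def)
  qed
  then show ?case using strict_mono_o[OF r(1) s(1)] by blast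
qed

lemma independent_family_sum_zero:
  fixes e :: "'c \<Rightarrow> 'a::real_vector"
  assumes "finite A" "inj_on e A" "independent (e ` A)" "(\<Sum>a\<in>A. w a *\<^sub>R e a) = 0" "a \<in> A"
  shows "w a = 0"
proof -
  have "(\<Sum>v\<in>e ` A. w (inv_into A e v) *\<^sub>R v) = (\<Sum>a\<in>A. w (inv_into A e (e a)) *\<^sub>R e a)"
    using assms(2) by (simp add: sum.reindex)
  also have "\<dots> = 0" using assms(2,4) by simp
  finally have "w (inv_into A e (e a)) = 0"
    using independentD[OF assms(3), of "e ` A" "\<lambda>v. w (inv_into A e v)" "e a"] assms(1,5) by simp
  then show ?thesis using assms(2,5) by simp
qed

text \<open>Chosen as a function of the subspace, so that indices with the same subspace share their
  basis; the invariance \<open>chess_lift\<close> relies on it.\<close>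

definition subspace_basis :: "'a::euclidean_space set \<Rightarrow> nat \<Rightarrow> 'a" where
  "subspace_basis S = (SOME e. inj_on e {..<dim S} \<and> independent (e ` {..<dim S}) \<and> e ` {..<dim S} \<subseteq> S)"

lemma subspace_basis:
  "inj_on (subspace_basis S) {..<dim S}" "independent (subspace_basis S ` {..<dim S})"
  "subspace_basis S ` {..<dim S} \<subseteq> S"
proof -
  obtain B where B: "B \<subseteq> S" "independent B" "card B = dim S" using basis_exists by metis
  then obtain h where "bij_betw h {0..<dim S} B" using ex_bij_betw_nat_finite[of B] independent_imp_finite by metis
  then have "inj_on h {..<dim S} \<and> independent (h ` {..<dim S}) \<and> h ` {..<dim S} \<subseteq> S"
    using B by (auto simp: bij_betw_def atLeast0LessThan)
  then have "inj_on (subspace_basis S) {..<dim S} \<and> independent (subspace_basis S ` {..<dim S}) \<and>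
     subspace_basis S ` {..<dim S} \<subseteq> S"
    unfolding subspace_basis_def
    by (rule someI[where P = "\<lambda>e. inj_on e {..<dim S} \<and> independent (e ` {..<dim S}) \<and> e ` {..<dim S} \<subseteq> S"])
  then show "inj_on (subspace_basis S) {..<dim S}" "independent (subspace_basis S ` {..<dim S})"
    "subspace_basis S ` {..<dim S} \<subseteq> S" by auto
qed

text \<open>A bijection of \<open>{1..n}\<close> onto the exponents 1, ..., n. In the order
  \<open>n\<close>, 1, 2, ... of the strata the exponents read 1, 3, 5, ... and then 2, 4, ..., so
  odd powers come first.\<close>

definition expo :: "nat \<Rightarrow> nat \<Rightarrow> nat" where
  "expo n \<kappa> = (if \<kappa> = n then 1 else if \<kappa> < (n + 1) div 2 then 2 * \<kappa> + 1 else 2 * (\<kappa> - (n + 1) div 2) + 2)"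

lemma expo_range: "1 \<le> \<kappa> \<Longrightarrow> \<kappa> \<le> n \<Longrightarrow> expo n \<kappa> \<in> {1..n}"
  by (auto simp: expo_def)

lemma expo_inj: "inj_on (expo n) {1..n}"
  unfolding inj_on_def expo_def by (auto split: if_splits) presburger+

lemma odd_expo: "1 \<le> \<kappa> \<Longrightarrow> \<kappa> \<le> n \<Longrightarrow> odd (expo n \<kappa>) \<longleftrightarrow> \<kappa> < (n + 1) div 2 \<or> \<kappa> = n"
  by (auto simp: expo_def)

text \<open>A continuous odd substitute for the sign: \<open>clamp1 (n * t)\<close> tends to
  \<open>sgn t\<close> as \<open>n\<close> grows.\<close>

definition clamp1 :: "real \<Rightarrow> real" where
  "clamp1 t = max (-1) (min 1 t)"

lemma clamp1_bound: "\<bar>clamp1 t\<bar> \<le> 1"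
  by (auto simp: clamp1_def)

lemma clamp1_minus: "clamp1 (- t) = - clamp1 t"
  by (auto simp: clamp1_def)

lemma continuous_clamp1: "continuous_on UNIV clamp1"
  unfolding clamp1_def by (intro continuous_intros)

lemma clamp1_measurable [measurable]: "clamp1 \<in> borel_measurable borel"
  using continuous_clamp1 by (rule borel_measurable_continuous_onI)

lemma clamp1_tendsto: "(f \<longlongrightarrow> l) F \<Longrightarrow> ((\<lambda>x. clamp1 (f x)) \<longlongrightarrow> clamp1 l) F"
  unfolding clamp1_def by (intro tendsto_intros)

section \<open>The map from the box to chessboard colourings\<close>

locale chess_config =
  fixes I :: "nat set" and L :: "nat \<Rightarrow> 'a::euclidean_space set" and k :: "nat \<Rightarrow> nat"
  assumes fin_I: "finite I" and k_pos: "\<And>i. i \<in> I \<Longrightarrow> k i > 0"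
    and sub: "\<And>i. i \<in> I \<Longrightarrow> subspace (L i) \<and> dim (L i) > 0"
begin

definition dims :: "nat \<Rightarrow> bool \<Rightarrow> nat" where
  "dims i b = (if b then k i else dim (L i) - 1)"

text \<open>\<open>D\<close>, \<open>half\<close>, \<open>negset\<close> and \<open>negate\<close>
  do not involve the mesh parameter, here 2, so the finer grids interpreted later share
  them.\<close>

sublocale grid: block_grid I dims 2
  by unfold_locales (use fin_I k_pos in \<open>auto simp: dims_def Suc_le_eq\<close>)

text \<open>The product vanishes exactly where some entry is \<open>\<plusminus>1\<close>, that is, on the boundary of the box.\<close>

definition direction :: "nat \<Rightarrow> (coord \<Rightarrow> real) \<Rightarrow> 'a" where
  "direction i z = (\<Sum>\<kappa>\<in>{1..dims i False}. z (i, False, \<kappa>) *\<^sub>R subspace_basis (L i) \<kappa>) +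
     (\<Prod>\<kappa>\<in>{1..dims i False}. 1 - (z (i, False, \<kappa>))\<^sup>2) *\<^sub>R subspace_basis (L i) 0"

text \<open>The constant term takes the place of the extra coordinate of the sphere; as it vanishes
  on the boundary, antipodal boundary points give opposite polynomials.\<close>

definition config_poly :: "nat \<Rightarrow> (coord \<Rightarrow> real) \<Rightarrow> real poly" where
  "config_poly i z = monom (\<Prod>\<kappa>\<in>{1..k i}. 1 - (z (i, True, \<kappa>))\<^sup>2) 0 + (\<Sum>\<kappa>\<in>{1..k i}. monom (z (i, True, \<kappa>)) (expo (k i) \<kappa>))"

definition chess :: "(coord \<Rightarrow> real) \<Rightarrow> 'a \<Rightarrow> real" where
  "chess z x = (\<Prod>i\<in>I. poly (config_poly i z) (inner x (direction i z)))"

lemma poly_config_poly: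
  "poly (config_poly i z) s = (\<Prod>\<kappa>\<in>{1..k i}. 1 - (z (i, True, \<kappa>))\<^sup>2) + (\<Sum>\<kappa>\<in>{1..k i}. z (i, True, \<kappa>) * s ^ expo (k i) \<kappa>)"
  by (simp add: config_poly_def poly_monom poly_sum)

text \<open>If all box coordinates vanish, the product is 1, so the coefficients never vanish
  simultaneously. The same reason makes \<open>config_poly\<close> nonzero.\<close>

lemma direction_nonzero:
  assumes "i \<in> I"
  shows "direction i z \<noteq> 0"
proof
  assume z: "direction i z = 0"
  define n where "n = dim (L i)"
  have n: "{..<n} = insert 0 {1..dims i False}" "n > 0" using sub[OF assms] by (auto simp: n_def dims_def)
  define w where "w \<kappa> = (if \<kappa> = 0 then (\<Prod>\<kappa>\<in>{1..dims i False}. 1 - (z (i, False, \<kappa>))\<^sup>2) else z (i, False, \<kappa>))" for \<kappa>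
  have "(\<Sum>\<kappa>\<in>{..<n}. w \<kappa> *\<^sub>R subspace_basis (L i) \<kappa>) = direction i z"
  proof -
    have "(\<Sum>\<kappa>\<in>{1..dims i False}. w \<kappa> *\<^sub>R subspace_basis (L i) \<kappa>) = (\<Sum>\<kappa>\<in>{1..dims i False}. z (i, False, \<kappa>) *\<^sub>R subspace_basis (L i) \<kappa>)"
      by (rule sum.cong) (auto simp: w_def)
    then show ?thesis unfolding n direction_def by (simp add: w_def add.commute)
  qed
  then have w0: "w \<kappa> = 0" if "\<kappa> \<in> {..<n}" for \<kappa>
    using independent_family_sum_zero[of "{..<n}" "subspace_basis (L i)" w \<kappa>] subspace_basis[of "L i"] z that
    by (simp add: n_def)
  have "z (i, False, \<kappa>) = 0" if "\<kappa> \<in> {1..dims i False}" for \<kappa>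
    using w0[of \<kappa>] that n by (auto simp: w_def)
  then have "w 0 = 1" by (simp add: w_def)
  then show False using w0[of 0] n by simp
qed

lemma direction_in: 
  assumes "i \<in> I"
  shows "direction i z \<in> L i"
proof -
  have s: "subspace (L i)" "dim (L i) > 0" using sub[OF assms] by auto
  have "subspace_basis (L i) \<kappa> \<in> L i" if "\<kappa> < dim (L i)" for \<kappa> using subspace_basis(3)[of "L i"] that by auto
  then show ?thesis unfolding direction_def using s
    by (intro subspace_add subspace_sum subspace_scale) (auto simp: dims_def)
qed

lemma config_poly_nonzero:
  assumes "i \<in> I"
  shows "config_poly i z \<noteq> 0"
proof
  assume 0: "config_poly i z = 0"
  have "z (i, True, \<kappa>) = 0" if k: "\<kappa> \<in> {1..k i}" for \<kappa>
  proof -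
    have "(\<Sum>m\<in>{1..k i}. coeff (monom (z (i, True, m)) (expo (k i) m)) (expo (k i) \<kappa>)) =
        (\<Sum>m\<in>{1..k i}. if m = \<kappa> then z (i, True, \<kappa>) else 0)"
    proof (rule sum.cong)
      fix m assume "m \<in> {1..k i}"
      then have "expo (k i) m = expo (k i) \<kappa> \<longleftrightarrow> m = \<kappa>" using inj_on_eq_iff[OF expo_inj] k by blast
      then show "coeff (monom (z (i, True, m)) (expo (k i) m)) (expo (k i) \<kappa>) = (if m = \<kappa> then z (i, True, \<kappa>) else 0)"
        by simp
    qed simp
    also have "\<dots> = z (i, True, \<kappa>)" using k by simp
    finally have e: "(\<Sum>m\<in>{1..k i}. coeff (monom (z (i, True, m)) (expo (k i) m)) (expo (k i) \<kappa>)) = z (i, True, \<kappa>)" .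
    have "expo (k i) \<kappa> \<noteq> 0" using expo_range[of \<kappa> "k i"] k by auto
    then have "coeff (config_poly i z) (expo (k i) \<kappa>) = z (i, True, \<kappa>)"
      unfolding config_poly_def coeff_add coeff_sum e by simp
    then show ?thesis using 0 by simp
  qed
  then have "config_poly i z = 1" by (simp add: config_poly_def)
  then show False using 0 by simp
qed

lemma degree_config_poly: "degree (config_poly i z) \<le> k i"
  unfolding config_poly_def
  by (intro degree_add_le degree_sum_le order_trans[OF degree_monom_le]) (use expo_range in auto)

lemma tendsto_chess:
  assumes "\<And>c. c \<in> grid.D \<Longrightarrow> (\<lambda>m. z m c) \<longlonglongrightarrow> w c"
  shows "(\<lambda>m. chess (z m) x) \<longlonglongrightarrow> chess w x"
proof -
  have c: "(\<lambda>m. z m (i, b, \<kappa>)) \<longlonglongrightarrow> w (i, b, \<kappa>)" if "i \<in> I" "\<kappa> \<in> {1..dims i b}" for i b \<kappa>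
    using assms that by (auto simp: grid.D_def)
  have d: "(\<lambda>m. direction i (z m)) \<longlonglongrightarrow> direction i w" if "i \<in> I" for i
    unfolding direction_def by (intro tendsto_intros c that)
  have "(\<lambda>m. poly (config_poly i (z m)) (inner x (direction i (z m)))) \<longlonglongrightarrow> poly (config_poly i w) (inner x (direction i w))"
    if "i \<in> I" for i
    unfolding poly_config_poly
    by (intro tendsto_intros d c that) (auto simp: dims_def)
  then show ?thesis unfolding chess_def by (intro tendsto_prod) auto
qed

lemma continuous_chess: "continuous_on UNIV (chess z)"
  unfolding chess_def poly_config_poly by (intro continuous_intros)

lemma chess_measurable [measurable]: "chess z \<in> borel_measurable borel"
  using continuous_chess by (rule borel_measurable_continuous_onI)

text \<open>On the wall the product coefficient of the block is 0, so negating the block negates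
  \<open>p\<close> or \<open>v\<close> exactly. In the second case the odd powers of
  \<open>p\<close> change sign as well, and p(-t) evaluated at the negated inner product gives the
  old value.\<close>

lemma chess_negate:
  assumes D: "(i, b, \<kappa>) \<in> grid.D" and bd: "\<bar>z (i, b, \<kappa>)\<bar> = 1"
  shows "chess (\<lambda>c. if c \<in> grid.negset i b then - z c else z c) x = (if b then -1 else 1) * chess z x"
proof -
  let ?z = "\<lambda>c. if c \<in> grid.negset i b then - z c else z c"
  let ?f = "\<lambda>z i. poly (config_poly i z) (inner x (direction i z))"
  have i: "i \<in> I" and k: "\<kappa> \<in> {1..dims i b}" using D by (auto simp: grid.D_def)
  have sq: "(?z c)\<^sup>2 = (z c)\<^sup>2" for c by simp
  have "(z (i, b, \<kappa>))\<^sup>2 = 1" using bd by (metis power2_abs power_one)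
  then have p0: "(\<Prod>\<kappa>\<in>{1..dims i b}. 1 - (z (i, b, \<kappa>))\<^sup>2) = 0" using k by (intro prod_zero) auto
  have oth: "?f ?z j = ?f z j" if "j \<in> I - {i}" for j
    using that by (simp add: poly_config_poly direction_def grid.negset_def)
  have fi: "?f ?z i = (if b then -1 else 1) * ?f z i"
  proof (cases b)
    case True
    have "direction i ?z = direction i z" by (simp add: direction_def grid.negset_def True)
    then show ?thesis using p0 True unfolding poly_config_poly sq
      by (simp add: grid.negset_def dims_def sum_negf)
  next
    case False
    have dir: "direction i ?z = - direction i z"
    proof -
      have b: "b = False" using False by simp
      show ?thesis unfolding direction_def sq p0[unfolded b] by (simp add: grid.negset_def sum_negf b)
    qed
    have "?z (i, True, \<kappa>') * (- s) ^ expo (k i) \<kappa>' = z (i, True, \<kappa>') * s ^ expo (k i) \<kappa>'" if "\<kappa>' \<in> {1..k i}" for \<kappa>' s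
      using that odd_expo[of \<kappa>' "k i"] False
      by (cases "odd (expo (k i) \<kappa>')") (auto simp: grid.negset_def grid.half_def dims_def)
    then show ?thesis unfolding poly_config_poly sq dir using False by simp
  qed
  have s: "chess z x = ?f z i * (\<Prod>j\<in>I-{i}. ?f z j)" for z
    unfolding chess_def using fin_I i by (rule prod.remove)
  show ?thesis unfolding s[of ?z] s[of z] using oth fi by simp
qed

lemma chess_lift:
  assumes g: "g permutes I" and pres: "\<And>i. i \<in> I \<Longrightarrow> L (g i) = L i \<and> k (g i) = k i"
  shows "chess (z \<circ> lift g) x = chess z x"
proof -
  have "poly (config_poly i (z \<circ> lift g)) (inner x (direction i (z \<circ> lift g))) =
     poly (config_poly (g i) z) (inner x (direction (g i) z))" if "i \<in> I" for i
    using pres[OF that] by (simp add: poly_config_poly direction_def dims_def)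
  then have "chess (z \<circ> lift g) x = (\<Prod>i\<in>I. poly (config_poly (g i) z) (inner x (direction (g i) z)))"
    by (simp add: chess_def)
  also have "\<dots> = chess z x" unfolding chess_def by (rule prod.reindex_bij_betw[OF permutes_imp_bij[OF g]])
  finally show ?thesis .
qed

end

text \<open>The zero set belongs to both colour classes, so an imbalance up to its measure is
  tolerated.\<close>

lemma bisects_if_sign_balance:
  fixes p :: "'a::euclidean_space \<Rightarrow> real"
  assumes \<mu>: "sets \<mu> = sets borel" "finite_measure \<mu>" and p: "p \<in> borel_measurable borel"
    and bal: "\<bar>measure \<mu> {x. p x > 0} - measure \<mu> {x. p x < 0}\<bar> \<le> measure \<mu> {x. p x = 0}"
  shows "bisects p \<mu>"
proof -
  interpret finite_measure \<mu> by fact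
  have s: "{x. p x > 0} \<in> sets \<mu>" "{x. p x < 0} \<in> sets \<mu>" "{x. p x = 0} \<in> sets \<mu>"
    unfolding \<mu>(1) using p by measurable
  have "{x. p x \<ge> 0} = {x. p x > 0} \<union> {x. p x = 0}" "{x. p x \<le> 0} = {x. p x < 0} \<union> {x. p x = 0}" by auto
  moreover have "{x. p x > 0} \<inter> {x. p x = 0} = {}" "{x. p x < 0} \<inter> {x. p x = 0} = {}" by auto
  ultimately have a: "measure \<mu> {x. p x \<ge> 0} = measure \<mu> {x. p x > 0} + measure \<mu> {x. p x = 0}"
    "measure \<mu> {x. p x \<le> 0} = measure \<mu> {x. p x < 0} + measure \<mu> {x. p x = 0}"
    using finite_measure_Union s by metis+
  have "space \<mu> = UNIV" using \<mu>(1) sets_eq_imp_space_eq by fastforce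
  moreover have "UNIV = {x. p x \<ge> 0} \<union> {x. p x < 0}" "{x. p x \<ge> 0} \<inter> {x. p x < 0} = {}" by auto
  moreover have "{x. p x \<ge> 0} \<in> sets \<mu>" unfolding \<mu>(1) using p by measurable
  ultimately have "measure \<mu> (space \<mu>) = measure \<mu> {x. p x \<ge> 0} + measure \<mu> {x. p x < 0}"
    using finite_measure_Union[OF _ s(2), of "{x. p x \<ge> 0}"] by simp
  then show ?thesis unfolding bisects_def using a bal by auto
qed

section \<open>Approximate bisection and passage to the limit\<close>

locale chess_measures = chess_config I L k
  for I :: "nat set" and L :: "nat \<Rightarrow> 'a::euclidean_space set" and k :: "nat \<Rightarrow> nat" +
  fixes G :: "(nat \<Rightarrow> nat) set" and \<mu> :: "nat \<Rightarrow> 'a measure" and multi :: nat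
  assumes I_nonempty: "I \<noteq> {}"
    and G_id: "id \<in> G" and G_comp: "\<And>g h. g \<in> G \<Longrightarrow> h \<in> G \<Longrightarrow> g \<circ> h \<in> G"
    and G_inv: "\<And>g. g \<in> G \<Longrightarrow> \<exists>h\<in>G. g \<circ> h = id"
    and G_perm: "\<And>g. g \<in> G \<Longrightarrow> g permutes I"
    and G_pres: "\<And>g i. g \<in> G \<Longrightarrow> i \<in> I \<Longrightarrow> L (g i) = L i \<and> k (g i) = k i"
    and G_moved: "\<And>g i. g \<in> G \<Longrightarrow> i \<in> I \<Longrightarrow> g i \<noteq> i \<Longrightarrow> 2 \<le> dim (L i) - 1 + k i"
    and multi: "card G * multi * (\<Prod>i\<in>I. fact (dim (L i) - 1 + k i)) = fact (\<Sum>i\<in>I. dim (L i) - 1 + k i)" "odd multi"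
    and binom: "\<And>i. i \<in> I \<Longrightarrow> odd ((dim (L i) - 1 + ((k i + 1) div 2 - 1)) choose (dim (L i) - 1))"
    and \<mu>: "\<And>j. j \<in> {1..(\<Sum>i\<in>I. dim (L i) - 1 + k i)} \<Longrightarrow> sets (\<mu> j) = sets borel \<and> finite_measure (\<mu> j)"
begin

lemma card_D: "card grid.D = (\<Sum>i\<in>I. dim (L i) - 1 + k i)"
  using grid.card_D by (simp add: dims_def)

text \<open>A smoothed imbalance of sharpness \<open>n\<close>, continuous in \<open>z\<close> even
  for measures that charge the zero set.\<close>

definition balance :: "nat \<Rightarrow> nat \<Rightarrow> (coord \<Rightarrow> real) \<Rightarrow> real" where
  "balance n j z = (\<integral>x. clamp1 (real n * chess z x) \<partial>\<mu> j)"

lemma tendsto_balance: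
  assumes j: "j \<in> {1..card grid.D}" and z: "\<And>c. c \<in> grid.D \<Longrightarrow> (\<lambda>m. z m c) \<longlonglongrightarrow> w c"
  shows "(\<lambda>m. balance n j (z m)) \<longlonglongrightarrow> balance n j w"
proof -
  have sb: "sets (\<mu> j) = sets borel" and "finite_measure (\<mu> j)" using \<mu>[of j] j card_D by auto
  interpret finite_measure "\<mu> j" by fact
  note mc = measurable_cong_sets[OF sb refl]
  show ?thesis unfolding balance_def
  proof (rule integral_dominated_convergence[where w = "\<lambda>_. 1"])
    show "(\<lambda>x. clamp1 (real n * chess w x)) \<in> borel_measurable (\<mu> j)" unfolding mc by measurable
    show "\<And>i. (\<lambda>x. clamp1 (real n * chess (z i) x)) \<in> borel_measurable (\<mu> j)" unfolding mc by measurable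
    show "AE x in \<mu> j. (\<lambda>i. clamp1 (real n * chess (z i) x)) \<longlonglongrightarrow> clamp1 (real n * chess w x)"
      using tendsto_chess[OF z] by (auto intro!: clamp1_tendsto tendsto_intros)
  qed (use clamp1_bound in auto)
qed

text \<open>If it failed, each configuration would get the index of a measure with imbalance above
  \<open>1 / n\<close> as its label, signed by the imbalance. At neighbouring points with
  complementary labels the balance of one measure differs by more than \<open>1 / n\<close>, on
  arbitrarily fine grids; this contradicts continuity at a limit point.\<close>

lemma almost_balanced_config:
  assumes n: "n > 0"
  shows "\<exists>z. (\<forall>c\<in>grid.D. \<bar>z c\<bar> \<le> 1) \<and> (\<forall>j\<in>{1..card grid.D}. \<bar>balance n j z\<bar> \<le> 1 / n)"
proof (rule ccontr)
  assume contra: "\<not> ?thesis"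
  \<comment> \<open>Taking the least index makes the label a function of the balances alone, hence
    compatible with all identifications and symmetries.\<close>
  define J where "J z = (LEAST j. j \<in> {1..card grid.D} \<and> \<bar>balance n j z\<bar> > 1 / n)" for z
  have J: "J z \<in> {1..card grid.D}" "\<bar>balance n (J z) z\<bar> > 1 / n" if "\<forall>c\<in>grid.D. \<bar>z c\<bar> \<le> 1" for z
  proof -
    have "\<exists>j. j \<in> {1..card grid.D} \<and> \<bar>balance n j z\<bar> > 1 / n"
    proof -
      have "\<not> (\<forall>j\<in>{1..card grid.D}. \<bar>balance n j z\<bar> \<le> 1 / n)" using contra that by blast
      then show ?thesis by (auto simp: not_le)
    qed
    then have "J z \<in> {1..card grid.D} \<and> \<bar>balance n (J z) z\<bar> > 1 / n" unfolding J_def by (rule LeastI_ex)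
    then show "J z \<in> {1..card grid.D}" "\<bar>balance n (J z) z\<bar> > 1 / n" by auto
  qed
  define scale where "scale m x c = real_of_int (x c) / real_of_int (2 * (int m + 1))" for m :: nat and x :: "coord \<Rightarrow> int" and c
  define lab where "lab z = (if balance n (J z) z > 0 then 1 else -1) * int (J z)" for z
  have neg_step: "lab z' = - lab z \<and> J z' = J z" if "chess z' = (\<lambda>x. - chess z x)" "\<forall>c\<in>grid.D. \<bar>z c\<bar> \<le> 1" for z z'
  proof -
    have b: "balance n j z' = - balance n j z" for j unfolding balance_def that(1) by (simp add: clamp1_minus)
    then have "J z' = J z" by (simp add: J_def)
    moreover have "balance n (J z) z \<noteq> 0" using J(2)[OF that(2)] n by force
    ultimately show ?thesis using b by (auto simp: lab_def)
  qed
  have same_step: "lab z' = lab z" if "chess z' = chess z" for z z'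
    unfolding lab_def J_def balance_def that ..
  have step: "\<exists>z z'. (\<forall>c\<in>grid.D. \<bar>z c\<bar> \<le> 1 \<and> \<bar>z' c\<bar> \<le> 1 \<and> \<bar>z c - z' c\<bar> \<le> 1 / Suc m) \<and>
      (\<exists>j\<in>{1..card grid.D}. \<bar>balance n j z - balance n j z'\<bar> > 1 / n)" for m :: nat
  proof -
    let ?R = "2 * (int m + 1)"
    interpret s: symmetric_block_grid I dims ?R G
    proof unfold_locales
      show "\<And>i. i \<in> I \<Longrightarrow> 1 \<le> dims i True" by (rule grid.d_pos)
      show "\<And>g i b. g \<in> G \<Longrightarrow> i \<in> I \<Longrightarrow> dims (g i) b = dims i b" using G_pres by (simp add: dims_def)
      show "\<And>g i. g \<in> G \<Longrightarrow> i \<in> I \<Longrightarrow> g i \<noteq> i \<Longrightarrow> 2 \<le> dims i False + dims i True"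
        using G_moved by (simp add: dims_def)
    qed (use fin_I I_nonempty G_id G_comp G_inv G_perm in auto)
    let ?X = "{x. (\<forall>c\<in>grid.D. \<bar>x c\<bar> \<le> ?R) \<and> (\<forall>c. c \<notin> grid.D \<longrightarrow> x c = 0)}"
    have sc: "\<forall>c\<in>grid.D. \<bar>scale m x c\<bar> \<le> 1" if "x \<in> ?X" for x
    proof
      fix c assume "c \<in> grid.D"
      then have "\<bar>x c\<bar> \<le> ?R" using that by auto
      then have "real_of_int \<bar>x c\<bar> \<le> real_of_int ?R" by (simp only: of_int_le_iff)
      then show "\<bar>scale m x c\<bar> \<le> 1" unfolding scale_def by (simp add: abs_divide)
    qed
    have "\<exists>x\<in>?X. \<exists>x'\<in>?X. (\<forall>c\<in>grid.D. \<bar>x c - x' c\<bar> \<le> 1) \<and> lab (scale m x) = - lab (scale m x')"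
    proof (rule s.complementary_labels_exist[where \<Lambda> = "\<lambda>x. lab (scale m x)"])
      show "card G * multi * (\<Prod>i\<in>I. fact (dims i False + dims i True)) = fact (card grid.D)"
        using multi(1) unfolding card_D by (simp add: dims_def)
      show "odd multi" by (rule multi(2))
      show "\<And>i. i \<in> I \<Longrightarrow> odd ((dims i False + (grid.half i - 1)) choose dims i False)"
        using binom by (simp add: dims_def grid.half_def)
    next
      fix x assume x: "x \<in> ?X"
      show "lab (scale m x) \<noteq> 0 \<and> \<bar>lab (scale m x)\<bar> \<le> int (card grid.D)"
      proof -
        have "J (scale m x) \<in> {1..card grid.D}" by (rule J(1)[OF sc[OF x]])
        then show ?thesis by (auto simp: lab_def)
      qed
    next
      fix g x assume g: "g \<in> G"
      have "scale m (x \<circ> lift g) = scale m x \<circ> lift g" by (auto simp: scale_def)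
      then have "chess (scale m (x \<circ> lift g)) = chess (scale m x)"
        using chess_lift[OF G_perm[OF g] G_pres[OF g]] by auto
      then show "lab (scale m (x \<circ> lift g)) = lab (scale m x)" by (rule same_step)
    next
      fix i b \<kappa> and x :: "coord \<Rightarrow> int"
      assume a: "(i, b, \<kappa>) \<in> grid.D" "x \<in> ?X" "\<bar>x (i, b, \<kappa>)\<bar> = ?R"
      have e: "scale m (grid.negate i b x) = (\<lambda>c. if c \<in> grid.negset i b then - scale m x c else scale m x c)"
        by (auto simp: scale_def grid.negate_def)
      have "real_of_int \<bar>x (i, b, \<kappa>)\<bar> = real_of_int ?R" using a(3) by simp
      then have "\<bar>scale m x (i, b, \<kappa>)\<bar> = 1" unfolding scale_def by (simp add: abs_divide)
      then have "chess (scale m (grid.negate i b x)) = (\<lambda>y. (if b then -1 else 1) * chess (scale m x) y)"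
        unfolding e using chess_negate[OF a(1)] by blast
      then show "lab (scale m (grid.negate i b x)) = (if b then - 1 else 1) * lab (scale m x)"
        using neg_step[of "scale m (grid.negate i b x)" "scale m x"] same_step[of "scale m (grid.negate i b x)" "scale m x"] sc[OF a(2)]
        by (cases b) auto
    qed
    then obtain x x' where x: "x \<in> ?X" "x' \<in> ?X" "\<And>c. c \<in> grid.D \<Longrightarrow> \<bar>x c - x' c\<bar> \<le> 1"
      "lab (scale m x) = - lab (scale m x')" by auto
    let ?z = "scale m x" and ?z' = "scale m x'"
    have Jx: "J ?z \<in> {1..card grid.D}" "J ?z' \<in> {1..card grid.D}" "\<bar>balance n (J ?z) ?z\<bar> > 1 / n" "\<bar>balance n (J ?z') ?z'\<bar> > 1 / n"
      using J sc x(1,2) by auto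
    have "J ?z = J ?z'" and "balance n (J ?z) ?z > 0 \<longleftrightarrow> \<not> balance n (J ?z') ?z' > 0"
      using x(4) Jx(1,2) unfolding lab_def by (auto split: if_splits)
    then have "\<bar>balance n (J ?z) ?z - balance n (J ?z) ?z'\<bar> > 1 / n" using Jx(3,4) by (auto simp: abs_if split: if_splits)
    moreover have "\<bar>?z c - ?z' c\<bar> \<le> 1 / Suc m" if "c \<in> grid.D" for c
    proof -
      have "real_of_int \<bar>x c - x' c\<bar> \<le> 1" using x(3)[OF that] by linarith
      then have "\<bar>real_of_int (x c) - real_of_int (x' c)\<bar> \<le> 2" by linarith
      moreover have "?z c - ?z' c = (real_of_int (x c) - real_of_int (x' c)) / (2 * (real m + 1))"
        by (simp add: scale_def diff_divide_distrib)
      ultimately have "\<bar>?z c - ?z' c\<bar> \<le> 2 / (2 * (real m + 1))"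
        by (simp only: abs_divide) (intro frac_le; simp)
      also have "2 / (2 * (real m + 1)) = 1 / real (Suc m)" by (simp add: field_simps)
      finally show ?thesis .
    qed
    ultimately show ?thesis using sc[OF x(1)] sc[OF x(2)] Jx(1) by blast
  qed
  then obtain z z' where zz: "\<And>m c. c \<in> grid.D \<Longrightarrow> \<bar>z m c\<bar> \<le> 1 \<and> \<bar>z' m c\<bar> \<le> 1 \<and> \<bar>z m c - z' m c\<bar> \<le> 1 / Suc m"
    "\<And>m. \<exists>j\<in>{1..card grid.D}. \<bar>balance n j (z m) - balance n j (z' m)\<bar> > 1 / n" by metis
  obtain w r where r: "strict_mono (r :: nat \<Rightarrow> nat)" "\<And>c. c \<in> grid.D \<Longrightarrow> (\<lambda>m. z (r m) c) \<longlonglongrightarrow> w c"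
    using bounded_coordinates_subsequence[OF grid.finite_D, of z 1] zz(1) by blast
  have r': "(\<lambda>m. z' (r m) c) \<longlonglongrightarrow> w c" if c: "c \<in> grid.D" for c
  proof -
    have "(\<lambda>m. 1 / real (Suc m)) \<longlonglongrightarrow> 0" by (rule LIMSEQ_Suc[OF lim_1_over_n])
    then have "(\<lambda>m. z m c - z' m c) \<longlonglongrightarrow> 0"
      by (rule Lim_null_comparison[rotated]) (use zz(1)[OF c] in auto)
    then have "((\<lambda>m. z m c - z' m c) \<circ> r) \<longlonglongrightarrow> 0" using r(1) by (rule LIMSEQ_subseq_LIMSEQ)
    then have "(\<lambda>m. z (r m) c - (z (r m) c - z' (r m) c)) \<longlonglongrightarrow> w c - 0"
      using r(2)[OF c] by (intro tendsto_diff) (auto simp: comp_def)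
    then show ?thesis by simp
  qed
  have "\<forall>\<^sub>F m in sequentially. \<bar>balance n j (z (r m)) - balance n j (z' (r m))\<bar> < 1 / n" if "j \<in> {1..card grid.D}" for j
  proof -
    have "(\<lambda>m. \<bar>balance n j (z (r m)) - balance n j (z' (r m))\<bar>) \<longlonglongrightarrow> \<bar>balance n j w - balance n j w\<bar>"
      by (intro tendsto_intros tendsto_balance[OF that] r(2) r')
    then show ?thesis by (rule order_tendstoD) (use n in simp)
  qed
  then have "\<forall>\<^sub>F m in sequentially. \<forall>j\<in>{1..card grid.D}. \<bar>balance n j (z (r m)) - balance n j (z' (r m))\<bar> < 1 / n"
    by (intro eventually_ball_finite) auto
  then obtain m where "\<forall>j\<in>{1..card grid.D}. \<bar>balance n j (z (r m)) - balance n j (z' (r m))\<bar> < 1 / n"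
    by (auto simp: eventually_sequentially)
  then show False using zz(2)[of "r m"] by force
qed

text \<open>Along a convergent subsequence sharpness grows while the tolerance shrinks. Off the zero
  set of the limit the clamped values tend to its sign; on that set nothing is known about them, but
  they contribute at most its measure, which is the slack that bisection allows.\<close>

theorem bisecting_config: "\<exists>z. \<forall>j\<in>{1..card grid.D}. bisects (chess z) (\<mu> j)"
proof -
  have "\<exists>z. \<forall>n. (\<forall>c\<in>grid.D. \<bar>z n c\<bar> \<le> 1) \<and> (\<forall>j\<in>{1..card grid.D}. \<bar>balance (Suc n) j (z n)\<bar> \<le> 1 / real (Suc n))"
    by (rule choice) (use almost_balanced_config in blast)
  then obtain z where z: "\<And>n c. c \<in> grid.D \<Longrightarrow> \<bar>z n c\<bar> \<le> 1"
    "\<And>n j. j \<in> {1..card grid.D} \<Longrightarrow> \<bar>balance (Suc n) j (z n)\<bar> \<le> 1 / real (Suc n)" by blast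
  obtain w r where r: "strict_mono (r :: nat \<Rightarrow> nat)" "\<And>c. c \<in> grid.D \<Longrightarrow> (\<lambda>m. z (r m) c) \<longlonglongrightarrow> w c"
    using bounded_coordinates_subsequence[OF grid.finite_D, of z 1] z(1) by blast
  have "bisects (chess w) (\<mu> j)" if j: "j \<in> {1..card grid.D}" for j
  proof -
    have sb: "sets (\<mu> j) = sets borel" and fm: "finite_measure (\<mu> j)" using \<mu>[of j] j card_D by auto
    interpret finite_measure "\<mu> j" by fact
    note mc = measurable_cong_sets[OF sb refl]
    let ?S = "\<lambda>P. {x. P (chess w x)}"
    have s: "?S (\<lambda>t. t > 0) \<in> sets (\<mu> j)" "?S (\<lambda>t. t < 0) \<in> sets (\<mu> j)" "?S (\<lambda>t. t = 0) \<in> sets (\<mu> j)"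
      unfolding sb by measurable
    define f where "f m x = clamp1 (real (Suc (r m)) * chess (z (r m)) x)" for m x
    \<comment> \<open>\<open>h m\<close> removes the zero set of the limit colouring, where
      \<open>f m\<close> need not converge.\<close>
    define h where "h m x = (if chess w x = 0 then 0 else f m x)" for m x
    have fmeas: "f m \<in> borel_measurable (\<mu> j)" for m unfolding mc f_def by measurable
    have hmeas: "h m \<in> borel_measurable (\<mu> j)" for m unfolding mc h_def f_def by measurable
    have fint: "integrable (\<mu> j) (f m)" for m
      by (rule integrable_const_bound[OF _ fmeas, of _ 1]) (simp add: f_def clamp1_bound)
    have hint: "integrable (\<mu> j) (h m)" for m
      by (rule integrable_const_bound[OF _ hmeas, of _ 1]) (simp add: h_def f_def clamp1_bound)
    have lim: "(\<lambda>m. h m x) \<longlonglongrightarrow> sgn (chess w x)" for x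
    proof -
      have c: "(\<lambda>m. chess (z (r m)) x) \<longlonglongrightarrow> chess w x" using r(2) by (rule tendsto_chess)
      have inf: "filterlim (\<lambda>m. real (Suc (r m))) at_top sequentially"
        using filterlim_compose[OF filterlim_real_sequentially filterlim_compose[OF filterlim_Suc filterlim_subseq[OF r(1)]]] by simp
      consider "chess w x = 0" | "chess w x > 0" | "chess w x < 0" by linarith
      then show ?thesis
      proof cases
        case 1 then show ?thesis by (simp add: h_def)
      next
        case 2
        have "filterlim (\<lambda>m. chess (z (r m)) x * real (Suc (r m))) at_top sequentially"
          by (rule filterlim_tendsto_pos_mult_at_top[OF c 2 inf])
        then have "\<forall>\<^sub>F m in sequentially. chess (z (r m)) x * real (Suc (r m)) \<ge> 1"
          unfolding filterlim_at_top by blast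
        then have "\<forall>\<^sub>F m in sequentially. h m x = 1"
          by eventually_elim (use 2 in \<open>simp add: h_def f_def clamp1_def mult.commute\<close>)
        then show ?thesis using 2 by (simp add: tendsto_eventually)
      next
        case 3
        have "filterlim (\<lambda>m. - chess (z (r m)) x * real (Suc (r m))) at_top sequentially"
          by (rule filterlim_tendsto_pos_mult_at_top[OF tendsto_minus[OF c] _ inf]) (use 3 in simp)
        then have "\<forall>\<^sub>F m in sequentially. - chess (z (r m)) x * real (Suc (r m)) \<ge> 1"
          unfolding filterlim_at_top by blast
        then have "\<forall>\<^sub>F m in sequentially. h m x = -1"
        proof eventually_elim
          case (elim m)
          then have "real (Suc (r m)) * chess (z (r m)) x \<le> -1" by (simp add: algebra_simps)
          then show ?case using 3 by (simp add: h_def f_def clamp1_def)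
        qed
        then show ?thesis using 3 by (simp add: tendsto_eventually)
      qed
    qed
    have limI: "(\<lambda>m. \<integral>x. h m x \<partial>\<mu> j) \<longlonglongrightarrow> (\<integral>x. sgn (chess w x) \<partial>\<mu> j)"
    proof (rule integral_dominated_convergence[where w = "\<lambda>_. 1"])
      show "(\<lambda>x. sgn (chess w x)) \<in> borel_measurable (\<mu> j)" unfolding mc by measurable
      show "h m \<in> borel_measurable (\<mu> j)" for m by (rule hmeas)
      show "AE x in \<mu> j. (\<lambda>m. h m x) \<longlonglongrightarrow> sgn (chess w x)" using lim by simp
      show "AE x in \<mu> j. norm (h m x) \<le> 1" for m by (simp add: h_def f_def clamp1_bound)
    qed simp
    have ind: "integrable (\<mu> j) (indicat_real A)" if "A \<in> sets (\<mu> j)" for A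
      by (rule integrable_const_bound[where B = 1]) (use that in auto)
    have "(\<integral>x. sgn (chess w x) \<partial>\<mu> j) = (\<integral>x. indicator (?S (\<lambda>t. t > 0)) x - indicator (?S (\<lambda>t. t < 0)) x \<partial>\<mu> j)"
      by (rule Bochner_Integration.integral_cong) (auto simp: sgn_if indicator_def)
    also have "\<dots> = measure (\<mu> j) (?S (\<lambda>t. t > 0)) - measure (\<mu> j) (?S (\<lambda>t. t < 0))"
      using s ind by (subst Bochner_Integration.integral_diff) (auto simp: sets_eq_imp_space_eq[OF sb])
    finally have sgnI: "(\<integral>x. sgn (chess w x) \<partial>\<mu> j) = measure (\<mu> j) (?S (\<lambda>t. t > 0)) - measure (\<mu> j) (?S (\<lambda>t. t < 0))" .
    have bd: "\<bar>\<integral>x. h m x \<partial>\<mu> j\<bar> \<le> 1 / real (Suc (r m)) + measure (\<mu> j) (?S (\<lambda>t. t = 0))" for m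
    proof -
      have "\<bar>\<integral>x. f m x - h m x \<partial>\<mu> j\<bar> \<le> (\<integral>x. indicator (?S (\<lambda>t. t = 0)) x \<partial>\<mu> j)"
      proof -
        have "\<bar>\<integral>x. f m x - h m x \<partial>\<mu> j\<bar> \<le> (\<integral>x. \<bar>f m x - h m x\<bar> \<partial>\<mu> j)" by (rule integral_abs_bound)
        also have "\<dots> \<le> (\<integral>x. indicator (?S (\<lambda>t. t = 0)) x \<partial>\<mu> j)"
        proof (rule integral_mono)
          show "integrable (\<mu> j) (\<lambda>x. \<bar>f m x - h m x\<bar>)"
            by (intro integrable_abs Bochner_Integration.integrable_diff fint hint)
          show "\<bar>f m x - h m x\<bar> \<le> indicator (?S (\<lambda>t. t = 0)) x" for x
            by (simp add: h_def f_def indicator_def clamp1_bound)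
        qed (rule ind[OF s(3)])
        finally show ?thesis .
      qed
      then have "\<bar>(\<integral>x. f m x \<partial>\<mu> j) - (\<integral>x. h m x \<partial>\<mu> j)\<bar> \<le> measure (\<mu> j) (?S (\<lambda>t. t = 0))"
        using fint hint s by simp
      moreover have "\<bar>\<integral>x. f m x \<partial>\<mu> j\<bar> \<le> 1 / real (Suc (r m))"
        using z(2)[OF j, of "r m"] unfolding balance_def f_def .
      ultimately show ?thesis by linarith
    qed
    have "(\<lambda>m. 1 / real (Suc m)) \<longlonglongrightarrow> 0" by (rule LIMSEQ_Suc[OF lim_1_over_n])
    then have "((\<lambda>m. 1 / real (Suc m)) \<circ> r) \<longlonglongrightarrow> 0" using r(1) by (rule LIMSEQ_subseq_LIMSEQ)
    then have "(\<lambda>m. 1 / real (Suc (r m)) + measure (\<mu> j) (?S (\<lambda>t. t = 0))) \<longlonglongrightarrow> 0 + measure (\<mu> j) (?S (\<lambda>t. t = 0))"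
      unfolding comp_def by (intro tendsto_intros)
    from LIMSEQ_le[OF tendsto_rabs[OF limI] this]
    have "\<bar>\<integral>x. sgn (chess w x) \<partial>\<mu> j\<bar> \<le> measure (\<mu> j) (?S (\<lambda>t. t = 0))" using bd by auto
    then show ?thesis
      by (intro bisects_if_sign_balance[OF sb fm chess_measurable]) (simp add: sgnI)
  qed
  then show ?thesis by blast
qed

end

section \<open>The bisection theorem\<close>

lemma bisects_sgn_cong:
  assumes "\<And>x. sgn (p x) = sgn (q x)"
  shows "bisects p \<mu> \<longleftrightarrow> bisects q \<mu>"
proof -
  have "p x \<ge> 0 \<longleftrightarrow> q x \<ge> 0" "p x \<le> 0 \<longleftrightarrow> q x \<le> 0" for x
    using assms[of x] by (auto simp: sgn_if split: if_splits)
  then show ?thesis by (simp add: bisects_def)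
qed

lemma sgn_prod:
  fixes f :: "'b \<Rightarrow> real"
  shows "sgn (\<Prod>i\<in>A. f i) = (\<Prod>i\<in>A. sgn (f i))"
  by (induction A rule: infinite_finite_induct) (auto simp: sgn_mult)

lemma fibre_perms_comp:
  assumes "g \<in> fibre_perms A f" "h \<in> fibre_perms A f"
  shows "g \<circ> h \<in> fibre_perms A f"
  using assms by (auto simp: fibre_perms_def permutes_compose permutes_in_image)

lemma fibre_perms_inverse:
  assumes "g \<in> fibre_perms A f"
  shows "\<exists>h\<in>fibre_perms A f. g \<circ> h = id"
proof (intro bexI)
  have g: "g permutes A" and f: "\<And>i. i \<in> A \<Longrightarrow> f (g i) = f i" using assms by (auto simp: fibre_perms_def)
  show "g \<circ> Hilbert_Choice.inv g = id" by (rule permutes_inv_o(1)[OF g])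
  have p: "Hilbert_Choice.inv g permutes A" by (rule permutes_inv[OF g])
  have "f (Hilbert_Choice.inv g i) = f i" if "i \<in> A" for i
    using f[of "Hilbert_Choice.inv g i"] permutes_inverses(1)[OF g, of i] permutes_in_image[OF p] that by metis
  then show "Hilbert_Choice.inv g \<in> fibre_perms A f" using p by (auto simp: fibre_perms_def)
qed

text \<open>Shows that the \<open>div\<close> in \<open>multinom\<close> is exact: the quotient
  counts linear extensions of disjoint chains.\<close>

lemma prod_fact_dvd_fact_sum:
  fixes l k :: "nat \<Rightarrow> nat"
  assumes "finite I" "\<And>i. i \<in> I \<Longrightarrow> k i > 0"
  shows "(\<Prod>i\<in>I. fact (l i + k i)) dvd (fact (\<Sum>i\<in>I. l i + k i) :: nat)"
proof -
  interpret block_grid I "\<lambda>i b. if b then k i else l i" 2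
    by unfold_locales (use assms in \<open>auto simp: Suc_le_eq\<close>)
  show ?thesis using card_linear_extensions_bchain card_D by (metis dvd_triv_right)
qed

theorem theorem1p1:
  fixes n :: nat
    and L :: "nat \<Rightarrow> 'a::euclidean_space set"
    and k :: "nat \<Rightarrow> nat"
    and \<mu> :: "nat \<Rightarrow> 'a measure"
  assumes "n > 0"
    and subsp: "\<forall>i\<in>{1..n}. subspace (L i) \<and> dim (L i) > 0"
    and kpos: "\<forall>i\<in>{1..n}. k i > 0"
    and parity: "\<exists>N::nat. odd N \<and>
        card {g. g permutes {1..n} \<and> (\<forall>i\<in>{1..n}. L (g i) = L i \<and> k (g i) = k i)} * N
          = multinom n (\<lambda>i. dim (L i) + k i - 1) * (\<Prod>i=1..n. Stirling (dim (L i) + k i - 1) (k i))"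
    and meas: "\<forall>j\<in>{1..(\<Sum>i=1..n. dim (L i) + k i - 1)}.
        sets (\<mu> j) = sets borel \<and> finite_measure (\<mu> j)"
  shows "\<exists>v :: nat \<Rightarrow> 'a. \<exists>H :: nat \<Rightarrow> nat \<Rightarrow> 'a \<times> real.
     (\<forall>i\<in>{1..n}. v i \<in> L i \<and> norm (v i) = 1 \<and>
        (\<forall>j\<in>{1..k i}. H i j \<noteq> (0, 0) \<and> orth_to (H i j) (v i))) \<and>
     (\<forall>j\<in>{1..(\<Sum>i=1..n. dim (L i) + k i - 1)}.
        bisects (\<lambda>x. \<Prod>i=1..n. \<Prod>j=1..k i. aff_fun (H i j) x) (\<mu> j))"
proof -
  define I0 where "I0 = {1..n}"
  define f where "f i = (L i, k i)" for i
  \<comment> \<open>From here on \<open>l i\<close> is the dimension of the sphere of directions,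
    one less than that of \<open>L i\<close>; so \<open>m\<close> has no subtraction of 1 on the
    right.\<close>
  define l where "l i = dim (L i) - 1" for i
  have pos: "subspace (L i)" "dim (L i) > 0" "k i > 0" if "i \<in> I0" for i using that subsp kpos by (auto simp: I0_def)
  have m: "dim (L i) + k i - 1 = l i + k i" if "i \<in> I0" for i using pos(2)[OF that] by (simp add: l_def)
  define I1 where "I1 = {i\<in>I0. l i = 0 \<and> k i = 1}"
  define I2 where "I2 = {i\<in>I0. \<not> (l i = 0 \<and> k i = 1)}"
  have fin: "finite I0" "finite I1" "finite I2" and I0: "I0 = I2 \<union> I1" and I12: "I2 \<inter> I1 = {}"
    by (auto simp: I0_def I1_def I2_def)
  \<comment> \<open>Swapping two indices with \<open>l\<^sub>i = k\<^sub>i = 1\<close> fixes a wall of codimension one, so that the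
    quotient would acquire a boundary. All such indices sharing one line \<open>L\<close> are therefore merged into
    a single index \<open>r\<close> of \<open>T\<close> carrying \<open>k' r\<close> hyperplanes; this does not change the number \<open>N\<close>.\<close>
  obtain T where T: "T \<subseteq> I1" "inj_on L T" "L ` I1 = L ` T" using subset_image_inj[of "L ` I1" L I1] by auto
  have finT: "finite T" using T(1) fin(2) finite_subset by blast
  define \<rho> where "\<rho> i = (if i \<in> I1 then inv_into T L (L i) else i)" for i
  define I where "I = I2 \<union> T"
  define k' where "k' r = (\<Sum>i\<in>{i\<in>I0. \<rho> i = r}. k i)" for r
  define G where "G = fibre_perms I2 f"
  have \<rho>1: "\<rho> i \<in> T" "L (\<rho> i) = L i" if "i \<in> I1" for i
    using that T(3) inv_into_into[of "L i" L T] f_inv_into_f[of "L i" L T] by (auto simp: \<rho>_def)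
  have \<rho>2: "\<rho> i = i" if "i \<in> I2" for i using that I12 by (auto simp: \<rho>_def)
  have \<rho>I: "\<rho> i \<in> I" "L (\<rho> i) = L i" if "i \<in> I0" for i using that \<rho>1 \<rho>2 by (auto simp: I0 I_def)
  have finI: "finite I" and II0: "I \<subseteq> I0" and disj: "I2 \<inter> T = {}" using fin finT T(1) I12 by (auto simp: I_def I0)
  have fib2: "{i\<in>I0. \<rho> i = r} = {r}" if "r \<in> I2" for r
  proof -
    have "i = r" if "i \<in> I0" "\<rho> i = r" for i
      using that \<open>r \<in> I2\<close> \<rho>1(1)[of i] \<rho>2[of i] disj by (cases "i \<in> I1") (auto simp: I0)
    then show ?thesis using that \<rho>2[OF that] by (auto simp: I0)
  qed
  have fibT: "{i\<in>I0. \<rho> i = r} = {i\<in>I1. f i = f r}" if r: "r \<in> T" for r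
  proof (intro equalityI subsetI)
    fix i assume i: "i \<in> {i\<in>I0. \<rho> i = r}"
    then have "i \<in> I1" using \<rho>2[of i] r disj by (auto simp: I0)
    moreover have "L i = L r" using \<rho>1(2)[OF \<open>i \<in> I1\<close>] i by auto
    ultimately show "i \<in> {i\<in>I1. f i = f r}" using r T(1) by (auto simp: f_def I1_def)
  next
    fix i assume "i \<in> {i\<in>I1. f i = f r}"
    then have i: "i \<in> I1" "L i = L r" by (auto simp: f_def)
    then have "\<rho> i = r" using \<rho>1[OF i(1)] T(2) r by (auto simp: inj_on_def)
    then show "i \<in> {i\<in>I0. \<rho> i = r}" using i by (auto simp: I0)
  qed
  have k'2: "k' r = k r" if "r \<in> I2" for r unfolding k'_def fib2[OF that] by simp
  have k'T: "k' r = card {i\<in>I1. f i = f r}" if "r \<in> T" for r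
    unfolding k'_def fibT[OF that] by (simp add: I1_def)
  have lT: "l r = 0" if "r \<in> T" for r using that T(1) by (auto simp: I1_def)
  have k'pos: "k' r > 0" if "r \<in> I" for r
  proof (cases "r \<in> I2")
    case True then show ?thesis using k'2 pos(3)[of r] by (simp add: I0)
  next
    case False
    then have r: "r \<in> T" using that by (simp add: I_def)
    then have "r \<in> {i\<in>I1. f i = f r}" using T(1) by auto
    then show ?thesis unfolding k'T[OF r] using fin(2) by (simp add: card_gt_0_iff) blast
  qed
  have fact_I: "(\<Prod>i\<in>I. fact (l i + k' i)) = (\<Prod>i\<in>I2. fact (l i + k i)) * (\<Prod>r\<in>T. fact (k' r))"
    unfolding I_def using k'2 lT by (subst prod.union_disjoint[OF fin(3) finT disj]) simp
  have sum_I: "(\<Sum>i\<in>I. l i + k' i) = (\<Sum>i\<in>I0. l i + k i)"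
  proof -
    have "(\<Sum>i\<in>I. k' i) = (\<Sum>i\<in>I0. k i)"
      unfolding k'_def by (rule sum.group[OF fin(1) finI]) (use \<rho>I in auto)
    moreover have "(\<Sum>i\<in>I. l i) = (\<Sum>i\<in>I2. l i)"
      unfolding I_def using lT by (subst sum.union_disjoint[OF fin(3) finT disj]) simp
    moreover have "(\<Sum>i\<in>I0. l i) = (\<Sum>i\<in>I2. l i)"
      unfolding I0 by (subst sum.union_disjoint[OF fin(3,2) I12]) (simp add: I1_def)
    ultimately show ?thesis by (simp add: sum.distrib)
  qed
  \<comment> \<open>Merging gives up the exchanges of indices with the same line, a factor
    \<open>fact (k' r)\<close> for each \<open>r\<close>. The same factor enters the denominator of
    the merged multinomial coefficient, so the quotient keeps its value.\<close>
  have cardG: "card (fibre_perms I0 f) = card G * (\<Prod>r\<in>T. fact (k' r))"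
  proof -
    have "card (fibre_perms I0 f) = card (fibre_perms I2 f) * card (fibre_perms I1 f)"
      unfolding I0
    proof (rule card_fibre_perms_disjoint_Un[OF fin(3,2)])
      show "f ` I2 \<inter> f ` I1 = {}" by (auto simp: f_def I1_def I2_def l_def)
    qed
    also have "card (fibre_perms I1 f) = (\<Prod>y\<in>f ` I1. fact (card {i\<in>I1. f i = y}))"
      by (rule card_fibre_perms[OF fin(2)])
    also have "f ` I1 = f ` T"
    proof -
      have "f i = (L i, 1)" if "i \<in> I1" for i using that by (auto simp: f_def I1_def)
      then have "f ` I1 = (\<lambda>S. (S, 1)) ` L ` I1" "f ` T = (\<lambda>S. (S, 1)) ` L ` T" using T(1) by (force simp: image_iff)+
      then show ?thesis using T(3) by simp
    qed
    also have "(\<Prod>y\<in>f ` T. fact (card {i\<in>I1. f i = y})) = (\<Prod>r\<in>T. fact (k' r))"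
      using T(2) k'T by (subst prod.reindex) (auto simp: inj_on_def f_def)
    finally show ?thesis by (simp add: G_def)
  qed
  have G_I2: "g permutes I2" "\<And>i. i \<in> I2 \<Longrightarrow> L (g i) = L i \<and> k (g i) = k i" if "g \<in> G" for g
    using that by (auto simp: G_def fibre_perms_def f_def)
  have G_perm: "g permutes I" if "g \<in> G" for g
    using G_I2(1)[OF that] by (rule permutes_subset) (auto simp: I_def)
  have G_pres: "L (g i) = L i \<and> k' (g i) = k' i" if "g \<in> G" "i \<in> I" for g i
  proof (cases "i \<in> I2")
    case True
    then have "g i \<in> I2" using G_I2(1)[OF that(1)] by (simp add: permutes_in_image)
    then show ?thesis using G_I2(2)[OF that(1) True] True k'2 by simp
  next
    case False then show ?thesis using permutes_not_in[OF G_I2(1)[OF that(1)]] by simp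
  qed
  have G_moved: "2 \<le> l i + k' i" if "g \<in> G" "i \<in> I" "g i \<noteq> i" for g i
  proof -
    have i: "i \<in> I2" using that permutes_not_in[OF G_I2(1)[OF that(1)]] by auto
    then show ?thesis using k'2[OF i] pos(3)[of i] by (auto simp: I2_def)
  qed
  have G_id: "id \<in> G" by (auto simp: G_def fibre_perms_def permutes_id)
  have I_ne: "I \<noteq> {}"
  proof -
    have "1 \<in> I0" using \<open>n > 0\<close> by (simp add: I0_def)
    then show ?thesis using \<rho>I by blast
  qed
  have posI: "subspace (L i) \<and> dim (L i) > 0" if "i \<in> I" for i using pos II0 that by auto
  interpret cc: chess_config I L k'
    by unfold_locales (use finI k'pos posI in auto)
  interpret sg: symmetric_block_grid I cc.dims 2 G
  proof unfold_locales
    show "cc.dims (g i) b = cc.dims i b" if "g \<in> G" "i \<in> I" for g i b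
      using G_pres[OF that] by (simp add: cc.dims_def)
    show "2 \<le> cc.dims i False + cc.dims i True" if "g \<in> G" "i \<in> I" "g i \<noteq> i" for g i
      using G_moved[OF that] by (simp add: cc.dims_def l_def)
    show "g \<circ> h \<in> G" if "g \<in> G" "h \<in> G" for g h using that fibre_perms_comp unfolding G_def by blast
    show "\<exists>h\<in>G. g \<circ> h = id" if "g \<in> G" for g using that fibre_perms_inverse unfolding G_def by blast
  qed (use I_ne G_id G_perm in auto)
  obtain c where c: "card G * c * (\<Prod>i\<in>I. fact (l i + k' i)) = fact (\<Sum>i\<in>I. l i + k' i)"
    using sg.multinomial_divided_by_symmetries cc.grid.card_D by (auto simp: cc.dims_def l_def)
  obtain N where N: "odd N" "card (fibre_perms I0 f) * N =
      multinom n (\<lambda>i. dim (L i) + k i - 1) * (\<Prod>i\<in>I0. Stirling (l i + k i) (k i))"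
  proof -
    have "fibre_perms I0 f = {g. g permutes {1..n} \<and> (\<forall>i\<in>{1..n}. L (g i) = L i \<and> k (g i) = k i)}"
      by (auto simp: fibre_perms_def f_def I0_def)
    moreover have "(\<Prod>i=1..n. Stirling (dim (L i) + k i - 1) (k i)) = (\<Prod>i\<in>I0. Stirling (l i + k i) (k i))"
      unfolding I0_def[symmetric] using m by simp
    ultimately show ?thesis using parity that by auto
  qed
  let ?S = "\<Prod>i\<in>I2. Stirling (l i + k i) (k i)"
  let ?F = "\<Prod>i\<in>I2. fact (l i + k i) :: nat"
  let ?K = "\<Prod>r\<in>T. fact (k' r) :: nat"
  have S0: "(\<Prod>i\<in>I0. Stirling (l i + k i) (k i)) = ?S"
    unfolding I0 by (subst prod.union_disjoint[OF fin(3,2) I12]) (simp add: I1_def)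
  have F0: "(\<Prod>i\<in>I0. fact (l i + k i)) = ?F"
    unfolding I0 by (subst prod.union_disjoint[OF fin(3,2) I12]) (simp add: I1_def)
  have sumM: "(\<Sum>i=1..n. dim (L i) + k i - 1) = (\<Sum>i\<in>I0. l i + k i)" unfolding I0_def[symmetric] using m by simp
  have mF: "multinom n (\<lambda>i. dim (L i) + k i - 1) * ?F = fact (\<Sum>i\<in>I0. l i + k i)"
  proof -
    have "(\<Prod>i=1..n. fact (dim (L i) + k i - 1)) = ?F" unfolding F0[symmetric] I0_def[symmetric] using m by simp
    moreover have "?F dvd fact (\<Sum>i\<in>I0. l i + k i)"
      using prod_fact_dvd_fact_sum[OF fin(1), of k l] pos(3) unfolding F0 by simp
    ultimately show ?thesis unfolding multinom_def sumM by simp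
  qed
  \<comment> \<open>Multiplying the hypothesis by \<open>?F\<close> clears the division in
    \<open>multinom\<close>; cancelling then leaves \<open>N = c * ?S\<close>, so both factors are
    odd.\<close>
  have "card G * ?K * N * ?F = (multinom n (\<lambda>i. dim (L i) + k i - 1) * ?S) * ?F"
    using N(2) unfolding cardG S0 by (simp only:)
  also have "\<dots> = (multinom n (\<lambda>i. dim (L i) + k i - 1) * ?F) * ?S" by (simp only: ac_simps)
  also have "\<dots> = fact (\<Sum>i\<in>I0. l i + k i) * ?S" by (simp only: mF)
  also have "fact (\<Sum>i\<in>I0. l i + k i) = card G * c * (?F * ?K)" using c unfolding sum_I fact_I by simp
  finally have "(card G * ?K * ?F) * N = (card G * ?K * ?F) * (c * ?S)" by (simp only: ac_simps)
  moreover have "card G * ?K * ?F \<noteq> 0" using sg.finite_G G_id fin finT by auto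
  ultimately have "N = c * ?S" by (simp only: mult_cancel1) blast
  then have odds: "odd c" "odd ?S" using N(1) by auto
  have binom: "odd ((l i + ((k' i + 1) div 2 - 1)) choose l i)" if i: "i \<in> I" for i
  proof (cases "i \<in> I2")
    case True
    then have "odd (Stirling (l i + k i) (k i))" using odds(2) fin by (auto simp: even_prod_iff)
    then show ?thesis using even_Stirling_iff_even_binomial[of "k i" "l i"] k'2[OF True] pos(3)[of i] True
      by (simp add: I0)
  next
    case False then show ?thesis using i lT by (auto simp: I_def)
  qed
  interpret cm: chess_measures I L k' G \<mu> c
  proof unfold_locales
    show "card G * c * (\<Prod>i\<in>I. fact (dim (L i) - 1 + k' i)) = fact (\<Sum>i\<in>I. dim (L i) - 1 + k' i)"
      using c by (simp add: l_def)
    show "odd (dim (L i) - 1 + ((k' i + 1) div 2 - 1) choose (dim (L i) - 1))" if "i \<in> I" for i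
      using binom[OF that] by (simp add: l_def)
    show "sets (\<mu> j) = sets borel \<and> finite_measure (\<mu> j)" if "j \<in> {1..(\<Sum>i\<in>I. dim (L i) - 1 + k' i)}" for j
      using meas that sum_I unfolding sumM l_def by simp
    show "2 \<le> dim (L i) - 1 + k' i" if "g \<in> G" "i \<in> I" "g i \<noteq> i" for g i using G_moved[OF that] by (simp add: l_def)
  qed (use I_ne G_id G_perm G_pres sg.G_comp sg.G_inv odds in auto)
  obtain z where z: "\<And>j. j \<in> {1..(\<Sum>i=1..n. dim (L i) + k i - 1)} \<Longrightarrow> bisects (cc.chess z) (\<mu> j)"
  proof -
    have "card cc.grid.D = (\<Sum>i=1..n. dim (L i) + k i - 1)"
      unfolding cm.card_D sumM sum_I[symmetric] by (simp add: l_def)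
    with cm.bisecting_config have "\<exists>z. \<forall>j\<in>{1..(\<Sum>i=1..n. dim (L i) + k i - 1)}. bisects (cc.chess z) (\<mu> j)"
      by (simp only:)
    then show ?thesis using that by blast
  qed
  \<comment> \<open>The \<open>k' r\<close> affine factors of the polynomial at \<open>r\<close> are
    distributed over the pairs \<open>(i, j)\<close> with \<open>\<rho> i = r\<close>, so each
    merged index gets back its own hyperplane.\<close>
  define A where "A r = (SIGMA i:{i\<in>I0. \<rho> i = r}. {1..k i})" for r
  have cardA: "card (A r) = k' r" for r unfolding A_def k'_def using fin by (simp add: card_SigmaI)
  have "\<forall>r\<in>I. \<exists>s c. (\<forall>a\<in>A r. (s a, c a) \<noteq> (0,0)) \<and>
      (\<forall>t. sgn (poly (cc.config_poly r z) t) = sgn (\<Prod>a\<in>A r. s a * t + c a))"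
  proof
    fix r assume r: "r \<in> I"
    have "finite (A r)" "A r \<noteq> {}" using cardA[of r] k'pos[OF r] by (auto intro: card_ge_0_finite)
    then show "\<exists>s c. (\<forall>a\<in>A r. (s a, c a) \<noteq> (0,0)) \<and>
      (\<forall>t. sgn (poly (cc.config_poly r z) t) = sgn (\<Prod>a\<in>A r. s a * t + c a))"
      by (rule sgn_poly_eq_sgn_prod_linear) (use cc.config_poly_nonzero[OF r] cc.degree_config_poly cardA in auto)
  qed
  then obtain s b where sb: "\<And>r a. r \<in> I \<Longrightarrow> a \<in> A r \<Longrightarrow> (s r a, b r a) \<noteq> (0,0)"
    "\<And>r t. r \<in> I \<Longrightarrow> sgn (poly (cc.config_poly r z) t) = sgn (\<Prod>a\<in>A r. s r a * t + b r a)" by metis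
  \<comment> \<open>Merged indices share one direction, which lies in \<open>L i\<close> because
    \<open>L (\<rho> i) = L i\<close>.\<close>
  define u where "u i = cc.direction (\<rho> i) z" for i
  define v where "v i = (1 / norm (u i)) *\<^sub>R u i" for i
  define H where "H i j = (s (\<rho> i) (i, j) *\<^sub>R u i, b (\<rho> i) (i, j))" for i j
  have u: "u i \<noteq> 0" "u i \<in> L i" if "i \<in> I0" for i
    using cc.direction_nonzero[OF \<rho>I(1)[OF that]] cc.direction_in[OF \<rho>I(1)[OF that]] \<rho>I(2)[OF that] by (auto simp: u_def)
  have vH: "\<forall>i\<in>I0. v i \<in> L i \<and> norm (v i) = 1 \<and> (\<forall>j\<in>{1..k i}. H i j \<noteq> (0, 0) \<and> orth_to (H i j) (v i))"
  proof (intro conjI ballI)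
    fix i assume i: "i \<in> I0"
    show "v i \<in> L i" unfolding v_def using pos(1)[OF i] u(2)[OF i] by (rule subspace_scale)
    show "norm (v i) = 1" using u(1)[OF i] by (simp add: v_def)
    fix j assume j: "j \<in> {1..k i}"
    have "(i, j) \<in> A (\<rho> i)" using i j by (auto simp: A_def)
    then show "H i j \<noteq> (0, 0)" using sb(1)[OF \<rho>I(1)[OF i]] u(1)[OF i] by (auto simp: H_def)
    have "s (\<rho> i) (i, j) *\<^sub>R u i = (s (\<rho> i) (i, j) * norm (u i)) *\<^sub>R v i" using u(1)[OF i] by (simp add: v_def)
    then show "orth_to (H i j) (v i)" unfolding orth_to_def H_def by (simp add: span_mul span_base)
  qed
  have "bisects (\<lambda>x. \<Prod>i=1..n. \<Prod>j=1..k i. aff_fun (H i j) x) (\<mu> j)"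
    if j: "j \<in> {1..(\<Sum>i=1..n. dim (L i) + k i - 1)}" for j
  proof -
    have "sgn (\<Prod>i=1..n. \<Prod>j=1..k i. aff_fun (H i j) x) = sgn (cc.chess z x)" for x
    proof -
      have "(\<Prod>i\<in>I0. \<Prod>j=1..k i. aff_fun (H i j) x) =
          (\<Prod>r\<in>I. \<Prod>i\<in>{i\<in>I0. \<rho> i = r}. \<Prod>j=1..k i. aff_fun (H i j) x)"
        by (rule prod.group[symmetric, OF fin(1) finI]) (use \<rho>I in auto)
      also have "\<dots> = (\<Prod>r\<in>I. \<Prod>a\<in>A r. s r a * inner x (cc.direction r z) + b r a)"
      proof (rule prod.cong)
        fix r
        have "(\<Prod>i\<in>{i\<in>I0. \<rho> i = r}. \<Prod>j=1..k i. aff_fun (H i j) x) =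
           (\<Prod>i\<in>{i\<in>I0. \<rho> i = r}. \<Prod>j=1..k i. s r (i, j) * inner x (cc.direction r z) + b r (i, j))"
          by (intro prod.cong) (auto simp: aff_fun_def H_def u_def)
        also have "\<dots> = (\<Prod>a\<in>A r. s r a * inner x (cc.direction r z) + b r a)"
          unfolding A_def using fin by (subst prod.Sigma) (auto intro!: prod.cong)
        finally show "(\<Prod>i\<in>{i\<in>I0. \<rho> i = r}. \<Prod>j=1..k i. aff_fun (H i j) x) =
           (\<Prod>a\<in>A r. s r a * inner x (cc.direction r z) + b r a)" .
      qed simp
      also have "sgn \<dots> = (\<Prod>r\<in>I. sgn (poly (cc.config_poly r z) (inner x (cc.direction r z))))"
        using sb(2) by (simp add: sgn_prod)
      also have "\<dots> = sgn (cc.chess z x)" unfolding cc.chess_def by (simp add: sgn_prod)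
      finally show ?thesis by (simp add: I0_def)
    qed
    then show ?thesis by (rule iffD2[OF bisects_sgn_cong z[OF j]])
  qed
  then have "\<forall>j\<in>{1..(\<Sum>i=1..n. dim (L i) + k i - 1)}.
        bisects (\<lambda>x. \<Prod>i=1..n. \<Prod>j=1..k i. aff_fun (H i j) x) (\<mu> j)" by (rule ballI)
  from conjI[OF vH this] show ?thesis unfolding I0_def by (intro exI[of _ v] exI[of _ H])
qed

end
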